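(* Let $\pi : E \to M$ be a smooth real vector bundle of finite fibre dimension over a smooth manifold $M$, let $\gamma \in \Gamma^\infty(\Lambda^2 E)$, and let $\mathcal{U} \subseteq E$ be an open neighbourhood of the zero section of $E$. Then there exist a natural number $d$, $2d$ smooth vector fields $X_1, \ldots, X_d, Y_1, \ldots, Y_d \in \Gamma^\infty(TE)$ on the total space $E$, and an open neighbourhood $\tilde{\mathcal{U}} \subseteq \mathcal{U}$ of the zero section such that: (1) $X_i, Y_i \in \Gamma^\infty(\mathrm{Ver}(TE))$ are vertical for all $i = 1, \ldots, d$. (2) $\operatorname{supp} X_i, \operatorname{supp} Y_i \subseteq \mathcal{U}$ for all $i = 1, \ldots, d$, and $\operatorname{supp} X_i \cap E_p$ and $\operatorname{supp} Y_i \cap E_p$ are compact for all $i = 1, \ldots, d$ and all $p \in M$. (3) $[X_i, X_j] = [X_i, Y_j] = [Y_i, Y_j] = 0$ for all $i, j = 1, \ldots, d$. (4) Each of the vector fields $X_i$, $Y_j$ has complete flow. (5) $\theta = \sum_{i=1}^d X_i \wedge Y_i$ is a vertical Poisson structure such that $\theta$ coincides with the vertical lift $\gamma^{\mathsf{ver}} \in \Gamma^\infty(\Lambda^2 \mathrm{Ver}(TE))$ on $\tilde{\mathcal{U}}$.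
   Context: $\mathrm{Ver}(TE) = \ker T\pi \subseteq TE$ is the vertical subbundle; a $k$-vector field on $E$ is called vertical if it is a section of $\Lambda^k \mathrm{Ver}(TE)$. For $s \in \Gamma^\infty(E)$ the vertical lift $s^{\mathsf{ver}} \in \Gamma^\infty(\mathrm{Ver}(TE))$ is $s^{\mathsf{ver}}(e) = \frac{d}{dt}\big|_{t=0}(e + t\, s(\pi(e)))$; it is extended to sections of tensor (and exterior) powers of $E$ multiplicatively, i.e. $(f\, s_1 \wedge s_2)^{\mathsf{ver}} = (\pi^* f)\, s_1^{\mathsf{ver}} \wedge s_2^{\mathsf{ver}}$ for $f\in C^\infty(M)$. A Poisson structure on $E$ is a bivector field $\theta \in \Gamma^\infty(\Lambda^2 TE)$ whose Schouten bracket $[\![\theta,\theta]\!]$ vanishes. $E_p = \pi^{-1}(p)$. Supports are closed supports. *)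

theory Defs
  imports "HOL-Analysis.Analysis"
begin

section \<open>Smooth manifolds\<close>

text \<open>Meant for open \<open>S\<close> in a finite-dimensional space, where continuity of all iterated
  directional derivatives is the usual notion.\<close>

primrec Ck_on :: "nat \<Rightarrow> 'a::real_normed_vector set \<Rightarrow> ('a \<Rightarrow> 'b::real_normed_vector) \<Rightarrow> bool" where
  "Ck_on 0 S f \<longleftrightarrow> continuous_on S f"
| "Ck_on (Suc k) S f \<longleftrightarrow>
     (\<forall>x\<in>S. f differentiable (at x)) \<and> (\<forall>v. Ck_on k S (\<lambda>x. frechet_derivative f (at x) v))"

definition smooth_on :: "'a::real_normed_vector set \<Rightarrow> ('a \<Rightarrow> 'b::real_normed_vector) \<Rightarrow> bool" where
  "smooth_on S f \<longleftrightarrow> (\<forall>k. Ck_on k S f)"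

text \<open>Model spaces are arbitrary finite-dimensional normed spaces instead of instances of
  \<^class>\<open>euclidean_space\<close>, because the latter have dimension at least one, while manifolds of
  dimension zero and bundles of rank zero are to be included.\<close>

definition finite_dimensional :: "'a::real_normed_vector itself \<Rightarrow> bool" where
  "finite_dimensional _ \<longleftrightarrow> (\<exists>B::'a set. finite B \<and> span B = UNIV)"

type_synonym ('m, 'a) chart = "'m set \<times> ('m \<Rightarrow> 'a)"

definition is_chart :: "('m::topological_space, 'a::real_normed_vector) chart \<Rightarrow> bool" where
  "is_chart = (\<lambda>(U, \<phi>). open U \<and> open (\<phi> ` U) \<and> homeomorphism U (\<phi> ` U) \<phi> (inv_into U \<phi>))"

text \<open>A manifold is a whole type together with an atlas, which need not be maximal.\<close>

definition smooth_manifold ::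
  "('m::{t2_space,second_countable_topology}, 'a::real_normed_vector) chart set \<Rightarrow> bool" where
  "smooth_manifold A \<longleftrightarrow>
     finite_dimensional TYPE('a) \<and>
     (\<forall>c\<in>A. is_chart c) \<and>
     (\<Union>(U, \<phi>)\<in>A. U) = UNIV \<and>
     (\<forall>(U, \<phi>)\<in>A. \<forall>(V, \<psi>)\<in>A. smooth_on (\<phi> ` (U \<inter> V)) (\<psi> \<circ> inv_into U \<phi>))"

definition euclidean_atlas :: "('a::real_normed_vector, 'a) chart set" where
  "euclidean_atlas = {(UNIV, \<lambda>x. x)}"

definition prod_atlas :: "('m, 'a) chart set \<Rightarrow> ('n, 'b) chart set \<Rightarrow> ('m \<times> 'n, 'a \<times> 'b) chart set" where
  "prod_atlas A B = {(U \<times> V, map_prod \<phi> \<psi>) |U \<phi> V \<psi>. (U, \<phi>) \<in> A \<and> (V, \<psi>) \<in> B}"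

text \<open>Smooth maps from an open subset \<open>S\<close> of one manifold to another.\<close>

definition smooth_map_on ::
  "('m::topological_space, 'a::real_normed_vector) chart set \<Rightarrow>
   ('n::topological_space, 'b::real_normed_vector) chart set \<Rightarrow> 'm set \<Rightarrow> ('m \<Rightarrow> 'n) \<Rightarrow> bool" where
  "smooth_map_on A B S f \<longleftrightarrow>
     continuous_on S f \<and>
     (\<forall>(U, \<phi>)\<in>A. \<forall>(V, \<psi>)\<in>B.
        smooth_on (\<phi> ` (U \<inter> S \<inter> f -` V)) (\<psi> \<circ> f \<circ> inv_into U \<phi>))"

definition diffeomorphism_on ::
  "('m::topological_space, 'a::real_normed_vector) chart set \<Rightarrow>
   ('n::topological_space, 'b::real_normed_vector) chart set \<Rightarrow>
   'm set \<Rightarrow> 'n set \<Rightarrow> ('m \<Rightarrow> 'n) \<Rightarrow> bool" where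
  "diffeomorphism_on A B S T f \<longleftrightarrow>
     bij_betw f S T \<and> smooth_map_on A B S f \<and> smooth_map_on B A T (inv_into S f)"

definition smooth_functions ::
  "('m::topological_space, 'a::real_normed_vector) chart set \<Rightarrow> ('m \<Rightarrow> real) set" where
  "smooth_functions A = {f. smooth_map_on A euclidean_atlas UNIV f}"

section \<open>Vector fields\<close>

text \<open>Tangent vectors are derivations at a point. They are made extensional by the value zero on
  functions that are not smooth, so that equality of tangent vectors is equality of functions.\<close>

definition tangent_space ::
  "('m::topological_space, 'a::real_normed_vector) chart set \<Rightarrow> 'm \<Rightarrow> (('m \<Rightarrow> real) \<Rightarrow> real) set" where
  "tangent_space A p = {v.
     (\<forall>f. f \<notin> smooth_functions A \<longrightarrow> v f = 0) \<and>
     (\<forall>f\<in>smooth_functions A. \<forall>g\<in>smooth_functions A. v (\<lambda>q. f q + g q) = v f + v g) \<and>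
     (\<forall>c. \<forall>f\<in>smooth_functions A. v (\<lambda>q. c * f q) = c * v f) \<and>
     (\<forall>f\<in>smooth_functions A. \<forall>g\<in>smooth_functions A.
        v (\<lambda>q. f q * g q) = v f * g p + f p * v g)}"

definition tangent_map ::
  "('n::topological_space, 'b::real_normed_vector) chart set \<Rightarrow> ('m \<Rightarrow> 'n) \<Rightarrow>
   (('m \<Rightarrow> real) \<Rightarrow> real) \<Rightarrow> (('n \<Rightarrow> real) \<Rightarrow> real)" where
  "tangent_map B F v = (\<lambda>g. if g \<in> smooth_functions B then v (g \<circ> F) else 0)"

type_synonym 'm vfield = "'m \<Rightarrow> ('m \<Rightarrow> real) \<Rightarrow> real"

definition vector_field ::
  "('m::topological_space, 'a::real_normed_vector) chart set \<Rightarrow> 'm vfield \<Rightarrow> bool" where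
  "vector_field A X \<longleftrightarrow>
     (\<forall>p. X p \<in> tangent_space A p) \<and>
     (\<forall>f\<in>smooth_functions A. (\<lambda>p. X p f) \<in> smooth_functions A)"

definition vf_support :: "'m::topological_space vfield \<Rightarrow> 'm set" where
  "vf_support X = closure {p. X p \<noteq> (\<lambda>f. 0)}"

definition lie_bracket :: "'m vfield \<Rightarrow> 'm vfield \<Rightarrow> 'm vfield" where
  "lie_bracket X Y = (\<lambda>p f. X p (\<lambda>q. Y q f) - Y p (\<lambda>q. X q f))"

definition integral_curve ::
  "('m::topological_space, 'a::real_normed_vector) chart set \<Rightarrow> 'm vfield \<Rightarrow> (real \<Rightarrow> 'm) \<Rightarrow> bool" where
  "integral_curve A X c \<longleftrightarrow>
     smooth_map_on euclidean_atlas A UNIV c \<and>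
     (\<forall>t. \<forall>f\<in>smooth_functions A. ((\<lambda>s. f (c s)) has_real_derivative X (c t) f) (at t))"

text \<open>The maximal flow of \<open>X\<close> is defined on all of \<open>\<real> \<times> M\<close> iff every point is the start of
  an integral curve defined for all times.\<close>

definition complete_flow ::
  "('m::topological_space, 'a::real_normed_vector) chart set \<Rightarrow> 'm vfield \<Rightarrow> bool" where
  "complete_flow A X \<longleftrightarrow> (\<forall>p. \<exists>c. integral_curve A X c \<and> c 0 = p)"

section \<open>Bivector fields and Poisson structures\<close>

text \<open>For a space \<open>V\<close> of real functions on \<open>I\<close>, the space \<open>V \<otimes> V\<close> embeds into the functions
  on \<open>I \<times> I\<close>, and \<open>\<Lambda>\<^sup>2 V\<close> is realised there as the span of the antisymmetrised products.\<close>

definition wedge :: "('i \<Rightarrow> real) \<Rightarrow> ('i \<Rightarrow> real) \<Rightarrow> 'i \<Rightarrow> 'i \<Rightarrow> real" where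
  "wedge v w = (\<lambda>i j. v i * w j - v j * w i)"

definition wedge3 ::
  "('i \<Rightarrow> real) \<Rightarrow> ('i \<Rightarrow> real) \<Rightarrow> ('i \<Rightarrow> real) \<Rightarrow> 'i \<Rightarrow> 'i \<Rightarrow> 'i \<Rightarrow> real" where
  "wedge3 u v w = (\<lambda>i j k. u i * wedge v w j k + u j * wedge v w k i + u k * wedge v w i j)"

definition exterior_square :: "('i \<Rightarrow> real) set \<Rightarrow> ('i \<Rightarrow> 'i \<Rightarrow> real) set" where
  "exterior_square V =
     {(\<lambda>i j. \<Sum>k<n. wedge (v k) (w k) i j) |(n::nat) v w. \<forall>k<n. v k \<in> V \<and> w k \<in> V}"

type_synonym 'm bivfield = "'m \<Rightarrow> ('m \<Rightarrow> real) \<Rightarrow> ('m \<Rightarrow> real) \<Rightarrow> real"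

definition bivector_field ::
  "('m::topological_space, 'a::real_normed_vector) chart set \<Rightarrow> 'm bivfield \<Rightarrow> bool" where
  "bivector_field A \<theta> \<longleftrightarrow>
     (\<forall>p. \<theta> p \<in> exterior_square (tangent_space A p)) \<and>
     (\<forall>f\<in>smooth_functions A. \<forall>g\<in>smooth_functions A. (\<lambda>p. \<theta> p f g) \<in> smooth_functions A)"

text \<open>The Schouten bracket of two bivector fields, as a triderivation. Lemma \<open>schouten_wedge\<close>
  below is the usual formula in terms of Lie brackets on decomposable bivector fields.\<close>

definition schouten ::
  "'m bivfield \<Rightarrow> 'm bivfield \<Rightarrow> 'm \<Rightarrow> ('m \<Rightarrow> real) \<Rightarrow> ('m \<Rightarrow> real) \<Rightarrow> ('m \<Rightarrow> real) \<Rightarrow> real" where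
  "schouten P Q = (\<lambda>p f g h.
     P p f (\<lambda>q. Q q g h) + P p g (\<lambda>q. Q q h f) + P p h (\<lambda>q. Q q f g) +
     Q p f (\<lambda>q. P q g h) + Q p g (\<lambda>q. P q h f) + Q p h (\<lambda>q. P q f g))"

definition poisson_structure ::
  "('m::topological_space, 'a::real_normed_vector) chart set \<Rightarrow> 'm bivfield \<Rightarrow> bool" where
  "poisson_structure A \<theta> \<longleftrightarrow> bivector_field A \<theta> \<and> schouten \<theta> \<theta> = (\<lambda>p f g h. 0)"

section \<open>Vector bundles\<close>

text \<open>A local trivialisation over \<open>U\<close> is given by its fibre component \<open>\<Phi>\<close>, so that the map
  to \<open>U \<times> 'b\<close> is \<open>e \<mapsto> (\<pi> e, \<Phi> e)\<close>. The operations \<open>fib_add\<close> and \<open>fib_scale\<close> are only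
  relevant within fibres.\<close>

record ('e, 'm, 'c, 'a, 'b) vbundle =
  total_atlas :: "('e, 'c) chart set"
  base_atlas :: "('m, 'a) chart set"
  proj :: "'e \<Rightarrow> 'm"
  fib_zero :: "'m \<Rightarrow> 'e"
  fib_add :: "'e \<Rightarrow> 'e \<Rightarrow> 'e"
  fib_scale :: "real \<Rightarrow> 'e \<Rightarrow> 'e"
  bundle_atlas :: "('m set \<times> ('e \<Rightarrow> 'b)) set"

definition fibre :: "('e, 'm, 'c, 'a, 'b) vbundle \<Rightarrow> 'm \<Rightarrow> 'e set" where
  "fibre E p = {e. proj E e = p}"

definition fibre_vector_space :: "('e, 'm, 'c, 'a, 'b) vbundle \<Rightarrow> 'm \<Rightarrow> bool" where
  "fibre_vector_space E p \<longleftrightarrow>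
     fib_zero E p \<in> fibre E p \<and>
     (\<forall>x\<in>fibre E p. \<forall>y\<in>fibre E p. fib_add E x y \<in> fibre E p) \<and>
     (\<forall>r. \<forall>x\<in>fibre E p. fib_scale E r x \<in> fibre E p) \<and>
     (\<forall>x\<in>fibre E p. \<forall>y\<in>fibre E p. \<forall>z\<in>fibre E p.
        fib_add E (fib_add E x y) z = fib_add E x (fib_add E y z)) \<and>
     (\<forall>x\<in>fibre E p. \<forall>y\<in>fibre E p. fib_add E x y = fib_add E y x) \<and>
     (\<forall>x\<in>fibre E p. fib_add E (fib_zero E p) x = x) \<and>
     (\<forall>x\<in>fibre E p. \<exists>y\<in>fibre E p. fib_add E x y = fib_zero E p) \<and>
     (\<forall>r. \<forall>x\<in>fibre E p. \<forall>y\<in>fibre E p.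
        fib_scale E r (fib_add E x y) = fib_add E (fib_scale E r x) (fib_scale E r y)) \<and>
     (\<forall>r s. \<forall>x\<in>fibre E p.
        fib_scale E (r + s) x = fib_add E (fib_scale E r x) (fib_scale E s x)) \<and>
     (\<forall>r s. \<forall>x\<in>fibre E p. fib_scale E r (fib_scale E s x) = fib_scale E (r * s) x) \<and>
     (\<forall>x\<in>fibre E p. fib_scale E 1 x = x)"

definition local_trivialization ::
  "('e::topological_space, 'm::topological_space, 'c::real_normed_vector,
    'a::real_normed_vector, 'b::real_normed_vector) vbundle \<Rightarrow> 'm set \<Rightarrow> ('e \<Rightarrow> 'b) \<Rightarrow> bool" where
  "local_trivialization E U \<Phi> \<longleftrightarrow>
     open U \<and>
     diffeomorphism_on (total_atlas E) (prod_atlas (base_atlas E) euclidean_atlas)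
       (proj E -` U) (U \<times> UNIV) (\<lambda>e. (proj E e, \<Phi> e)) \<and>
     (\<forall>p\<in>U. \<forall>x\<in>fibre E p. \<forall>y\<in>fibre E p. \<Phi> (fib_add E x y) = \<Phi> x + \<Phi> y) \<and>
     (\<forall>p\<in>U. \<forall>r. \<forall>x\<in>fibre E p. \<Phi> (fib_scale E r x) = r *\<^sub>R \<Phi> x)"

definition smooth_vector_bundle ::
  "('e::{t2_space,second_countable_topology}, 'm::{t2_space,second_countable_topology},
    'c::real_normed_vector, 'a::real_normed_vector, 'b::real_normed_vector) vbundle \<Rightarrow> bool" where
  "smooth_vector_bundle E \<longleftrightarrow>
     smooth_manifold (total_atlas E) \<and>
     smooth_manifold (base_atlas E) \<and>
     finite_dimensional TYPE('b) \<and>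
     smooth_map_on (total_atlas E) (base_atlas E) UNIV (proj E) \<and>
     (\<forall>p. fibre_vector_space E p) \<and>
     (\<forall>(U, \<Phi>)\<in>bundle_atlas E. local_trivialization E U \<Phi>) \<and>
     (\<Union>(U, \<Phi>)\<in>bundle_atlas E. U) = UNIV"

text \<open>Elements of the dual of a fibre are extended by zero outside of the fibre.\<close>

definition fibre_dual :: "('e, 'm, 'c, 'a, 'b) vbundle \<Rightarrow> 'm \<Rightarrow> ('e \<Rightarrow> real) set" where
  "fibre_dual E p = {\<alpha>.
     (\<forall>e. e \<notin> fibre E p \<longrightarrow> \<alpha> e = 0) \<and>
     (\<forall>x\<in>fibre E p. \<forall>y\<in>fibre E p. \<alpha> (fib_add E x y) = \<alpha> x + \<alpha> y) \<and>
     (\<forall>r. \<forall>x\<in>fibre E p. \<alpha> (fib_scale E r x) = r * \<alpha> x)}"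

text \<open>The embedding of the fibre into its bidual, which makes \<^const>\<open>exterior_square\<close> applicable.\<close>

definition fibre_eval :: "('e, 'm, 'c, 'a, 'b) vbundle \<Rightarrow> 'e \<Rightarrow> ('e \<Rightarrow> real) \<Rightarrow> real" where
  "fibre_eval E e = (\<lambda>\<alpha>. if \<alpha> \<in> fibre_dual E (proj E e) then \<alpha> e else 0)"

text \<open>Smooth sections of \<open>\<Lambda>\<^sup>2 E\<close>; smoothness is that of the components in the local frames.\<close>

definition smooth_bivector_section ::
  "('e, 'm::topological_space, 'c, 'a::real_normed_vector, 'b::real_normed_vector) vbundle \<Rightarrow>
   ('m \<Rightarrow> ('e \<Rightarrow> real) \<Rightarrow> ('e \<Rightarrow> real) \<Rightarrow> real) \<Rightarrow> bool" where
  "smooth_bivector_section E \<gamma> \<longleftrightarrow>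
     (\<forall>p. \<gamma> p \<in> exterior_square (fibre_eval E ` fibre E p)) \<and>
     (\<forall>(U, \<Phi>)\<in>bundle_atlas E. \<forall>(\<alpha>::'b \<Rightarrow> real) (\<beta>::'b \<Rightarrow> real). linear \<alpha> \<longrightarrow> linear \<beta> \<longrightarrow>
        smooth_map_on (base_atlas E) euclidean_atlas U
          (\<lambda>p. \<gamma> p (\<lambda>e. if e \<in> fibre E p then \<alpha> (\<Phi> e) else 0)
                   (\<lambda>e. if e \<in> fibre E p then \<beta> (\<Phi> e) else 0)))"

definition vertical_space ::
  "('e::topological_space, 'm::topological_space, 'c::real_normed_vector,
    'a::real_normed_vector, 'b) vbundle \<Rightarrow> 'e \<Rightarrow> (('e \<Rightarrow> real) \<Rightarrow> real) set" where
  "vertical_space E e =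
     {v \<in> tangent_space (total_atlas E) e. tangent_map (base_atlas E) (proj E) v = (\<lambda>g. 0)}"

text \<open>The vertical lift of \<open>s \<in> E\<^sub>p\<close> at \<open>e \<in> E\<^sub>p\<close>, the velocity of \<open>t \<mapsto> e + t s\<close> at \<open>0\<close>.\<close>

definition vertical_lift_at ::
  "('e::topological_space, 'm, 'c::real_normed_vector, 'a, 'b) vbundle \<Rightarrow>
   'e \<Rightarrow> 'e \<Rightarrow> ('e \<Rightarrow> real) \<Rightarrow> real" where
  "vertical_lift_at E e s = (\<lambda>f. if f \<in> smooth_functions (total_atlas E)
     then deriv (\<lambda>t. f (fib_add E e (fib_scale E t s))) 0 else 0)"

text \<open>The map induced by \<^const>\<open>vertical_lift_at\<close> on \<open>\<Lambda>\<^sup>2 E\<^sub>p\<close>: as \<open>f\<close> is fixed, \<open>s \<mapsto> s\<^sup>v\<^sup>e\<^sup>r f\<close>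
  is a linear functional on the fibre, at which \<open>\<gamma>\<close> is evaluated. Multiplicativity is lemma
  \<open>vertical_lift_wedge\<close> below.\<close>

definition fibre_differential ::
  "('e::topological_space, 'm, 'c::real_normed_vector, 'a, 'b) vbundle \<Rightarrow>
   'e \<Rightarrow> ('e \<Rightarrow> real) \<Rightarrow> 'e \<Rightarrow> real" where
  "fibre_differential E e f =
     (\<lambda>s. if s \<in> fibre E (proj E e) then vertical_lift_at E e s f else 0)"

definition vertical_lift ::
  "('e::topological_space, 'm, 'c::real_normed_vector, 'a, 'b) vbundle \<Rightarrow>
   ('m \<Rightarrow> ('e \<Rightarrow> real) \<Rightarrow> ('e \<Rightarrow> real) \<Rightarrow> real) \<Rightarrow> 'e bivfield" where
  "vertical_lift E \<gamma> =
     (\<lambda>e f g. \<gamma> (proj E e) (fibre_differential E e f) (fibre_differential E e g))"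

section \<open>Consistency of the definitions\<close>

lemma Ck_on_cong:
  assumes "open S" "\<And>x. x \<in> S \<Longrightarrow> f x = g x" "Ck_on k S f"
  shows "Ck_on k S g"
  using assms(2,3)
proof (induction k arbitrary: f g)
  case 0
  then show ?case by (metis Ck_on.simps(1) continuous_on_cong)
next
  case (Suc k)
  have d: "(g has_derivative frechet_derivative f (at x)) (at x)" if "x \<in> S" for x
  proof -
    have "(f has_derivative frechet_derivative f (at x)) (at x)"
      using Suc.prems(2) that frechet_derivative_works by auto
    then show ?thesis
      using has_derivative_transform_within_open[OF _ assms(1) that] Suc.prems(1) by blast
  qed
  have "Ck_on k S (\<lambda>x. frechet_derivative g (at x) v)" for v
  proof (rule Suc.IH)
    show "Ck_on k S (\<lambda>x. frechet_derivative f (at x) v)" using Suc.prems(2) by simp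
    show "frechet_derivative f (at x) v = frechet_derivative g (at x) v" if "x \<in> S" for x
      using frechet_derivative_at[OF d[OF that]] by metis
  qed
  then show ?case using d by (auto simp: differentiable_def)
qed

lemma Ck_on_SucD: "open S \<Longrightarrow> Ck_on (Suc k) S f \<Longrightarrow> Ck_on k S f"
proof (induction k arbitrary: f)
  case 0
  then show ?case
    by (auto intro!: differentiable_imp_continuous_on simp: differentiable_on_def
        differentiable_at_withinI)
next
  case (Suc k)
  then show ?case by (simp only: Ck_on.simps(2)) blast
qed

lemma Ck_on_const: "Ck_on k S (\<lambda>x. c)"
  by (induction k arbitrary: c) (auto simp: frechet_derivative_const)

lemma Ck_on_add:
  assumes "open S" "Ck_on k S f" "Ck_on k S g"
  shows "Ck_on k S (\<lambda>x. f x + g x)"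
  using assms(2,3)
proof (induction k arbitrary: f g)
  case 0 then show ?case by (auto intro: continuous_on_add)
next
  case (Suc k)
  have "Ck_on k S (\<lambda>x. frechet_derivative (\<lambda>x. f x + g x) (at x) v)" for v
  proof (rule Ck_on_cong[OF assms(1)])
    show "Ck_on k S (\<lambda>x. frechet_derivative f (at x) v + frechet_derivative g (at x) v)"
      by (rule Suc.IH) (use Suc.prems in auto)
    fix x assume "x \<in> S"
    then have "((\<lambda>x. f x + g x) has_derivative
       (\<lambda>h. frechet_derivative f (at x) h + frechet_derivative g (at x) h)) (at x)"
      using Suc.prems by (intro has_derivative_add) (auto simp: frechet_derivative_works[symmetric])
    from frechet_derivative_at[OF this]
    show "frechet_derivative f (at x) v + frechet_derivative g (at x) v
       = frechet_derivative (\<lambda>x. f x + g x) (at x) v" by metis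
  qed
  then show ?case using Suc.prems by (auto intro: differentiable_add)
qed

lemma Ck_on_mult:
  fixes f g :: "'a::real_normed_vector \<Rightarrow> real"
  assumes "open S" "Ck_on k S f" "Ck_on k S g"
  shows "Ck_on k S (\<lambda>x. f x * g x)"
  using assms(2,3)
proof (induction k arbitrary: f g)
  case 0 then show ?case by (auto intro: continuous_on_mult)
next
  case (Suc k)
  have fg: "Ck_on k S f" "Ck_on k S g" using Suc.prems Ck_on_SucD assms(1) by blast+
  have "Ck_on k S (\<lambda>x. frechet_derivative (\<lambda>x. f x * g x) (at x) v)" for v
  proof (rule Ck_on_cong[OF assms(1)])
    show "Ck_on k S (\<lambda>x. f x * frechet_derivative g (at x) v + frechet_derivative f (at x) v * g x)"
      by (intro Ck_on_add assms(1) Suc.IH fg) (use Suc.prems in auto)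
    fix x assume "x \<in> S"
    then have "((\<lambda>x. f x * g x) has_derivative
       (\<lambda>h. f x * frechet_derivative g (at x) h + frechet_derivative f (at x) h * g x)) (at x)"
      using Suc.prems by (intro has_derivative_mult) (auto simp: frechet_derivative_works[symmetric])
    from frechet_derivative_at[OF this]
    show "f x * frechet_derivative g (at x) v + frechet_derivative f (at x) v * g x
       = frechet_derivative (\<lambda>x. f x * g x) (at x) v" by metis
  qed
  then show ?case using Suc.prems by (auto intro: differentiable_mult)
qed

lemma smooth_functions_iff:
  assumes "smooth_manifold A"
  shows "f \<in> smooth_functions A \<longleftrightarrow>
     continuous_on UNIV f \<and> (\<forall>(U,\<phi>)\<in>A. smooth_on (\<phi> ` U) (f \<circ> inv_into U \<phi>))"
  by (auto simp: smooth_functions_def smooth_map_on_def euclidean_atlas_def o_def)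

lemma
  assumes "smooth_manifold A" "f \<in> smooth_functions A" "g \<in> smooth_functions A"
  shows sf_add: "(\<lambda>x. f x + g x) \<in> smooth_functions A"
   and sf_mult: "(\<lambda>x. f x * g x) \<in> smooth_functions A"
proof -
  have op: "open (\<phi> ` U)" if "(U,\<phi>) \<in> A" for U \<phi>
    using assms(1) that by (auto simp: smooth_manifold_def is_chart_def)
  show "(\<lambda>x. f x + g x) \<in> smooth_functions A" 
    using assms(2,3) op unfolding smooth_functions_iff[OF assms(1)] smooth_on_def o_def
    by (auto intro!: continuous_on_add Ck_on_add)
  show "(\<lambda>x. f x * g x) \<in> smooth_functions A" 
    using assms(2,3) op unfolding smooth_functions_iff[OF assms(1)] smooth_on_def o_def
    by (auto intro!: continuous_on_mult Ck_on_mult)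
qed

lemma sf_const: "smooth_manifold A \<Longrightarrow> (\<lambda>x. c) \<in> smooth_functions A"
  by (auto simp: smooth_functions_iff smooth_on_def o_def Ck_on_const)

lemma tangent_spaceD:
  assumes "v \<in> tangent_space A p"
  shows "\<And>f g. f \<in> smooth_functions A \<Longrightarrow> g \<in> smooth_functions A \<Longrightarrow> v (\<lambda>q. f q + g q) = v f + v g"
    and "\<And>c f. f \<in> smooth_functions A \<Longrightarrow> v (\<lambda>q. c * f q) = c * v f"
    and "\<And>f g. f \<in> smooth_functions A \<Longrightarrow> g \<in> smooth_functions A \<Longrightarrow>
      v (\<lambda>q. f q * g q) = v f * g p + f p * v g"
  using assms by (simp_all add: tangent_space_def)

lemma schouten_wedge:
  assumes A: "smooth_manifold A"
    and vf: "vector_field A X" "vector_field A Y" "vector_field A Z" "vector_field A W"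
    and fgh: "f \<in> smooth_functions A" "g \<in> smooth_functions A" "h \<in> smooth_functions A"
  shows "schouten (\<lambda>p. wedge (X p) (Y p)) (\<lambda>p. wedge (Z p) (W p)) p f g h =
    wedge3 (lie_bracket X Z p) (Y p) (W p) f g h - wedge3 (lie_bracket X W p) (Y p) (Z p) f g h
    - wedge3 (lie_bracket Y Z p) (X p) (W p) f g h + wedge3 (lie_bracket Y W p) (X p) (Z p) f g h"
proof -
  have cl: "(\<lambda>q. V q k) \<in> smooth_functions A" if "vector_field A V" "k \<in> smooth_functions A" for V k
    using that by (simp add: vector_field_def)
  have *: "V p (\<lambda>q. a q * b q - c q * d q) = V p a * b p + a p * V p b - (V p c * d p + c p * V p d)"
    if V: "vector_field A V" and "a \<in> smooth_functions A" "b \<in> smooth_functions A" "c \<in> smooth_functions A"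
      "d \<in> smooth_functions A" for V a b c d
  proof -
    have t: "V p \<in> tangent_space A p" using V by (simp add: vector_field_def)
    note m = sf_mult[OF A]
    have "(\<lambda>q. -1 * (c q * d q)) \<in> smooth_functions A"
      by (intro m sf_const A that)
    from tangent_spaceD(1)[OF t m[OF that(2,3)] this]
    have "V p (\<lambda>q. a q * b q + -1 * (c q * d q)) = V p (\<lambda>q. a q * b q) + V p (\<lambda>q. -1 * (c q * d q))"
      .
    also have "V p (\<lambda>q. -1 * (c q * d q)) = -1 * V p (\<lambda>q. c q * d q)"
      using tangent_spaceD(2)[OF t m[OF that(4,5)], of "-1"] by simp
    also have "V p (\<lambda>q. c q * d q) = V p c * d p + c p * V p d"
      using tangent_spaceD(3)[OF t that(4,5)] by simp
    also have "V p (\<lambda>q. a q * b q) = V p a * b p + a p * V p b"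
      using tangent_spaceD(3)[OF t that(2,3)] by simp
    finally show ?thesis by simp
  qed
  note vs = vf(1)[THEN *] vf(2)[THEN *] vf(3)[THEN *] vf(4)[THEN *]
  show ?thesis
    unfolding schouten_def wedge_def wedge3_def lie_bracket_def
    by (simp only: vs cl vf fgh) algebra
qed

lemma smooth_on_differentiable:
  assumes "smooth_on S f" "x \<in> S" shows "f differentiable (at x)"
  using assms by (metis smooth_on_def Ck_on.simps(2))

lemma fibre_derivative:
  fixes E :: "('e::{t2_space,second_countable_topology}, 'm::{t2_space,second_countable_topology},
      'c::real_normed_vector, 'a::real_normed_vector, 'b::real_normed_vector) vbundle"
  assumes E: "smooth_vector_bundle E" and tr: "(U, \<Phi>) \<in> bundle_atlas E" "proj E e \<in> U"
    and f: "f \<in> smooth_functions (total_atlas E)"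
  obtains D where "bounded_linear D"
    and "\<And>s. s \<in> fibre E (proj E e) \<Longrightarrow>
      ((\<lambda>t. f (fib_add E e (fib_scale E t s))) has_real_derivative D (\<Phi> s)) (at 0)"
proof -
  let ?p = "proj E e" and ?F = "\<lambda>e. (proj E e, \<Phi> e)"
  let ?G = "inv_into (proj E -` U) ?F"
  have mE: "smooth_manifold (total_atlas E)" and mM: "smooth_manifold (base_atlas E)"
    and fv: "fibre_vector_space E ?p"
    and lt: "local_trivialization E U \<Phi>"
    using E tr unfolding smooth_vector_bundle_def by auto
  have bij: "bij_betw ?F (proj E -` U) (U \<times> UNIV)" and oU: "open U"
    and G: "smooth_map_on (prod_atlas (base_atlas E) euclidean_atlas) (total_atlas E) (U \<times> UNIV) ?G"
    and add: "\<And>x y. x \<in> fibre E ?p \<Longrightarrow> y \<in> fibre E ?p \<Longrightarrow> \<Phi> (fib_add E x y) = \<Phi> x + \<Phi> y"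
    and scale: "\<And>r x. x \<in> fibre E ?p \<Longrightarrow> \<Phi> (fib_scale E r x) = r *\<^sub>R \<Phi> x"
    using lt tr(2) unfolding local_trivialization_def diffeomorphism_on_def by auto
  have GF: "?G (?F x) = x" if "proj E x \<in> U" for x
    using inv_into_f_f[OF bij_betw_imp_inj_on[OF bij], of x] that by simp
  obtain V \<phi> where V: "(V, \<phi>) \<in> base_atlas E" "?p \<in> V"
    using mM unfolding smooth_manifold_def by blast
  obtain W \<psi> where W: "(W, \<psi>) \<in> total_atlas E" "e \<in> W"
    using mE unfolding smooth_manifold_def by blast
  have oW: "open W" and homW: "homeomorphism W (\<psi> ` W) \<psi> (inv_into W \<psi>)"
    using W mE unfolding smooth_manifold_def is_chart_def by auto
  have homV: "homeomorphism V (\<phi> ` V) \<phi> (inv_into V \<phi>)"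
    using V mM unfolding smooth_manifold_def is_chart_def by auto
  have injV: "inj_on \<phi> V" using homV by (metis homeomorphism_def inj_on_inverseI)
  let ?Q = "map_prod \<phi> (\<lambda>x::'b. x)"
  have ch: "(V \<times> UNIV, ?Q) \<in> prod_atlas (base_atlas E) euclidean_atlas"
    using V by (auto simp: prod_atlas_def euclidean_atlas_def)
  let ?K = "\<psi> \<circ> ?G \<circ> inv_into (V \<times> UNIV) ?Q"
  have inj: "inj_on ?Q (V \<times> UNIV)" using injV by (auto simp: inj_on_def)
  have iv: "inv_into (V \<times> UNIV) ?Q (\<phi> ?p, v) = (?p, v)" for v
    using inv_into_f_f[OF inj, of "(?p, v)"] V by simp
  have "smooth_on (?Q ` ((V \<times> UNIV) \<inter> (U \<times> UNIV) \<inter> ?G -` W)) ?K"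
    using G ch W unfolding smooth_map_on_def by fastforce
  moreover have "(\<phi> ?p, \<Phi> e) \<in> ?Q ` ((V \<times> UNIV) \<inter> (U \<times> UNIV) \<inter> ?G -` W)"
    using V W tr(2) GF[of e] by (force simp: image_iff)
  ultimately have "?K differentiable (at (\<phi> ?p, \<Phi> e))"
    by (rule smooth_on_differentiable)
  then obtain DK where DK: "(?K has_derivative DK) (at (\<phi> ?p, \<Phi> e))"
    by (auto simp: differentiable_def)
  have ptK: "?K (\<phi> ?p, v) = \<psi> (?G (?p, v))" for v using iv by simp
  have fs: "smooth_on (\<psi> ` W) (f \<circ> inv_into W \<psi>)"
    using f smooth_functions_iff[OF mE] W by auto
  then obtain Df where Df: "((f \<circ> inv_into W \<psi>) has_derivative Df) (at (\<psi> e))"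
    using smooth_on_differentiable W by (fastforce simp: differentiable_def)
  have pr: "((\<lambda>v. (\<phi> ?p, v)) has_derivative (\<lambda>v. (0, v))) (at (\<Phi> e))"
    by (auto intro!: derivative_eq_intros)
  have "((\<lambda>v. ?K (\<phi> ?p, v)) has_derivative (\<lambda>v. DK (0, v))) (at (\<Phi> e))"
    using has_derivative_compose[OF pr DK] .
  then have a: "((\<lambda>v. \<psi> (?G (?p, v))) has_derivative (\<lambda>v. DK (0, v))) (at (\<Phi> e))"
    using ptK by simp
  have "((\<lambda>v. (f \<circ> inv_into W \<psi>) (\<psi> (?G (?p, v)))) has_derivative (\<lambda>v. Df (DK (0, v)))) (at (\<Phi> e))"
    using has_derivative_compose[OF a, of "f \<circ> inv_into W \<psi>" Df] Df GF[of e] tr(2) by simp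
  moreover have cG: "continuous_on UNIV (\<lambda>v. ?G (?p, v))"
    using G tr(2) unfolding smooth_map_on_def
    by (intro continuous_on_compose2[where f = "\<lambda>v. (?p, v)" and g = ?G and t = "U \<times> UNIV"])
       (auto intro!: continuous_intros)
  moreover have "open ((\<lambda>v. ?G (?p, v)) -` W)"
    using cG oW by (simp add: open_vimage)
  ultimately have D: "((\<lambda>v. f (?G (?p, v))) has_derivative (\<lambda>v. Df (DK (0, v)))) (at (\<Phi> e))"
    apply (elim has_derivative_transform_within_open[where s = "(\<lambda>v. ?G (?p, v)) -` W"])
    using GF[of e] tr(2) W homW by (auto simp: homeomorphism_def)
  show ?thesis
  proof
    show bl: "bounded_linear (\<lambda>v. Df (DK (0, v)))" using D by (rule has_derivative_bounded_linear)
    fix s assume s: "s \<in> fibre E ?p"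
    have c: "((\<lambda>t. \<Phi> e + t *\<^sub>R \<Phi> s) has_derivative (\<lambda>t. t *\<^sub>R \<Phi> s)) (at 0)"
      by (auto intro!: derivative_eq_intros)
    have "((\<lambda>t. f (?G (?p, \<Phi> e + t *\<^sub>R \<Phi> s))) has_derivative (\<lambda>t. Df (DK (0, t *\<^sub>R \<Phi> s)))) (at 0)"
      using has_derivative_compose[OF c, of "\<lambda>v. f (?G (?p, v))"] D by simp
    moreover have "Df (DK (0, t *\<^sub>R \<Phi> s)) = t * Df (DK (0, \<Phi> s))" for t
      using bl linear_cmul[OF bounded_linear.linear[OF bl]] by simp
    moreover have "?G (?p, \<Phi> e + t *\<^sub>R \<Phi> s) = fib_add E e (fib_scale E t s)" for t
    proof -
      have e: "e \<in> fibre E ?p" by (simp add: fibre_def)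
      have ts: "fib_scale E t s \<in> fibre E ?p" using fv s unfolding fibre_vector_space_def by blast
      then have "fib_add E e (fib_scale E t s) \<in> fibre E ?p"
        using fv e unfolding fibre_vector_space_def by simp
      then show ?thesis using GF[of "fib_add E e (fib_scale E t s)"] tr(2) add[OF e ts] scale[OF s]
        by (simp add: fibre_def)
    qed
    ultimately show "((\<lambda>t. f (fib_add E e (fib_scale E t s))) has_real_derivative Df (DK (0, \<Phi> s))) (at 0)"
      by (simp only: has_field_derivative_def mult_commute_abs)
  qed
qed

lemma vertical_lift_wedge:
  fixes E :: "('e::{t2_space,second_countable_topology}, 'm::{t2_space,second_countable_topology},
      'c::real_normed_vector, 'a::real_normed_vector, 'b::real_normed_vector) vbundle"
  assumes E: "smooth_vector_bundle E"
    and st: "s \<in> fibre E (proj E e)" "t \<in> fibre E (proj E e)"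
    and \<gamma>: "\<gamma> (proj E e) = wedge (fibre_eval E s) (fibre_eval E t)"
  shows "vertical_lift E \<gamma> e = wedge (vertical_lift_at E e s) (vertical_lift_at E e t)"
proof -
  have d: "fibre_differential E e f \<in> fibre_dual E (proj E e)" for f
  proof (cases "f \<in> smooth_functions (total_atlas E)")
    case True
    have "proj E e \<in> (\<Union>(U, \<Phi>)\<in>bundle_atlas E. U)"
      using E by (simp add: smooth_vector_bundle_def)
    then obtain U \<Phi> where tr: "(U, \<Phi>) \<in> bundle_atlas E" "proj E e \<in> U"
      by blast
    obtain D where D: "bounded_linear D" "\<And>s. s \<in> fibre E (proj E e) \<Longrightarrow>
      ((\<lambda>t. f (fib_add E e (fib_scale E t s))) has_real_derivative D (\<Phi> s)) (at 0)"
      by (rule fibre_derivative[OF E tr True]) (rule that)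
    have eq: "fibre_differential E e f s = D (\<Phi> s)" if "s \<in> fibre E (proj E e)" for s
      using D(2)[OF that] that True
      by (simp add: fibre_differential_def vertical_lift_at_def DERIV_imp_deriv)
    interpret bounded_linear D by fact
    have lt: "local_trivialization E U \<Phi>" and fv: "fibre_vector_space E (proj E e)"
      using E tr unfolding smooth_vector_bundle_def by auto
    have 1: "x \<in> fibre E (proj E e) \<Longrightarrow> y \<in> fibre E (proj E e) \<Longrightarrow>
        fib_add E x y \<in> fibre E (proj E e) \<and> \<Phi> (fib_add E x y) = \<Phi> x + \<Phi> y" for x y
      using fv lt tr(2) unfolding fibre_vector_space_def local_trivialization_def by simp
    have 2: "x \<in> fibre E (proj E e) \<Longrightarrow>
        fib_scale E r x \<in> fibre E (proj E e) \<and> \<Phi> (fib_scale E r x) = r *\<^sub>R \<Phi> x" for x r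
      using fv lt tr(2) unfolding fibre_vector_space_def local_trivialization_def by simp
    have 3: "x \<notin> fibre E (proj E e) \<Longrightarrow> fibre_differential E e f x = 0" for x
      by (simp add: fibre_differential_def)
    show ?thesis unfolding fibre_dual_def
      using 1 2 3 eq add scaleR by auto
  qed (auto simp: fibre_differential_def vertical_lift_at_def fibre_dual_def)
  have "fibre_eval E s (fibre_differential E e f) = vertical_lift_at E e s f"
       "fibre_eval E t (fibre_differential E e f) = vertical_lift_at E e t f" for f
    using d[of f] st by (simp_all add: fibre_eval_def fibre_def fibre_differential_def)
  then show ?thesis by (simp only: vertical_lift_def \<gamma> wedge_def)
qed

lemma vertical_lift_at_vertical:
  fixes E :: "('e::{t2_space,second_countable_topology}, 'm::{t2_space,second_countable_topology},
      'c::real_normed_vector, 'a::real_normed_vector, 'b::real_normed_vector) vbundle"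
  assumes E: "smooth_vector_bundle E" and s: "s \<in> fibre E (proj E e)"
  shows "vertical_lift_at E e s \<in> vertical_space E e"
proof -
  let ?c = "\<lambda>t. fib_add E e (fib_scale E t s)"
  let ?C = "smooth_functions (total_atlas E)"
  have fv: "fibre_vector_space E (proj E e)" and mE: "smooth_manifold (total_atlas E)"
    and un: "proj E e \<in> (\<Union>(U, \<Phi>)\<in>bundle_atlas E. U)"
    using E by (simp_all add: smooth_vector_bundle_def)
  obtain U \<Phi> where tr: "(U, \<Phi>) \<in> bundle_atlas E" "proj E e \<in> U"
    using un by blast
  have e: "e \<in> fibre E (proj E e)" by (simp add: fibre_def)
  have ts: "fib_scale E t s \<in> fibre E (proj E e)" for t
    using fv s unfolding fibre_vector_space_def by simp
  have c: "?c t \<in> fibre E (proj E e)" for t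
    using fv e ts unfolding fibre_vector_space_def by simp
  have lt: "local_trivialization E U \<Phi>"
    using E tr unfolding smooth_vector_bundle_def by auto
  have inj: "inj_on (\<lambda>e. (proj E e, \<Phi> e)) (proj E -` U)"
    using lt unfolding local_trivialization_def diffeomorphism_on_def bij_betw_def by simp
  have "\<Phi> (?c 0) = \<Phi> e + 0 *\<^sub>R \<Phi> s"
    using lt tr(2) e ts[of 0] s unfolding local_trivialization_def by simp
  then have c0: "?c 0 = e"
    using inj_onD[OF inj, of "?c 0" e] c[of 0] tr(2) by (simp add: fibre_def)
  have d: "((\<lambda>t. f (?c t)) has_real_derivative vertical_lift_at E e s f) (at 0)" if f: "f \<in> ?C" for f
  proof -
    obtain D where "((\<lambda>t. f (?c t)) has_real_derivative D (\<Phi> s)) (at 0)"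
      by (rule fibre_derivative[OF E tr f]) (use s that in blast)
    then show ?thesis using f by (simp add: vertical_lift_at_def DERIV_imp_deriv)
  qed
  have u: "vertical_lift_at E e s f = D"
    if "f \<in> ?C" "((\<lambda>t. f (?c t)) has_real_derivative D) (at 0)" for f D
    using DERIV_unique d that by blast
  have t: "vertical_lift_at E e s \<in> tangent_space (total_atlas E) e"
    unfolding tangent_space_def
  proof (intro CollectI conjI allI ballI impI)
    fix f g assume f: "f \<in> ?C" and g: "g \<in> ?C"
    show "vertical_lift_at E e s (\<lambda>q. f q + g q) = vertical_lift_at E e s f + vertical_lift_at E e s g"
      by (rule u[OF sf_add[OF mE f g]]) (rule DERIV_add[OF d[OF f] d[OF g]])
    show "vertical_lift_at E e s (\<lambda>q. f q * g q) =
        vertical_lift_at E e s f * g e + f e * vertical_lift_at E e s g"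
      by (rule u[OF sf_mult[OF mE f g]]) (use DERIV_mult[OF d[OF f] d[OF g]] c0 in \<open>simp add: mult.commute\<close>)
  next
    fix k f assume f: "f \<in> ?C"
    show "vertical_lift_at E e s (\<lambda>q. k * f q) = k * vertical_lift_at E e s f"
      by (rule u[OF sf_mult[OF mE sf_const[OF mE] f]]) (rule DERIV_cmult[OF d[OF f]])
  qed (simp add: vertical_lift_at_def)
  have "vertical_lift_at E e s (g \<circ> proj E) = 0" for g
  proof -
    have "(\<lambda>t. (g \<circ> proj E) (?c t)) = (\<lambda>t. g (proj E e))"
      using c by (simp add: fibre_def)
    then show ?thesis by (simp add: vertical_lift_at_def)
  qed
  then show ?thesis using t by (auto simp: vertical_space_def tangent_map_def fun_eq_iff)
qed

end

theory Submission
  imports Defs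
begin

text \<open>
  Vertical lifts of sections commute and are complete, but their supports are too large, and cutting
  them off one by one destroys commutation. So they are all transported at once, by a single fibre
  preserving embedding \<open>\<Psi>\<close> of \<open>E\<close> onto the open unit ball bundle of a fibre metric \<open>\<beta>\<close> whose closed
  unit balls lie in \<open>U\<close>. If \<open>\<Psi>\<close> is the identity near the zero section, then \<open>\<Psi>\<^sub>* s\<^sup>v\<^sup>e\<^sup>r\<close> equals
  \<open>s\<^sup>v\<^sup>e\<^sup>r\<close> there; if \<open>\<Psi>\<close> approaches the boundary fast enough, then the extension of \<open>\<Psi>\<^sub>* s\<^sup>v\<^sup>e\<^sup>r\<close> by
  zero is smooth. For a radial map with inverse \<open>e \<mapsto> e / a(q)\<close>, \<open>q = \<beta>(e, e)\<close>, one computes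
  \<open>\<Psi>\<^sub>* s\<^sup>v\<^sup>e\<^sup>r = a(q) s + b(q) \<beta>(e, s) e\<close>, where \<open>b\<close> is determined by \<open>2 a' (a + q b) = a b\<close>. Explicit
  \<open>a\<close> and \<open>b\<close>, smooth on the whole line and built from \<open>exp (-1/t)\<close>, are \<open>cutoff\<close> and \<open>rad\<close>. Everything
  about these fields happens in a single fibre: \<open>ball_fields_commute\<close> and \<open>ball_field_complete\<close>.

  What remains is to write \<open>\<gamma>\<close> as a sum of finitely many \<open>s\<^sub>i \<and> t\<^sub>i\<close> with global sections, and to
  find \<open>\<beta>\<close>. Both are done by gluing local frames, and finiteness over a non-compact base needs a
  cover of bounded multiplicity. Given bump functions \<open>\<rho>\<^sub>j\<close>, \<open>j \<in> \<nat>\<close>, and thresholds \<open>r\<^sub>c\<^sub>j\<close>, let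
  \<open>W\<^sub>c\<^sub>j\<close> be the open set where \<open>\<rho>\<^sub>j > r\<^sub>c\<^sub>j\<close> while \<open>\<rho>\<^sub>i < r\<^sub>c\<^sub>i\<close> for all \<open>i < j\<close>. For a fixed colour \<open>c\<close>
  these sets are disjoint, and they miss a point only if \<open>\<rho>\<^sub>j = r\<^sub>c\<^sub>j\<close> there for some \<open>j\<close>. A point missed
  by all of \<open>n + 1\<close> colours, \<open>n = dim M\<close>, puts \<open>n + 1\<close> of the thresholds into the image of a Lipschitz
  map from an \<open>n\<close>-dimensional set to \<open>\<real>\<^sup>n\<^sup>+\<^sup>1\<close>. Such an image has no interior
  (\<open>lipschitz_image_misses_grid\<close>), so by Baire's theorem generic thresholds avoid all of them
  (\<open>generic_thresholds\<close>), and \<open>n + 1\<close> colours cover (\<open>disjoint_families_of_bumps\<close>).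

  As the sets of one colour are disjoint, the local frames on them glue to sections and covectors of
  \<open>E\<close>, with finitely many for each colour. Weighted by smooth functions they give \<open>\<beta>\<close> (\<open>metric_ball\<close>,
  \<open>metric_fibre_compact\<close>) and the decomposition of \<open>\<gamma>\<close> (\<open>vertical_lift_decomposition\<close>). Finally, a sum
  of wedges of commuting fields is Poisson (\<open>poisson_sum_commuting_wedges\<close>).
\<close>

section \<open>Finite-dimensional normed spaces\<close>

text \<open>A basis indexed by an initial segment of the naturals, together with its dual basis. The number \<open>n\<close>
  may be zero, so that this also serves vector spaces of dimension zero.\<close>

definition coordinates :: "nat \<Rightarrow> (nat \<Rightarrow> 'a::real_normed_vector) \<Rightarrow> (nat \<Rightarrow> 'a \<Rightarrow> real) \<Rightarrow> bool" where
  "coordinates n b c \<longleftrightarrow>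
     (\<forall>i<n. bounded_linear (c i)) \<and> (\<forall>x. (\<Sum>i<n. c i x *\<^sub>R b i) = x) \<and>
     (\<forall>i<n. \<forall>j<n. c i (b j) = (if i = j then 1 else 0))"

lemma compact_bounded_combinations:
  fixes b :: "nat \<Rightarrow> 'a::real_normed_vector"
  shows "compact ((\<lambda>a. \<Sum>i<n. a i *\<^sub>R b i) ` {a. \<forall>i<n. \<bar>a i\<bar> \<le> r})"
proof (induction n)
  case 0
  have "(\<lambda>a. \<Sum>i<0. a i *\<^sub>R b i) ` {a. \<forall>i<0. \<bar>a i\<bar> \<le> r} = {0}" by auto
  then show ?case by simp
next
  case (Suc n)
  let ?T = "\<lambda>n. (\<lambda>a. \<Sum>i<n. a i *\<^sub>R b i) ` {a. \<forall>i<n. \<bar>a i\<bar> \<le> r}"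
  have "?T (Suc n) = (\<lambda>(t, y). y + t *\<^sub>R b n) ` ({-r..r} \<times> ?T n)"
  proof (intro set_eqI iffI)
    fix x assume "x \<in> ?T (Suc n)"
    then obtain a where "\<forall>i<Suc n. \<bar>a i\<bar> \<le> r" "x = (\<Sum>i<Suc n. a i *\<^sub>R b i)" by auto
    then show "x \<in> (\<lambda>(t, y). y + t *\<^sub>R b n) ` ({-r..r} \<times> ?T n)"
      by (intro image_eqI[of _ _ "(a n, \<Sum>i<n. a i *\<^sub>R b i)"]) (auto simp: abs_le_iff)
  next
    fix x assume "x \<in> (\<lambda>(t, y). y + t *\<^sub>R b n) ` ({-r..r} \<times> ?T n)"
    then obtain t a where "\<bar>t\<bar> \<le> r" "\<forall>i<n. \<bar>a i\<bar> \<le> r" "x = (\<Sum>i<n. a i *\<^sub>R b i) + t *\<^sub>R b n"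
      unfolding image_iff abs_le_iff by force
    then show "x \<in> ?T (Suc n)"
      by (intro image_eqI[of _ _ "a(n := t)"]) (auto simp: less_Suc_eq)
  qed
  moreover have "continuous_on ({-r..r} \<times> ?T n) (\<lambda>(t, y). y + t *\<^sub>R b n)"
    by (auto simp: case_prod_unfold intro!: continuous_intros)
  ultimately show ?case
    using Suc by (simp add: compact_continuous_image compact_Times)
qed

text \<open>The point is continuity of the coordinates, that is, equivalence of norms. By compactness there is a
  positive lower bound for the norm on the vectors whose \<open>j\<close>-th coordinate is one and whose other
  coordinates are at most one, and every nonzero vector has a multiple of this form for some \<open>j\<close>.\<close>

lemma coordinates_exist:
  assumes "finite_dimensional TYPE('a::real_normed_vector)"
  obtains n and b :: "nat \<Rightarrow> 'a::real_normed_vector" and c where "coordinates n b c"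
proof -
  obtain B0 :: "'a set" where B0: "finite B0" "span B0 = UNIV"
    using assms by (auto simp: finite_dimensional_def)
  obtain B where B: "B \<subseteq> B0" "independent B" "B0 \<subseteq> span B"
    using maximal_independent_subset by blast
  have finB: "finite B" using B B0 finite_subset by blast
  have spB: "span B = UNIV"
    using B B0 by (metis span_mono span_span top.extremum_uniqueI)
  obtain b where b: "bij_betw b {0..<card B} B"
    using ex_bij_betw_nat_finite[OF finB] by blast
  define n where "n = card B"
  define c where "c i x = representation B x (b i)" for i x
  have lin: "linear (c i)" for i
    by (rule linearI) (simp_all add: c_def B(2) spB representation_add representation_scale)
  have exp: "(\<Sum>i<n. c i x *\<^sub>R b i) = x" for x
  proof -
    have "(\<Sum>i<n. c i x *\<^sub>R b i) = (\<Sum>v\<in>B. representation B x v *\<^sub>R v)"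
      using b by (auto simp: c_def n_def lessThan_atLeast0
          intro!: sum.reindex_bij_betw[of b "{0..<card B}" B "\<lambda>v. representation B x v *\<^sub>R v"])
    then show ?thesis using sum_representation_eq[OF B(2) _ finB order_refl, of x] spB by simp
  qed
  have delta: "c i (b j) = (if i = j then 1 else 0)" if "i < n" "j < n" for i j
  proof -
    have "b j \<in> B" using b that by (auto simp: bij_betw_def n_def)
    moreover have "b i = b j \<longleftrightarrow> i = j"
      using b that by (auto simp: bij_betw_def n_def inj_on_def)
    ultimately show ?thesis by (simp add: c_def representation_basis[OF B(2)])
  qed
  have bound: "\<exists>m>0. \<forall>x. (\<forall>i<n. \<bar>c i x\<bar> \<le> \<bar>c j x\<bar>) \<longrightarrow> \<bar>c j x\<bar> * m \<le> norm x" if j: "j < n" for j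
  proof -
    let ?b = "b(j := 0)"
    let ?D = "(\<lambda>y. y + b j) ` (\<lambda>a. \<Sum>i<n. a i *\<^sub>R ?b i) ` {a. \<forall>i<n. \<bar>a i\<bar> \<le> 1}"
    have comp: "compact ?D"
      by (intro compact_continuous_image compact_bounded_combinations continuous_intros)
    have sum: "(\<Sum>i<n. a i *\<^sub>R ?b i) + b j = (\<Sum>i<n. (a(j:=1)) i *\<^sub>R b i)" for a :: "nat \<Rightarrow> real"
    proof -
      have "(\<Sum>i<n. (a(j:=1)) i *\<^sub>R b i) = (\<Sum>i<n. a i *\<^sub>R ?b i + (if i = j then b j else 0))"
        by (intro sum.cong) auto
      then show ?thesis using j by (simp add: sum.distrib)
    qed
    have "0 \<notin> ?D"
    proof
      assume "0 \<in> ?D"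
      then obtain a :: "nat \<Rightarrow> real" where "0 = (\<Sum>i<n. a i *\<^sub>R ?b i) + b j" by auto
      then have "c j 0 = c j (\<Sum>i<n. (a(j:=1)) i *\<^sub>R b i)" using sum by metis
      also have "\<dots> = (\<Sum>i<n. (a(j:=1)) i * c j (b i))"
        using lin by (simp add: linear_sum linear_cmul)
      also have "\<dots> = (\<Sum>i<n. if i = j then 1 else 0)"
        using delta j by (intro sum.cong) auto
      finally show False using j lin by (simp add: linear_0)
    qed
    moreover have "?D \<noteq> {}" by (auto intro: exI[of _ "\<lambda>_. 0"])
    ultimately obtain m where m: "m > 0" "\<forall>y\<in>?D. m \<le> norm y"
    proof -
      obtain y where y: "y \<in> ?D" "\<forall>z\<in>?D. norm y \<le> norm z"
        using continuous_attains_inf[OF comp \<open>?D \<noteq> {}\<close> continuous_on_norm_id] by blast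
      have "y \<noteq> 0" using \<open>0 \<notin> ?D\<close> y(1) by blast
      then have "norm y > 0" by simp
      then show ?thesis using that y by blast
    qed
    have "\<bar>c j x\<bar> * m \<le> norm x" if x: "\<forall>i<n. \<bar>c i x\<bar> \<le> \<bar>c j x\<bar>" for x
    proof (cases "c j x = 0")
      case False
      let ?a = "\<lambda>i. c i x / c j x"
      have "x /\<^sub>R c j x = (\<Sum>i<n. ?a i *\<^sub>R b i)"
        by (subst exp[of x, symmetric]) (simp add: scaleR_sum_right divide_inverse_commute)
      also have "\<dots> = (\<Sum>i<n. ?a i *\<^sub>R ?b i) + b j"
        unfolding sum using False by (intro sum.cong) auto
      finally have "x /\<^sub>R c j x = (\<Sum>i<n. ?a i *\<^sub>R ?b i) + b j" .
      moreover have "\<forall>i<n. \<bar>?a i\<bar> \<le> 1" using x False by (auto simp: abs_divide divide_le_eq_1)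
      ultimately have "x /\<^sub>R c j x \<in> ?D"
        by (intro image_eqI[of _ _ "\<Sum>i<n. ?a i *\<^sub>R ?b i"] image_eqI[of _ _ ?a] CollectI) (assumption | rule refl)+
      then have "m \<le> norm (x /\<^sub>R c j x)" using m by blast
      then show ?thesis using False by (simp add: field_simps)
    qed simp
    then show ?thesis using m by blast
  qed
  then obtain m where m: "\<And>j. j < n \<Longrightarrow> m j > 0"
    "\<And>j x. j < n \<Longrightarrow> (\<forall>i<n. \<bar>c i x\<bar> \<le> \<bar>c j x\<bar>) \<Longrightarrow> \<bar>c j x\<bar> * m j \<le> norm x"
    by metis
  have bl: "bounded_linear (c k)" if k: "k < n" for k
  proof -
    define M where "M = Min (m ` {..<n})"
    have "Min (m ` {..<n}) \<in> m ` {..<n}" using k by (intro Min_in) auto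
    then have M: "M > 0" using m(1) by (auto simp: M_def)
    have "norm (c k x) \<le> norm x * (1 / M)" for x
    proof -
      obtain j where j: "j < n" "\<forall>i<n. \<bar>c i x\<bar> \<le> \<bar>c j x\<bar>"
      proof -
        let ?A = "(\<lambda>i. \<bar>c i x\<bar>) ` {..<n}"
        have "Max ?A \<in> ?A" using k by (intro Max_in) auto
        then obtain j where j: "j < n" "Max ?A = \<bar>c j x\<bar>" by auto
        moreover have "\<bar>c i x\<bar> \<le> Max ?A" if "i < n" for i using that by (intro Max_ge) auto
        ultimately show ?thesis using that[of j] by simp
      qed
      have "\<bar>c k x\<bar> * M \<le> \<bar>c j x\<bar> * m j"
        using j k M by (intro mult_mono) (auto simp: M_def)
      also have "\<dots> \<le> norm x" using m(2)[OF j] .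
      finally show ?thesis using M by (simp add: field_simps)
    qed
    then show ?thesis
      by (intro bounded_linear_intro[where K = "1 / M"])
         (auto simp: linear_add[OF lin[of k]] linear_cmul[OF lin[of k]])
  qed
  show ?thesis
    by (rule that[of n b c]) (use bl exp delta in \<open>auto simp: coordinates_def\<close>)
qed

lemma coordinatesD:
  assumes "coordinates n b c"
  shows "i < n \<Longrightarrow> bounded_linear (c i)" "(\<Sum>i<n. c i x *\<^sub>R b i) = x"
    "i < n \<Longrightarrow> j < n \<Longrightarrow> c i (b j) = (if i = j then 1 else 0)"
    "i < n \<Longrightarrow> c i (x + y) = c i x + c i y" "i < n \<Longrightarrow> c i (r *\<^sub>R x) = r * c i x"
    "i < n \<Longrightarrow> c i (x - y) = c i x - c i y" "i < n \<Longrightarrow> c i 0 = 0"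
proof -
  have l: "linear (c i)" if "i < n" for i
    using assms that by (simp add: coordinates_def bounded_linear.linear)
  show "i < n \<Longrightarrow> bounded_linear (c i)" "(\<Sum>i<n. c i x *\<^sub>R b i) = x"
    "i < n \<Longrightarrow> j < n \<Longrightarrow> c i (b j) = (if i = j then 1 else 0)"
    using assms by (simp_all add: coordinates_def)
  show "i < n \<Longrightarrow> c i (x + y) = c i x + c i y" "i < n \<Longrightarrow> c i (r *\<^sub>R x) = r * c i x"
    "i < n \<Longrightarrow> c i (x - y) = c i x - c i y" "i < n \<Longrightarrow> c i 0 = 0"
    using l linear_add linear_cmul linear_diff linear_0 by fastforce+
qed

text \<open>The theorem of Heine and Borel; boundedness is measured in coordinates.\<close>

lemma finite_dimensional_compact:
  fixes S :: "'a::real_normed_vector set"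
  assumes co: "coordinates n b c" and S: "closed S" "\<And>x i. x \<in> S \<Longrightarrow> i < n \<Longrightarrow> \<bar>c i x\<bar> \<le> r"
  shows "compact S"
proof -
  let ?T = "(\<lambda>a. \<Sum>i<n. a i *\<^sub>R b i) ` {a. \<forall>i<n. \<bar>a i\<bar> \<le> r}"
  have "S \<subseteq> ?T"
  proof
    fix x assume "x \<in> S"
    then show "x \<in> ?T"
      using S(2) coordinatesD(2)[OF co, of x] by (intro image_eqI[of _ _ "\<lambda>i. c i x"]) auto
  qed
  then show ?thesis
    using compact_Int_closed[OF compact_bounded_combinations[of b n r] S(1)] by (simp only: Int_absorb1)
qed

lemma linear_coordinates:
  assumes co: "coordinates n b c" and L: "linear L"
  shows "L x = (\<Sum>i<n. c i x *\<^sub>R L (b i))"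
  by (subst coordinatesD(2)[OF co, of x, symmetric]) (use L in \<open>simp add: linear_sum linear_cmul\<close>)

lemma finite_dimensional_prod:
  assumes "finite_dimensional TYPE('a::real_normed_vector)" "finite_dimensional TYPE('b::real_normed_vector)"
  shows "finite_dimensional TYPE('a::real_normed_vector \<times> 'b::real_normed_vector)"
proof -
  obtain A :: "'a set" and B :: "'b set" where "finite A" "span A = UNIV" "finite B" "span B = UNIV"
    using assms by (auto simp: finite_dimensional_def)
  moreover have "span (A \<times> {0} \<union> {0} \<times> B) = (UNIV :: ('a \<times> 'b) set)"
  proof -
    have "(x, y) \<in> span (A \<times> {0} \<union> {0} \<times> B)" for x :: 'a and y :: 'b
    proof -
      have "(x, 0) \<in> span A \<times> {0}" "(0, y) \<in> {0} \<times> span B" using \<open>span A = UNIV\<close> \<open>span B = UNIV\<close> by auto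
      then have "(x, 0) \<in> span (A \<times> {0})" "(0, y) \<in> span ({0} \<times> B)"
        by (simp_all add: span_Times_sing1 span_Times_sing2)
      then have "(x, 0) \<in> span (A \<times> {0} \<union> {0} \<times> B)" "(0, y) \<in> span (A \<times> {0} \<union> {0} \<times> B)"
        using span_mono[of "A \<times> {0}" "A \<times> {0} \<union> {0} \<times> B"] span_mono[of "{0} \<times> B" "A \<times> {0} \<union> {0} \<times> B"] by blast+
      from span_add[OF this] show ?thesis by simp
    qed
    then show ?thesis by auto
  qed
  ultimately show ?thesis unfolding finite_dimensional_def
    by (intro exI[of _ "A \<times> {0} \<union> {0} \<times> B"]) simp
qed

section \<open>Calculus of smooth maps\<close>

lemma Ck_on_subset: "Ck_on k S f \<Longrightarrow> T \<subseteq> S \<Longrightarrow> Ck_on k T f"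
proof (induction k arbitrary: f)
  case 0 then show ?case using continuous_on_subset by auto
next
  case (Suc k) then show ?case by (simp only: Ck_on.simps) blast
qed

lemma Ck_on_local:
  assumes "\<And>x. x \<in> S \<Longrightarrow> \<exists>T. open T \<and> x \<in> T \<and> Ck_on k (T \<inter> S) f"
  shows "Ck_on k S f"
  using assms
proof (induction k arbitrary: f)
  case 0
  have "continuous (at x within S) f" if x: "x \<in> S" for x
  proof -
    obtain T where T: "open T" "x \<in> T" "continuous_on (T \<inter> S) f"
      using 0[OF x] by auto
    then have "continuous (at x within (T \<inter> S)) f"
      using x by (simp add: continuous_on_eq_continuous_within)
    moreover have "at x within (T \<inter> S) = at x within S"
      using T by (intro at_within_nhd[of x T]) auto
    ultimately show ?thesis by simp
  qed
  then show ?case by (simp add: continuous_on_eq_continuous_within)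
next
  case (Suc k)
  have "f differentiable (at x)" if "x \<in> S" for x using Suc.prems[OF that] that by auto
  moreover have "Ck_on k S (\<lambda>x. frechet_derivative f (at x) v)" for v
    by (rule Suc.IH) (metis Suc.prems Ck_on.simps(2))
  ultimately show ?case by simp
qed

lemma Ck_on_SucI:
  assumes "open S" "\<And>x. x \<in> S \<Longrightarrow> (f has_derivative f' x) (at x)"
    and "\<And>v. Ck_on k S (\<lambda>x. f' x v)"
  shows "Ck_on (Suc k) S f"
proof -
  have "frechet_derivative f (at x) = f' x" if "x \<in> S" for x
    using frechet_derivative_at[OF assms(2)[OF that]] by simp
  then have "Ck_on k S (\<lambda>x. frechet_derivative f (at x) v)" for v
    using assms(3)[of v] by (intro Ck_on_cong[OF assms(1) _ assms(3)[of v]]) simp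
  then show ?thesis using assms(2) by (auto simp: differentiable_def)
qed

lemma Ck_on_has_derivative:
  "Ck_on (Suc k) S f \<Longrightarrow> x \<in> S \<Longrightarrow> (f has_derivative frechet_derivative f (at x)) (at x)"
  by (simp add: frechet_derivative_works)

lemma Ck_on_linear_compose:
  assumes L: "bounded_linear L" and "open S" "Ck_on k S f"
  shows "Ck_on k S (\<lambda>x. L (f x))"
  using assms(3)
proof (induction k arbitrary: f)
  case 0
  then show ?case using L by (simp add: bounded_linear.continuous_on)
next
  case (Suc k)
  show ?case
  proof (rule Ck_on_SucI[OF assms(2)])
    show "((\<lambda>x. L (f x)) has_derivative (\<lambda>v. L (frechet_derivative f (at x) v))) (at x)" if "x \<in> S" for x
      using bounded_linear.has_derivative[OF L Ck_on_has_derivative[OF Suc.prems that]] .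
  qed (use Suc in auto)
qed

lemma Ck_on_bilinear:
  assumes B: "bounded_bilinear B" and S: "open S" and "Ck_on k S f" "Ck_on k S g"
  shows "Ck_on k S (\<lambda>x. B (f x) (g x))"
  using assms(3,4)
proof (induction k arbitrary: f g)
  case 0
  then show ?case using B by (simp add: bounded_bilinear.continuous_on)
next
  case (Suc k)
  show ?case
  proof (rule Ck_on_SucI[OF S])
    show "((\<lambda>x. B (f x) (g x)) has_derivative
        (\<lambda>v. B (f x) (frechet_derivative g (at x) v) + B (frechet_derivative f (at x) v) (g x))) (at x)"
      if "x \<in> S" for x
      using bounded_bilinear.FDERIV[OF B Ck_on_has_derivative[OF Suc.prems(1) that]
        Ck_on_has_derivative[OF Suc.prems(2) that]] .
    show "Ck_on k S (\<lambda>x. B (f x) (frechet_derivative g (at x) v) + B (frechet_derivative f (at x) v) (g x))" for v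
      using Suc.prems Ck_on_SucD[OF S Suc.prems(1)] Ck_on_SucD[OF S Suc.prems(2)]
      by (intro Ck_on_add[OF S] Suc.IH) auto
  qed
qed

lemma Ck_on_sum:
  assumes "open S" "\<And>i. i \<in> I \<Longrightarrow> Ck_on k S (f i)"
  shows "Ck_on k S (\<lambda>x. \<Sum>i\<in>I. f i x)"
  using assms(2)
proof (induction I rule: infinite_finite_induct)
  case (insert i I)
  then show ?case by (simp add: Ck_on_add[OF assms(1)])
qed (auto simp: Ck_on_const)

text \<open>The chain rule gives the derivative as \<open>Df(g x)(Dg(x) v)\<close>, where the argument of the linear map varies
  with \<open>x\<close>. Expanding it in coordinates leaves only derivatives in fixed directions, to which the
  induction hypothesis applies.\<close>

lemma Ck_on_compose:
  fixes g :: "'a::real_normed_vector \<Rightarrow> 'b::real_normed_vector" and f :: "'b \<Rightarrow> 'c::real_normed_vector"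
  assumes fd: "finite_dimensional TYPE('b)" and S: "open S" and T: "open T" and "g ` S \<subseteq> T"
    and "Ck_on k T f" "Ck_on k S g"
  shows "Ck_on k S (\<lambda>x. f (g x))"
  using assms(4-)
proof (induction k arbitrary: f)
  case 0
  then show ?case by (auto intro: continuous_on_compose2)
next
  case (Suc k)
  obtain n and b :: "nat \<Rightarrow> 'b" and c where co: "coordinates n b c"
    using coordinates_exist[OF fd] .
  show ?case
  proof (rule Ck_on_SucI[OF S])
    fix x assume x: "x \<in> S"
    have D: "(f has_derivative frechet_derivative f (at (g x))) (at (g x))"
      using Ck_on_has_derivative[OF Suc.prems(2), of "g x"] x Suc.prems(1) by auto
    have "((\<lambda>x. f (g x)) has_derivative
        (\<lambda>v. frechet_derivative f (at (g x)) (frechet_derivative g (at x) v))) (at x)"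
      by (rule has_derivative_compose[OF Ck_on_has_derivative[OF Suc.prems(3) x] D])
    also have "(\<lambda>v. frechet_derivative f (at (g x)) (frechet_derivative g (at x) v)) =
       (\<lambda>v. \<Sum>i<n. c i (frechet_derivative g (at x) v) *\<^sub>R frechet_derivative f (at (g x)) (b i))"
      using linear_coordinates[OF co] has_derivative_linear[OF D] by blast
    finally show "((\<lambda>x. f (g x)) has_derivative
      (\<lambda>v. \<Sum>i<n. c i (frechet_derivative g (at x) v) *\<^sub>R frechet_derivative f (at (g x)) (b i))) (at x)" .
  next
    fix v
    have g: "Ck_on k S g" using Suc.prems Ck_on_SucD[OF S] by blast
    show "Ck_on k S (\<lambda>x. \<Sum>i<n. c i (frechet_derivative g (at x) v) *\<^sub>R frechet_derivative f (at (g x)) (b i))"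
    proof (rule Ck_on_sum[OF S], rule Ck_on_bilinear[OF bounded_bilinear_scaleR S])
      fix i assume i: "i \<in> {..<n}"
      show "Ck_on k S (\<lambda>x. c i (frechet_derivative g (at x) v))"
        using Suc.prems(3) i by (intro Ck_on_linear_compose[OF coordinatesD(1)[OF co] S]) simp_all
      show "Ck_on k S (\<lambda>x. frechet_derivative f (at (g x)) (b i))"
        using Suc.prems(2) by (intro Suc.IH[OF Suc.prems(1) _ g]) simp
    qed
  qed
qed

lemma Ck_on_real_SucI:
  fixes f :: "real \<Rightarrow> real"
  assumes "open S" "\<And>x. x \<in> S \<Longrightarrow> (f has_real_derivative f' x) (at x)" "Ck_on k S f'"
  shows "Ck_on (Suc k) S f"
proof (rule Ck_on_SucI[OF assms(1)])
  show "(f has_derivative (\<lambda>v. f' x * v)) (at x)" if "x \<in> S" for x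
    using assms(2)[OF that] by (simp add: has_field_derivative_def)
  show "Ck_on k S (\<lambda>x. f' x * v)" for v
    using assms(1,3) by (intro Ck_on_mult Ck_on_const)
qed

lemma smooth_on_const: "smooth_on S (\<lambda>x. c)"
  by (simp add: smooth_on_def Ck_on_const)

lemma smooth_on_add: "open S \<Longrightarrow> smooth_on S f \<Longrightarrow> smooth_on S g \<Longrightarrow> smooth_on S (\<lambda>x. f x + g x)"
  by (simp add: smooth_on_def Ck_on_add)

lemma smooth_on_scaleR:
  "open S \<Longrightarrow> smooth_on S f \<Longrightarrow> smooth_on S g \<Longrightarrow> smooth_on S (\<lambda>x. f x *\<^sub>R g x)"
  by (simp add: smooth_on_def Ck_on_bilinear[OF bounded_bilinear_scaleR])

lemma smooth_on_mult:
  fixes f g :: "_ \<Rightarrow> real"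
  shows "open S \<Longrightarrow> smooth_on S f \<Longrightarrow> smooth_on S g \<Longrightarrow> smooth_on S (\<lambda>x. f x * g x)"
  by (simp add: smooth_on_def Ck_on_mult)

lemma smooth_on_linear_compose:
  "bounded_linear L \<Longrightarrow> open S \<Longrightarrow> smooth_on S f \<Longrightarrow> smooth_on S (\<lambda>x. L (f x))"
  by (simp add: smooth_on_def Ck_on_linear_compose)

lemma smooth_on_minus:
  "open S \<Longrightarrow> smooth_on S f \<Longrightarrow> smooth_on S (\<lambda>x. - f x)"
  by (rule smooth_on_linear_compose[OF bounded_linear_minus[OF bounded_linear_ident]])

lemma smooth_on_diff:
  "open S \<Longrightarrow> smooth_on S f \<Longrightarrow> smooth_on S g \<Longrightarrow> smooth_on S (\<lambda>x. f x - g x)"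
  using smooth_on_add[OF _ _ smooth_on_minus, of S f g] by simp

lemma smooth_on_id: "open S \<Longrightarrow> smooth_on S (\<lambda>x. x)"
  unfolding smooth_on_def
proof
  fix k assume S: "open S"
  have "Ck_on (Suc k) S (\<lambda>x. x)"
    by (rule Ck_on_SucI[OF S, of _ "\<lambda>_ v. v"]) (auto simp: Ck_on_const)
  then show "Ck_on k S (\<lambda>x. x)" by (rule Ck_on_SucD[OF S])
qed

lemma smooth_on_linear: "bounded_linear L \<Longrightarrow> open S \<Longrightarrow> smooth_on S L"
  using smooth_on_linear_compose[OF _ _ smooth_on_id] by blast

lemma smooth_on_compose:
  fixes f :: "'b::real_normed_vector \<Rightarrow> 'c::real_normed_vector" and g :: "'a::real_normed_vector \<Rightarrow> 'b"
  assumes "finite_dimensional TYPE('b)" "open S" "open T" "g ` S \<subseteq> T"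
    and "smooth_on T f" "smooth_on S g"
  shows "smooth_on S (\<lambda>x. f (g x))"
  using assms Ck_on_compose unfolding smooth_on_def by blast

lemma smooth_on_cong:
  "open S \<Longrightarrow> (\<And>x. x \<in> S \<Longrightarrow> f x = g x) \<Longrightarrow> smooth_on S f \<Longrightarrow> smooth_on S g"
  unfolding smooth_on_def using Ck_on_cong by blast

lemma smooth_on_subset: "smooth_on S f \<Longrightarrow> T \<subseteq> S \<Longrightarrow> smooth_on T f"
  by (auto simp: smooth_on_def intro: Ck_on_subset)

lemma smooth_on_local:
  assumes "\<And>x. x \<in> S \<Longrightarrow> \<exists>T. open T \<and> x \<in> T \<and> smooth_on (T \<inter> S) f"
  shows "smooth_on S f"
  unfolding smooth_on_def
proof (intro allI Ck_on_local)
  fix k x assume "x \<in> S"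
  then show "\<exists>T. open T \<and> x \<in> T \<and> Ck_on k (T \<inter> S) f"
    using assms[of x] by (auto simp: smooth_on_def)
qed

lemma smooth_on_partial:
  "smooth_on S f \<Longrightarrow> smooth_on S (\<lambda>x. frechet_derivative f (at x) v)"
  unfolding smooth_on_def by (metis Ck_on.simps(2))

lemma smooth_on_has_derivative:
  "smooth_on S f \<Longrightarrow> x \<in> S \<Longrightarrow> (f has_derivative frechet_derivative f (at x)) (at x)"
  using smooth_on_differentiable frechet_derivative_works by blast

lemma smooth_on_continuous: "smooth_on S f \<Longrightarrow> continuous_on S f"
  unfolding smooth_on_def by (metis Ck_on.simps(1))

lemma finite_dimensional_real: "finite_dimensional TYPE(real)"
proof -
  have "x \<in> span {1}" for x :: real
    unfolding span_singleton by (rule image_eqI[of _ _ x]) simp_all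
  then show ?thesis unfolding finite_dimensional_def by (intro exI[of _ "{1}"]) auto
qed

lemma smooth_on_real_compose:
  fixes f :: "real \<Rightarrow> real"
  assumes "open S" "smooth_on UNIV f" "smooth_on S g"
  shows "smooth_on S (\<lambda>x. f (g x))"
  using smooth_on_compose[OF finite_dimensional_real assms(1) open_UNIV _ assms(2,3)] by simp

lemma smooth_on_inverse:
  assumes S: "open S" and f: "smooth_on S f" and nz: "\<And>x. x \<in> S \<Longrightarrow> f x \<noteq> (0::real)"
  shows "smooth_on S (\<lambda>x. inverse (f x))"
proof (rule smooth_on_compose[OF finite_dimensional_real S, where f = inverse and g = f and T = "-{0}"])
  have o: "open (-{0::real})" by (simp add: open_Compl)
  then show "open (-{0::real})" .
  have "Ck_on k (-{0}) (inverse :: real \<Rightarrow> real)" for k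
  proof (induction k)
    case 0
    show ?case by (auto intro!: continuous_intros)
  next
    case (Suc k)
    show ?case
    proof (rule Ck_on_real_SucI[OF o, where f' = "\<lambda>x. -1 * (inverse x * inverse x)"])
      show "(inverse has_real_derivative -1 * (inverse x * inverse x)) (at x)" if "x \<in> -{0}" for x :: real
        using that by (auto intro!: derivative_eq_intros)
      show "Ck_on k (-{0}) (\<lambda>x::real. -1 * (inverse x * inverse x))"
        by (intro Ck_on_mult[OF o] Ck_on_const Suc)
    qed
  qed
  then show "smooth_on (-{0::real}) inverse" by (simp add: smooth_on_def)
qed (use f nz in auto)

lemma smooth_on_divide:
  fixes f g :: "_ \<Rightarrow> real"
  assumes "open S" "smooth_on S f" "smooth_on S g" "\<And>x. x \<in> S \<Longrightarrow> g x \<noteq> 0"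
  shows "smooth_on S (\<lambda>x. f x / g x)"
  unfolding divide_inverse using assms by (intro smooth_on_mult smooth_on_inverse) auto


section \<open>A flat function\<close>

text \<open>The functions \<open>t\<^sup>-\<^sup>m exp (-1/t)\<close>, extended by zero. Derivatives of members of this family are
  combinations of members, which turns smoothness into an induction for all \<open>m\<close> at once.\<close>

definition flat_pow :: "nat \<Rightarrow> real \<Rightarrow> real" where
  "flat_pow m t = (if t > 0 then (1 / t) ^ m * exp (- (1 / t)) else 0)"

abbreviation flat :: "real \<Rightarrow> real" where
  "flat \<equiv> flat_pow 0"

lemma flat_pow_pos: "t > 0 \<Longrightarrow> flat_pow m t > 0"
  and flat_pow_0: "t \<le> 0 \<Longrightarrow> flat_pow m t = 0"
  and flat_pow_nonneg: "flat_pow m t \<ge> 0"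
  by (simp_all add: flat_pow_def)

lemma flat_pow_Suc: "t * flat_pow (Suc m) t = flat_pow m t"
  by (simp add: flat_pow_def)

lemma flat_pow_has_derivative:
  "(flat_pow m has_real_derivative (flat_pow (m + 2) t - of_nat m * flat_pow (m + 1) t)) (at t)"
proof (cases t "0::real" rule: linorder_cases)
  case less
  have "((\<lambda>_. 0) has_real_derivative 0) (at t)" by simp
  then have "(flat_pow m has_real_derivative 0) (at t)"
    by (rule has_field_derivative_transform_within_open[where S = "{..<0}"]) (use less in \<open>auto simp: flat_pow_0\<close>)
  then show ?thesis using less by (simp add: flat_pow_0)
next
  case greater
  have "((\<lambda>t. (1 / t) ^ m) has_real_derivative - of_nat m * (1 / t) ^ (m + 1)) (at t)"
  proof (cases m)
    case (Suc k)
    have "((\<lambda>t. 1 / t) has_real_derivative - (1 / t)\<^sup>2) (at t)"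
      using greater by (auto intro!: derivative_eq_intros simp: power2_eq_square)
    from DERIV_power_Suc[OF this, of k] show ?thesis
      unfolding Suc by (rule DERIV_cong)
        (simp add: power2_eq_square algebra_simps add_divide_distrib diff_divide_distrib)
  qed simp
  moreover have "((\<lambda>t. exp (- (1 / t))) has_real_derivative exp (- (1 / t)) * (1 / t)\<^sup>2) (at t)"
    using greater by (auto intro!: derivative_eq_intros simp: power2_eq_square)
  ultimately have "((\<lambda>t. (1 / t) ^ m * exp (- (1 / t))) has_real_derivative
     (flat_pow (m + 2) t - of_nat m * flat_pow (m + 1) t)) (at t)"
    using greater by (auto intro!: DERIV_cong[OF DERIV_mult] simp: flat_pow_def power2_eq_square algebra_simps)
  then show ?thesis
    by (rule has_field_derivative_transform_within_open[where S = "{0<..}"])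
       (use greater in \<open>auto simp: flat_pow_def\<close>)
next
  case equal
  have lim: "(flat_pow k \<longlongrightarrow> 0) (at_right 0)" for k
  proof -
    have "((\<lambda>t. inverse t ^ k / exp (inverse t)) \<longlongrightarrow> 0) (at_right (0::real))"
      by (rule filterlim_compose[OF tendsto_power_div_exp_0 filterlim_inverse_at_top_right])
    then show ?thesis
      by (rule Lim_transform_eventually)
         (auto simp: eventually_at_right_less flat_pow_def exp_minus divide_inverse eventually_at
               intro!: exI[of _ 1])
  qed
  have "((\<lambda>h. (flat_pow m (0 + h) - flat_pow m 0) / h) \<longlongrightarrow> 0) (at 0)"
  proof (rule filterlim_split_at_real)
    show "((\<lambda>h. (flat_pow m (0 + h) - flat_pow m 0) / h) \<longlongrightarrow> 0) (at_left 0)"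
      by (rule Lim_transform_eventually[OF tendsto_const])
         (auto simp: eventually_at flat_pow_0 intro!: exI[of _ 1])
    show "((\<lambda>h. (flat_pow m (0 + h) - flat_pow m 0) / h) \<longlongrightarrow> 0) (at_right 0)"
      by (rule Lim_transform_eventually[OF lim[of "Suc m"]])
         (auto simp: eventually_at flat_pow_def intro!: exI[of _ 1])
  qed
  then show ?thesis using equal by (simp add: DERIV_def flat_pow_0)
qed

lemma smooth_on_flat_pow: "smooth_on UNIV (flat_pow m)"
proof -
  have "Ck_on k UNIV (flat_pow m)" for k
  proof (induction k arbitrary: m)
    case 0
    show ?case
      using DERIV_isCont[OF flat_pow_has_derivative] by (simp add: continuous_on_eq_continuous_at)
  next
    case (Suc k)
    have "Ck_on k UNIV (\<lambda>t. flat_pow (m + 2) t + (- of_nat m) * flat_pow (m + 1) t)"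
      by (intro Ck_on_add Ck_on_mult Ck_on_const open_UNIV Suc)
    then show ?case
      by (intro Ck_on_real_SucI[OF open_UNIV flat_pow_has_derivative]) simp
  qed
  then show ?thesis by (simp add: smooth_on_def)
qed

section \<open>Mean value arguments\<close>

lemma has_real_derivative_along_line:
  fixes f :: "'a::real_normed_vector \<Rightarrow> real"
  assumes "(f has_derivative D) (at (x + s *\<^sub>R u))"
  shows "((\<lambda>s. f (x + s *\<^sub>R u)) has_real_derivative D u) (at s)"
proof -
  have "((\<lambda>s. x + s *\<^sub>R u) has_derivative (\<lambda>t. t *\<^sub>R u)) (at s)"
    by (auto intro!: derivative_eq_intros)
  from has_derivative_compose[OF this assms]
  have "((\<lambda>s. f (x + s *\<^sub>R u)) has_derivative (\<lambda>t. D (t *\<^sub>R u))) (at s)" .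
  moreover have "(\<lambda>t. D (t *\<^sub>R u)) = (*) (D u)"
    using linear_cmul[OF has_derivative_linear[OF assms]] by (auto simp: fun_eq_iff)
  ultimately show ?thesis by (simp only: has_field_derivative_def)
qed

text \<open>Two applications of the mean value theorem. The left-hand side is symmetric in \<open>u\<close> and \<open>w\<close>, which
  yields the symmetry of second derivatives.\<close>

lemma second_difference_mean_value:
  fixes f :: "'a::real_normed_vector \<Rightarrow> real"
  assumes f: "smooth_on S f" and h: "h > 0"
    and S: "\<And>s t. 0 \<le> s \<Longrightarrow> s \<le> h \<Longrightarrow> 0 \<le> t \<Longrightarrow> t \<le> h \<Longrightarrow> x + s *\<^sub>R u + t *\<^sub>R w \<in> S"
  obtains s t where "0 < s" "s < h" "0 < t" "t < h"
    "f (x + h *\<^sub>R u + h *\<^sub>R w) - f (x + h *\<^sub>R u) - f (x + h *\<^sub>R w) + f x =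
     h * h * frechet_derivative (\<lambda>y. frechet_derivative f (at y) u) (at (x + s *\<^sub>R u + t *\<^sub>R w)) w"
proof -
  let ?A = "\<lambda>y. frechet_derivative f (at y) u"
  have d: "((\<lambda>s. f (x + s *\<^sub>R u + h *\<^sub>R w) - f (x + s *\<^sub>R u)) has_real_derivative
      (?A (x + s *\<^sub>R u + h *\<^sub>R w) - ?A (x + s *\<^sub>R u))) (at s)" if "0 \<le> s" "s \<le> h" for s
  proof (rule DERIV_diff)
    have "((\<lambda>s. f ((x + h *\<^sub>R w) + s *\<^sub>R u)) has_real_derivative ?A ((x + h *\<^sub>R w) + s *\<^sub>R u)) (at s)"
      using S[of s h] that h by (intro has_real_derivative_along_line smooth_on_has_derivative[OF f]) (simp add: ac_simps)
    then show "((\<lambda>s. f (x + s *\<^sub>R u + h *\<^sub>R w)) has_real_derivative ?A (x + s *\<^sub>R u + h *\<^sub>R w)) (at s)"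
      by (simp add: ac_simps)
    show "((\<lambda>s. f (x + s *\<^sub>R u)) has_real_derivative ?A (x + s *\<^sub>R u)) (at s)"
      using S[of s 0] that h by (intro has_real_derivative_along_line smooth_on_has_derivative[OF f]) simp
  qed
  obtain s where s: "0 < s" "s < h"
    "f (x + h *\<^sub>R u + h *\<^sub>R w) - f (x + h *\<^sub>R u) - (f (x + h *\<^sub>R w) - f x) =
      h * (?A (x + s *\<^sub>R u + h *\<^sub>R w) - ?A (x + s *\<^sub>R u))"
    using MVT2[OF h d] by auto
  have "((\<lambda>t. ?A (x + s *\<^sub>R u + t *\<^sub>R w)) has_real_derivative
      frechet_derivative ?A (at (x + s *\<^sub>R u + t *\<^sub>R w)) w) (at t)" if "0 \<le> t" "t \<le> h" for t
    using S[of s t] that s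
    by (intro has_real_derivative_along_line smooth_on_has_derivative[OF smooth_on_partial[OF f]]) simp
  from MVT2[OF h this] obtain t where t: "0 < t" "t < h"
    "?A (x + s *\<^sub>R u + h *\<^sub>R w) - ?A (x + s *\<^sub>R u) =
       h * frechet_derivative ?A (at (x + s *\<^sub>R u + t *\<^sub>R w)) w" by auto
  show ?thesis
    by (rule that[OF s(1,2) t(1,2)]) (use s(3) t(3) in \<open>simp add: algebra_simps\<close>)
qed

lemma mixed_partials_commute:
  fixes f :: "'a::real_normed_vector \<Rightarrow> real"
  assumes S: "open S" "x \<in> S" and f: "smooth_on S f"
  shows "frechet_derivative (\<lambda>y. frechet_derivative f (at y) u) (at x) w =
    frechet_derivative (\<lambda>y. frechet_derivative f (at y) w) (at x) u"
proof -
  define P where "P = (\<lambda>y. frechet_derivative (\<lambda>y. frechet_derivative f (at y) u) (at y) w)"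
  define Q where "Q = (\<lambda>y. frechet_derivative (\<lambda>y. frechet_derivative f (at y) w) (at y) u)"
  have "isCont P x" "isCont Q x"
    using smooth_on_continuous[OF smooth_on_partial[OF smooth_on_partial[OF f]]] S
    by (auto simp: P_def Q_def continuous_on_eq_continuous_at)
  have "\<bar>P x - Q x\<bar> \<le> e" if e: "e > 0" for e
  proof -
    have "((\<lambda>z. x + fst z *\<^sub>R u + snd z *\<^sub>R w) \<longlongrightarrow> x + 0 *\<^sub>R u + 0 *\<^sub>R w)
        (nhds (0::real, 0::real))"
      using tendsto_fst[OF filterlim_ident, of "(0::real, 0::real)"] tendsto_snd[OF filterlim_ident, of "(0::real, 0::real)"]
      unfolding fst_conv snd_conv
      by (intro tendsto_add tendsto_scaleR tendsto_const)
    then have lim: "((\<lambda>z. x + fst z *\<^sub>R u + snd z *\<^sub>R w) \<longlongrightarrow> x) (nhds (0::real, 0::real))"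
      by simp
    have "((\<lambda>y. dist (P y) (P x)) \<longlongrightarrow> 0) (nhds x)" "((\<lambda>y. dist (Q y) (Q x)) \<longlongrightarrow> 0) (nhds x)"
      using \<open>isCont P x\<close> \<open>isCont Q x\<close>
      by (simp_all add: isCont_def tendsto_at_iff_tendsto_nhds flip: tendsto_dist_iff)
    then have "\<forall>\<^sub>F y in nhds x. dist (P y) (P x) < e / 2" "\<forall>\<^sub>F y in nhds x. dist (Q y) (Q x) < e / 2"
      using e by (auto dest!: order_tendstoD(2)[of _ 0 _ "e / 2"])
    moreover have "\<forall>\<^sub>F y in nhds x. y \<in> S" using S by (simp add: eventually_nhds_in_open)
    ultimately have "\<forall>\<^sub>F y in nhds x. y \<in> S \<and> dist (P y) (P x) < e / 2 \<and> dist (Q y) (Q x) < e / 2"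
      by eventually_elim auto
    from eventually_compose_filterlim[OF this lim]
    obtain d where d: "d > 0" "\<And>s t. dist (s, t) (0, 0) < d \<Longrightarrow> x + s *\<^sub>R u + t *\<^sub>R w \<in> S \<and>
        dist (P (x + s *\<^sub>R u + t *\<^sub>R w)) (P x) < e / 2 \<and> dist (Q (x + s *\<^sub>R u + t *\<^sub>R w)) (Q x) < e / 2"
      by (auto simp: eventually_nhds_metric)
    define h where "h = d / 4"
    have h: "h > 0" using d by (simp add: h_def)
    have near: "dist (s, t) (0, 0) < d" if "0 \<le> s" "s \<le> h" "0 \<le> t" "t \<le> h" for s t :: real
    proof -
      have "dist (s, t) (0, 0) \<le> \<bar>s\<bar> + \<bar>t\<bar>" using norm_Pair_le[of s t] by (simp add: dist_norm)
      then show ?thesis using that d by (simp add: h_def)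
    qed
    have inS: "x + s *\<^sub>R u + t *\<^sub>R w \<in> S" "x + t *\<^sub>R w + s *\<^sub>R u \<in> S"
      if "0 \<le> s" "s \<le> h" "0 \<le> t" "t \<le> h" for s t
      using d(2)[OF near[OF that]] by (simp_all add: ac_simps)
    obtain s t where 1: "0 < s" "s < h" "0 < t" "t < h"
      "f (x + h *\<^sub>R u + h *\<^sub>R w) - f (x + h *\<^sub>R u) - f (x + h *\<^sub>R w) + f x = h * h * P (x + s *\<^sub>R u + t *\<^sub>R w)"
      unfolding P_def by (rule second_difference_mean_value[OF f h inS(1)])
    obtain s' t' where 2: "0 < s'" "s' < h" "0 < t'" "t' < h"
      "f (x + h *\<^sub>R w + h *\<^sub>R u) - f (x + h *\<^sub>R w) - f (x + h *\<^sub>R u) + f x = h * h * Q (x + s' *\<^sub>R w + t' *\<^sub>R u)"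
      unfolding Q_def by (rule second_difference_mean_value[OF f h inS(2)])
    have "f (x + h *\<^sub>R w + h *\<^sub>R u) = f (x + h *\<^sub>R u + h *\<^sub>R w)" by (simp add: ac_simps)
    then have "h * h * P (x + s *\<^sub>R u + t *\<^sub>R w) = h * h * Q (x + s' *\<^sub>R w + t' *\<^sub>R u)"
      using 1(5) 2(5) by linarith
    then have "P (x + s *\<^sub>R u + t *\<^sub>R w) = Q (x + t' *\<^sub>R u + s' *\<^sub>R w)"
      using h by (simp add: ac_simps)
    moreover have "\<bar>P (x + s *\<^sub>R u + t *\<^sub>R w) - P x\<bar> < e / 2"
      using d(2)[OF near, of s t] 1 by (simp add: dist_real_def)
    moreover have "\<bar>Q (x + t' *\<^sub>R u + s' *\<^sub>R w) - Q x\<bar> < e / 2"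
      using d(2)[OF near, of t' s'] 2 by (simp add: dist_real_def)
    ultimately show ?thesis by linarith
  qed
  then have "\<bar>P x - Q x\<bar> \<le> 0" by (rule field_le_epsilon) auto
  then show ?thesis by (simp add: P_def Q_def)
qed

text \<open>The Lipschitz bound is in terms of coordinates, as these are what the counting argument for generic
  thresholds subdivides.\<close>

lemma smooth_on_compact_convex_lipschitz:
  fixes f :: "'a::real_normed_vector \<Rightarrow> real"
  assumes co: "coordinates n b c" and f: "smooth_on S f" and K: "compact K" "convex K" "K \<subseteq> S"
  obtains L where "L > 0" "\<And>x y. x \<in> K \<Longrightarrow> y \<in> K \<Longrightarrow> \<bar>f x - f y\<bar> \<le> L * (\<Sum>i<n. \<bar>c i (x - y)\<bar>)"
proof -
  have "\<exists>M>0. \<forall>x\<in>K. \<bar>frechet_derivative f (at x) v\<bar> \<le> M" for v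
  proof -
    have "compact ((\<lambda>x. frechet_derivative f (at x) v) ` K)"
      using smooth_on_continuous[OF smooth_on_partial[OF f]] K
      by (intro compact_continuous_image) (auto intro: continuous_on_subset)
    then obtain M where "M > 0" "\<forall>y\<in>(\<lambda>x. frechet_derivative f (at x) v) ` K. norm y \<le> M"
      using compact_imp_bounded bounded_pos by blast
    then show ?thesis by (intro exI[of _ M]) simp
  qed
  then obtain M where M: "\<And>v. M v > 0" "\<And>v x. x \<in> K \<Longrightarrow> \<bar>frechet_derivative f (at x) v\<bar> \<le> M v"
    by metis
  define L where "L = 1 + (\<Sum>i<n. M (b i))"
  show ?thesis
  proof
    show "L > 0" using M(1) by (simp add: L_def add_pos_nonneg sum_nonneg less_imp_le)
    fix x y assume xy: "x \<in> K" "y \<in> K"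
    have seg: "y + t *\<^sub>R (x - y) \<in> K" if "0 \<le> t" "t \<le> 1" for t
      using convexD_alt[OF K(2) xy(2,1) that] by (simp add: algebra_simps)
    have "((\<lambda>t. f (y + t *\<^sub>R (x - y))) has_real_derivative
       frechet_derivative f (at (y + t *\<^sub>R (x - y))) (x - y)) (at t)" if "0 \<le> t" "t \<le> 1" for t
      using seg[OF that] K(3) by (intro has_real_derivative_along_line smooth_on_has_derivative[OF f]) auto
    from MVT2[OF _ this, of 0 1] obtain t where t: "0 < t" "t < 1"
      "f x - f y = frechet_derivative f (at (y + t *\<^sub>R (x - y))) (x - y)" by auto
    let ?D = "frechet_derivative f (at (y + t *\<^sub>R (x - y)))"
    have z: "y + t *\<^sub>R (x - y) \<in> K" using seg t by simp
    have "linear ?D" using smooth_on_has_derivative[OF f] z K(3) has_derivative_linear by blast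
    from linear_coordinates[OF co this, of "x - y"]
    have "\<bar>f x - f y\<bar> \<le> (\<Sum>i<n. \<bar>c i (x - y) * ?D (b i)\<bar>)"
      unfolding t(3) by (simp add: sum_abs)
    also have "\<dots> \<le> (\<Sum>i<n. \<bar>c i (x - y)\<bar> * L)"
    proof (rule sum_mono)
      fix i assume i: "i \<in> {..<n}"
      have "M (b i) \<le> (\<Sum>i<n. M (b i))"
        using i M(1) by (intro member_le_sum) (auto simp: less_imp_le)
      then have "\<bar>?D (b i)\<bar> \<le> L" using M(2)[OF z, of "b i"] by (simp add: L_def)
      then show "\<bar>c i (x - y) * ?D (b i)\<bar> \<le> \<bar>c i (x - y)\<bar> * L"
        by (simp add: abs_mult mult_left_mono)
    qed
    finally show "\<bar>f x - f y\<bar> \<le> L * (\<Sum>i<n. \<bar>c i (x - y)\<bar>)"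
      by (simp add: sum_distrib_left mult.commute)
  qed
qed

section \<open>Commuting complete fields on a ball\<close>

text \<open>A smooth step function \<open>cutoff\<close> from \<open>1\<close> on \<open>q \<le> 1/4\<close> to \<open>0\<close> on \<open>q \<ge> 1\<close>, and the function \<open>rad\<close>
  determined by the differential equation in \<open>cutoff_rad_equation\<close>. Solving that equation gives
  \<open>rad = 2 a a' / (a - 2 q a')\<close> with \<open>a = cutoff\<close>, where both numerator and denominator vanish to
  infinite order at \<open>q = 1\<close>. Cancelling \<open>exp (-1 / (1 - q))\<close> and clearing the remaining \<open>(1 - q)\<^sup>2\<close>
  leads to the formula below, whose denominator is positive everywhere.\<close>

definition cutoff_num :: "real \<Rightarrow> real" where
  "cutoff_num q = flat (1 - q)"

definition cutoff_den :: "real \<Rightarrow> real" where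
  "cutoff_den q = flat (1 - q) + flat (q - 1 / 4)"

definition cutoff_aux :: "real \<Rightarrow> real" where
  "cutoff_aux q = flat (q - 1 / 4) + (1 - q)\<^sup>2 * flat_pow 2 (q - 1 / 4)"

definition cutoff :: "real \<Rightarrow> real" where
  "cutoff q = cutoff_num q / cutoff_den q"

definition cutoff' :: "real \<Rightarrow> real" where
  "cutoff' q = - (flat_pow 2 (1 - q) * cutoff_aux q) / (cutoff_den q)\<^sup>2"

definition rad_den :: "real \<Rightarrow> real" where
  "rad_den q = (1 - q)\<^sup>2 * cutoff_den q + 2 * q * cutoff_aux q"

definition rad :: "real \<Rightarrow> real" where
  "rad q = - 2 * cutoff_num q * cutoff_aux q / (cutoff_den q * rad_den q)"

lemma cutoff_den_pos: "cutoff_den q > 0"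
  using flat_pow_pos[of "1 - q" 0] flat_pow_pos[of "q - 1/4" 0] flat_pow_nonneg[of 0 "1 - q"]
    flat_pow_nonneg[of 0 "q - 1/4"]
  unfolding cutoff_den_def by (cases "q < 1") linarith+

lemma cutoff_aux_nonneg: "cutoff_aux q \<ge> 0"
  by (simp add: cutoff_aux_def flat_pow_nonneg)

lemma cutoff_aux_pos: "q > 1 / 4 \<Longrightarrow> cutoff_aux q > 0"
  using flat_pow_pos[of "q - 1/4" 0] flat_pow_nonneg[of 2 "q - 1/4"]
  unfolding cutoff_aux_def by (intro add_pos_nonneg) simp_all

lemma cutoff_aux_0: "q \<le> 1 / 4 \<Longrightarrow> cutoff_aux q = 0"
  by (simp add: cutoff_aux_def flat_pow_0)

lemma rad_den_pos: "rad_den q > 0"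
proof (cases "q > 1 / 4")
  case True
  then have "2 * q * cutoff_aux q > 0" using cutoff_aux_pos[OF True] by simp
  moreover have "(1 - q)\<^sup>2 * cutoff_den q \<ge> 0" using cutoff_den_pos[of q] by simp
  ultimately show ?thesis unfolding rad_den_def by linarith
next
  case False
  then show ?thesis using cutoff_den_pos[of q] by (simp add: rad_den_def cutoff_aux_0)
qed

lemma cutoff_rad_inner: "q \<le> 1 / 4 \<Longrightarrow> cutoff q = 1" "q \<le> 1 / 4 \<Longrightarrow> rad q = 0"
  using flat_pow_pos[of "1 - q" 0]
  by (simp_all add: cutoff_def rad_def cutoff_aux_0 cutoff_num_def cutoff_den_def flat_pow_0)

lemma cutoff_rad_outer: "q \<ge> 1 \<Longrightarrow> cutoff q = 0" "q \<ge> 1 \<Longrightarrow> rad q = 0"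
  by (simp_all add: cutoff_def rad_def cutoff_num_def flat_pow_0)

lemma cutoff_pos: "q < 1 \<Longrightarrow> cutoff q > 0"
  using cutoff_den_pos[of q] by (simp add: cutoff_def cutoff_num_def flat_pow_pos)

lemma smooth_on_flat_pow_compose:
  "open S \<Longrightarrow> smooth_on S f \<Longrightarrow> smooth_on S (\<lambda>x. flat_pow m (f x))"
  by (rule smooth_on_real_compose[OF _ smooth_on_flat_pow])

lemma
  shows smooth_on_cutoff: "smooth_on UNIV cutoff" and smooth_on_cutoff': "smooth_on UNIV cutoff'"
    and smooth_on_rad: "smooth_on UNIV rad"
proof -
  note [intro!] = smooth_on_diff smooth_on_const smooth_on_id smooth_on_add smooth_on_mult
    smooth_on_flat_pow_compose
  have 1: "smooth_on UNIV (\<lambda>q. cutoff_num q)" unfolding cutoff_num_def by auto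
  have 2: "smooth_on UNIV (\<lambda>q. cutoff_den q)" unfolding cutoff_den_def by auto
  have 3: "smooth_on UNIV (\<lambda>q. cutoff_aux q)" unfolding cutoff_aux_def power2_eq_square by auto
  have 4: "smooth_on UNIV (\<lambda>q. rad_den q)" unfolding rad_den_def power2_eq_square using 2 3 by auto
  have pos: "cutoff_den q \<noteq> 0" "rad_den q \<noteq> 0" for q using cutoff_den_pos[of q] rad_den_pos[of q] by auto
  show "smooth_on UNIV cutoff" unfolding cutoff_def[abs_def]
    by (intro smooth_on_divide) (use 1 2 pos in auto)
  show "smooth_on UNIV cutoff'" unfolding cutoff'_def[abs_def] power2_eq_square
    by (intro smooth_on_divide smooth_on_minus) (use 2 3 pos in auto)
  show "smooth_on UNIV rad" unfolding rad_def[abs_def]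
    by (intro smooth_on_divide smooth_on_mult smooth_on_const open_UNIV 1 2 3 4) (use pos in auto)
qed

lemma cutoff_num_eq: "(1 - q)\<^sup>2 * flat_pow 2 (1 - q) = cutoff_num q"
  using flat_pow_Suc[of "1 - q" 1] flat_pow_Suc[of "1 - q" 0]
  by (simp add: cutoff_num_def power2_eq_square numeral_2_eq_2 mult.assoc)

lemma has_real_derivative_cutoff: "(cutoff has_real_derivative cutoff' q) (at q)"
proof -
  have f: "(flat has_real_derivative flat_pow 2 t) (at t)" for t
    using flat_pow_has_derivative[of 0 t] by (simp add: numeral_2_eq_2)
  have n: "(cutoff_num has_real_derivative - flat_pow 2 (1 - q)) (at q)"
    unfolding cutoff_num_def[abs_def]
    by (rule DERIV_cong[OF DERIV_chain2[OF f]]) (auto intro!: derivative_eq_intros)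
  have "((\<lambda>q. flat (q - 1 / 4)) has_real_derivative flat_pow 2 (q - 1 / 4)) (at q)"
    by (rule DERIV_cong[OF DERIV_chain2[OF f]]) (auto intro!: derivative_eq_intros)
  from DERIV_add[OF n this]
  have d: "(cutoff_den has_real_derivative - flat_pow 2 (1 - q) + flat_pow 2 (q - 1 / 4)) (at q)"
    unfolding cutoff_den_def[abs_def] cutoff_num_def[abs_def] .
  have "cutoff_den q \<noteq> 0" using cutoff_den_pos[of q] by simp
  from DERIV_divide[OF n d this] show ?thesis
    unfolding cutoff_def[abs_def]
  proof (rule DERIV_cong)
    let ?d = "flat_pow 2 (1 - q)" and ?e = "flat_pow 2 (q - 1 / 4)"
    have "- ?d * cutoff_den q - cutoff_num q * (- ?d + ?e) = - (?d * flat (q - 1 / 4)) - cutoff_num q * ?e"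
      by (simp add: cutoff_den_def cutoff_num_def algebra_simps)
    also have "\<dots> = - (?d * cutoff_aux q)"
      unfolding cutoff_num_eq[symmetric] cutoff_aux_def by (simp add: algebra_simps)
    finally show "(- ?d * cutoff_den q - cutoff_num q * (- ?d + ?e)) / (cutoff_den q * cutoff_den q) = cutoff' q"
      by (simp add: cutoff'_def power2_eq_square)
  qed
qed

text \<open>The condition under which the fields \<open>a(q) s + b(q) \<beta>(e, s) e\<close>, with \<open>a = cutoff\<close> and \<open>b = rad\<close>,
  commute for all \<open>s\<close>.\<close>

lemma cutoff_rad_equation: "2 * cutoff' q * (cutoff q + rad q * q) = cutoff q * rad q"
proof -
  define n c x r e where defs: "n = cutoff_num q" "c = cutoff_den q" "x = cutoff_aux q" "r = rad_den q"
    "e = flat_pow 2 (1 - q)"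
  have pos: "c > 0" "r > 0" using cutoff_den_pos rad_den_pos by (auto simp: defs)
  have n: "(1 - q)\<^sup>2 * e = n" and r: "r = (1 - q)\<^sup>2 * c + 2 * q * x"
    using cutoff_num_eq[of q] by (auto simp: defs rad_den_def)
  have 1: "cutoff q + rad q * q = n * (1 - q)\<^sup>2 / r"
  proof -
    have "cutoff q + rad q * q = (n * r - 2 * n * x * q) / (c * r)"
      using pos by (simp add: cutoff_def rad_def defs[symmetric] field_simps)
    also have "n * r - 2 * n * x * q = n * (1 - q)\<^sup>2 * c" by (simp add: r algebra_simps)
    finally show ?thesis using pos by simp
  qed
  have "2 * cutoff' q * (cutoff q + rad q * q) = - 2 * (e * (1 - q)\<^sup>2) * x * n / (c\<^sup>2 * r)"
    unfolding 1 cutoff'_def defs[symmetric] by simp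
  also have "\<dots> = - 2 * n * x * n / (c\<^sup>2 * r)" using n by (simp add: mult.commute)
  also have "\<dots> = cutoff q * rad q"
    by (simp add: cutoff_def rad_def defs[symmetric] power2_eq_square ac_simps)
  finally show ?thesis .
qed

text \<open>This is, up to a positive factor, the derivative of \<open>stretch\<close>.\<close>

lemma cutoff_derivative_gap: "q < 1 \<Longrightarrow> cutoff q - 2 * q * cutoff' q > 0"
proof (cases "q \<le> 1 / 4")
  case True
  then show ?thesis by (simp add: cutoff_rad_inner cutoff'_def cutoff_aux_0)
next
  case False
  assume q: "q < 1"
  have "cutoff' q \<le> 0"
    using flat_pow_nonneg[of 2 "1 - q"] cutoff_aux_nonneg[of q] by (simp add: cutoff'_def)
  then have "q * cutoff' q \<le> 0" using False by (intro mult_nonneg_nonpos) auto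
  then show ?thesis using cutoff_pos[OF q] by linarith
qed

text \<open>If \<open>q\<close> is the square of the length of \<open>e\<close>, then \<open>stretch q\<close> is that of \<open>e / cutoff q\<close>. As \<open>\<beta>\<close> is
  an arbitrary symmetric form, \<open>q\<close> ranges over all numbers below one, and \<open>stretch\<close> maps them onto
  the whole line.\<close>

definition stretch :: "real \<Rightarrow> real" where
  "stretch x = x / (cutoff x)\<^sup>2"

definition unstretch :: "real \<Rightarrow> real" where
  "unstretch = the_inv_into {..<1} stretch"

lemma has_real_derivative_stretch:
  assumes "x < 1"
  shows "(stretch has_real_derivative (cutoff x - 2 * x * cutoff' x) / cutoff x ^ 3) (at x)"
  unfolding stretch_def[abs_def]
  using cutoff_pos[OF assms]
  by (auto intro!: derivative_eq_intros has_real_derivative_cutoff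
      simp: power2_eq_square power3_eq_cube field_simps)

lemma stretch_strict_mono: "x < y \<Longrightarrow> y < 1 \<Longrightarrow> stretch x < stretch y"
  by (rule DERIV_pos_imp_increasing_open[of x y stretch])
     (force intro!: exI divide_pos_pos has_real_derivative_stretch cutoff_derivative_gap cutoff_pos zero_less_power
        continuous_at_imp_continuous_on DERIV_isCont)+

lemma stretch_inj: "inj_on stretch {..<1}"
  by (rule inj_onI) (metis lessThan_iff less_irrefl linorder_neqE stretch_strict_mono)

lemma stretch_surj: "\<exists>x<1. stretch x = y"
proof -
  have cont: "continuous_on {a..b} stretch" if "b < 1" for a b
    using that by (intro continuous_at_imp_continuous_on ballI DERIV_isCont[OF has_real_derivative_stretch]) auto
  define a where "a = min 0 y"
  have a: "a < 1" "stretch a \<le> y" by (auto simp: a_def stretch_def cutoff_rad_inner)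
  have "isCont cutoff 1" using has_real_derivative_cutoff DERIV_isCont by blast
  then have "(cutoff \<longlongrightarrow> 0) (at_left 1)"
    using cutoff_rad_outer(1)[of 1] by (simp add: isCont_def filterlim_at_split)
  moreover define e where "e = 1 / (2 * (1 + \<bar>y\<bar>))"
  have e: "e > 0" by (simp add: e_def add_pos_nonneg)
  ultimately have "\<forall>\<^sub>F x in at_left 1. cutoff x < min e 1" by (auto intro!: eventually_conj order_tendstoD(2)[of cutoff 0 _ e] order_tendstoD(2)[of cutoff 0 _ 1])
  moreover have "\<forall>\<^sub>F x in at_left 1. x \<in> {max (1/2) a<..<1}"
    using a by (intro eventually_at_left_real) auto
  ultimately have "\<forall>\<^sub>F x in at_left 1. cutoff x < min e 1 \<and> x \<in> {max (1/2) a<..<1}"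
    by (rule eventually_conj)
  then obtain b where b: "cutoff b < e" "cutoff b < 1" "b > 1/2" "b > a" "b < 1"
    using eventually_happens'[OF trivial_limit_at_left_real] by fastforce
  have "(cutoff b)\<^sup>2 \<le> cutoff b * 1" unfolding power2_eq_square using b cutoff_pos[of b] by (intro mult_left_mono) auto
  then have "(cutoff b)\<^sup>2 \<le> e" using b by simp
  then have "(1 + \<bar>y\<bar>) * (cutoff b)\<^sup>2 \<le> (1 + \<bar>y\<bar>) * e" by (intro mult_left_mono) auto
  also have "\<dots> = 1 / 2" by (simp add: e_def field_simps)
  finally have "(1 + \<bar>y\<bar>) * (cutoff b)\<^sup>2 \<le> b" using b by simp
  moreover have "y * (cutoff b)\<^sup>2 \<le> (1 + \<bar>y\<bar>) * (cutoff b)\<^sup>2" by (intro mult_right_mono) auto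
  ultimately have "y \<le> stretch b" using cutoff_pos[of b] b by (simp add: stretch_def field_simps)
  then obtain x where "a \<le> x" "x \<le> b" "stretch x = y"
    using IVT'[of stretch a y b] a b cont[of b a] by auto
  then show ?thesis using b by (intro exI[of _ x]) simp
qed

lemma
  shows unstretch_less: "unstretch y < 1" and stretch_unstretch: "stretch (unstretch y) = y"
    and unstretch_stretch: "x < 1 \<Longrightarrow> unstretch (stretch x) = x"
proof -
  have img: "stretch ` {..<1} = UNIV"
  proof -
    have "y \<in> stretch ` {..<1}" for y using stretch_surj[of y] by auto
    then show ?thesis by auto
  qed
  show "unstretch y < 1"
    using the_inv_into_into[OF stretch_inj _ order_refl, of y] img by (simp add: unstretch_def)
  show "stretch (unstretch y) = y"
    using f_the_inv_into_f[OF stretch_inj, of y] img by (simp add: unstretch_def)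
  show "x < 1 \<Longrightarrow> unstretch (stretch x) = x"
    using the_inv_into_f_f[OF stretch_inj, of x] by (simp add: unstretch_def)
qed

definition unstretch' :: "real \<Rightarrow> real" where
  "unstretch' x = cutoff x ^ 3 / (cutoff x - 2 * x * cutoff' x)"

lemma has_real_derivative_unstretch:
  "(unstretch has_real_derivative unstretch' (unstretch y)) (at y)"
proof -
  let ?x = "unstretch y"
  have x: "?x < 1" by (rule unstretch_less)
  have "isCont unstretch (stretch ?x)"
  proof (rule isCont_inverse_function2[where f = stretch and x = ?x and a = "?x - 1" and b = "(?x + 1) / 2"])
    show "?x - 1 < ?x" "?x < (?x + 1) / 2" using x by auto
    show "unstretch (stretch z) = z" if "?x - 1 \<le> z" "z \<le> (?x + 1) / 2" for z
      using that x by (intro unstretch_stretch) auto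
    show "isCont stretch z" if "?x - 1 \<le> z" "z \<le> (?x + 1) / 2" for z
      using that x by (intro DERIV_isCont[OF has_real_derivative_stretch]) auto
  qed
  then have "isCont unstretch y" by (simp add: stretch_unstretch)
  moreover have "(cutoff ?x - 2 * ?x * cutoff' ?x) / cutoff ?x ^ 3 \<noteq> 0"
    using cutoff_derivative_gap[OF x] cutoff_pos[OF x] by simp
  ultimately have "(unstretch has_real_derivative
      inverse ((cutoff ?x - 2 * ?x * cutoff' ?x) / cutoff ?x ^ 3)) (at y)"
    by (intro DERIV_inverse_function[where f = stretch and a = "y - 1" and b = "y + 1"]
        has_real_derivative_stretch[OF x]) (simp_all add: stretch_unstretch)
  then show ?thesis by (simp add: unstretch'_def)
qed

lemma smooth_on_unstretch: "smooth_on UNIV unstretch"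
proof -
  have S: "smooth_on {..<1} unstretch'"
    unfolding unstretch'_def[abs_def] power3_eq_cube
    using smooth_on_subset[OF smooth_on_cutoff, of "{..<1}"] smooth_on_subset[OF smooth_on_cutoff', of "{..<1}"]
    by (intro smooth_on_divide smooth_on_mult smooth_on_diff smooth_on_id smooth_on_const)
       (auto dest: cutoff_derivative_gap)
  have "Ck_on k UNIV unstretch" for k
  proof (induction k)
    case 0
    show ?case
      using DERIV_isCont[OF has_real_derivative_unstretch] by (simp add: continuous_on_eq_continuous_at)
  next
    case (Suc k)
    show ?case
    proof (rule Ck_on_real_SucI[OF open_UNIV has_real_derivative_unstretch])
      show "Ck_on k UNIV (\<lambda>y. unstretch' (unstretch y))"
        by (rule Ck_on_compose[OF finite_dimensional_real, where T = "{..<1}"])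
           (use S Suc unstretch_less in \<open>auto simp: smooth_on_def\<close>)
    qed
  qed
  then show ?thesis by (simp add: smooth_on_def)
qed

text \<open>The image of the constant field \<open>s\<close> under the inverse of \<open>v \<mapsto> v / cutoff (\<beta> v v)\<close>, extended by zero
  to the complement of the unit ball.\<close>

definition ball_field :: "('b \<Rightarrow> 'b \<Rightarrow> real) \<Rightarrow> 'b::real_normed_vector \<Rightarrow> 'b \<Rightarrow> 'b" where
  "ball_field \<beta> s v = cutoff (\<beta> v v) *\<^sub>R s + (rad (\<beta> v v) * \<beta> v s) *\<^sub>R v"

text \<open>The derivative of the field in the direction \<open>h\<close>.\<close>

definition ball_field' :: "('b \<Rightarrow> 'b \<Rightarrow> real) \<Rightarrow> 'b::real_normed_vector \<Rightarrow> 'b \<Rightarrow> 'b \<Rightarrow> 'b" where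
  "ball_field' \<beta> s v h = (cutoff' (\<beta> v v) * (2 * \<beta> v h)) *\<^sub>R s +
     (deriv rad (\<beta> v v) * (2 * \<beta> v h) * \<beta> v s + rad (\<beta> v v) * \<beta> h s) *\<^sub>R v +
     (rad (\<beta> v v) * \<beta> v s) *\<^sub>R h"

lemma has_real_derivative_rad: "(rad has_real_derivative deriv rad q) (at q)"
  using smooth_on_differentiable[OF smooth_on_rad, of q] DERIV_deriv_iff_real_differentiable by simp

lemma ball_field_has_derivative:
  assumes \<beta>: "bounded_bilinear \<beta>" and sym: "\<And>u v. \<beta> u v = \<beta> v u"
  shows "(ball_field \<beta> s has_derivative ball_field' \<beta> s v) (at v)"
proof -
  interpret bounded_bilinear \<beta> by (rule \<beta>)
  have q: "((\<lambda>v. \<beta> v v) has_derivative (\<lambda>h. 2 * \<beta> v h)) (at v)"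
    using FDERIV[OF has_derivative_ident has_derivative_ident, of v UNIV] sym[of _ v] by simp
  have l: "((\<lambda>v. \<beta> v s) has_derivative (\<lambda>h. \<beta> h s)) (at v)"
    by (rule bounded_linear.has_derivative[OF bounded_linear_left has_derivative_ident])
  have c: "((\<lambda>v. cutoff (\<beta> v v)) has_derivative (\<lambda>h. cutoff' (\<beta> v v) * (2 * \<beta> v h))) (at v)"
    using has_derivative_compose[OF q, of cutoff "(*) (cutoff' (\<beta> v v))"] has_real_derivative_cutoff
    by (simp add: has_field_derivative_def)
  have r: "((\<lambda>v. rad (\<beta> v v)) has_derivative (\<lambda>h. deriv rad (\<beta> v v) * (2 * \<beta> v h))) (at v)"
    using has_derivative_compose[OF q, of rad "(*) (deriv rad (\<beta> v v))"] has_real_derivative_rad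
    by (simp add: has_field_derivative_def)
  note r[derivative_intros] c[derivative_intros] l[derivative_intros]
  show ?thesis unfolding ball_field_def[abs_def]
    by (auto intro!: derivative_eq_intros simp: ball_field'_def fun_eq_iff algebra_simps)
qed

text \<open>In the difference of both sides the multiples of \<open>v\<close> cancel by symmetry of \<open>\<beta>\<close>; what is left is
  \<open>2 a' (a + q b) - a b\<close> times \<open>\<beta>(v, s) t - \<beta>(v, t) s\<close>.\<close>

lemma ball_fields_commute:
  assumes \<beta>: "bounded_bilinear \<beta>" and sym: "\<And>u v. \<beta> u v = \<beta> v u"
  shows "ball_field' \<beta> t v (ball_field \<beta> s v) = ball_field' \<beta> s v (ball_field \<beta> t v)"
proof -
  interpret bounded_bilinear \<beta> by (rule \<beta>)
  define q where "q = \<beta> v v"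
  define c where "c = cutoff q + rad q * q"
  have b: "\<beta> v (ball_field \<beta> s v) = \<beta> v s * c" for s
    by (simp add: ball_field_def add_right scaleR_right q_def[symmetric] c_def algebra_simps)
  have b': "\<beta> (ball_field \<beta> s v) t = cutoff q * \<beta> s t + rad q * \<beta> v s * \<beta> v t" for s t
    by (simp add: ball_field_def add_left scaleR_left q_def)
  have eq: "2 * cutoff' q * c = cutoff q * rad q"
    using cutoff_rad_equation[of q] by (simp add: c_def)
  have "ball_field' \<beta> t v (ball_field \<beta> s v) =
     (\<beta> v s * (2 * cutoff' q * c)) *\<^sub>R t + (\<beta> v t * (cutoff q * rad q)) *\<^sub>R s +
     (deriv rad q * 2 * c * \<beta> v s * \<beta> v t + rad q * cutoff q * \<beta> s t
       + rad q * rad q * \<beta> v s * \<beta> v t) *\<^sub>R v + (rad q * rad q * \<beta> v s * \<beta> v t) *\<^sub>R v" for s t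
    unfolding ball_field'_def b b' q_def[symmetric]
    unfolding ball_field_def[of _ s v] q_def[symmetric]
    by (simp add: algebra_simps)
  then show ?thesis unfolding eq by (simp add: sym[of t s] algebra_simps)
qed

text \<open>Inside the ball the integral curves are the images of the straight lines in direction \<open>s\<close>; outside
  they are constant.\<close>

lemma ball_field_complete:
  assumes \<beta>: "bounded_bilinear \<beta>" and sym: "\<And>u v. \<beta> u v = \<beta> v u"
  obtains w where "smooth_on UNIV w" "w 0 = v"
    "\<And>t. (w has_vector_derivative ball_field \<beta> s (w t)) (at t)"
proof (cases "\<beta> v v < 1")
  case False
  then have "ball_field \<beta> s v = 0" by (simp add: ball_field_def cutoff_rad_outer)
  then show ?thesis by (intro that[of "\<lambda>_. v"]) (auto simp: smooth_on_const)
next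
  case True
  interpret bounded_bilinear \<beta> by (rule \<beta>)
  let ?c = "cutoff (\<beta> v v)"
  have c: "?c > 0" by (rule cutoff_pos[OF True])
  \<comment> \<open>The straight line through the preimage of \<open>v\<close>.\<close>
  define y where "y t = v /\<^sub>R ?c + t *\<^sub>R s" for t
  define Q where "Q t = \<beta> (y t) (y t)" for t
  \<comment> \<open>The squared length of the image of \<open>y t\<close>, recovered from that of \<open>y t\<close>.\<close>
  define x where "x t = unstretch (Q t)" for t
  define w where "w t = cutoff (x t) *\<^sub>R y t" for t
  have x1: "x t < 1" for t by (simp add: x_def unstretch_less)
  have Q: "Q t = x t / (cutoff (x t))\<^sup>2" for t
    using stretch_unstretch[of "Q t"] by (simp add: x_def stretch_def)
  have ww: "\<beta> (w t) (w t) = x t" for t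
    using cutoff_pos[OF x1[of t]]
    by (simp add: w_def scaleR_left scaleR_right Q_def[symmetric] Q power2_eq_square)
  have Q0: "Q 0 = stretch (\<beta> v v)"
    by (simp add: Q_def y_def scaleR_left scaleR_right stretch_def power2_eq_square field_simps)
  have y': "(y has_vector_derivative s) (at t)" for t
    unfolding y_def[abs_def] by (auto intro!: derivative_eq_intros)
  have Q': "(Q has_real_derivative 2 * \<beta> (y t) s) (at t)" for t
    using FDERIV[OF y'[unfolded has_vector_derivative_def] y'[unfolded has_vector_derivative_def]]
    unfolding Q_def[abs_def] has_field_derivative_def
    by (rule has_derivative_eq_rhs) (auto simp: fun_eq_iff scaleR_left scaleR_right sym[of s] algebra_simps)
  have x': "(x has_real_derivative unstretch' (x t) * (2 * \<beta> (y t) s)) (at t)" for t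
    unfolding x_def[abs_def] by (rule DERIV_chain2[OF has_real_derivative_unstretch Q'])
  have "(w has_vector_derivative ball_field \<beta> s (w t)) (at t)" for t
  proof -
    let ?x = "x t"
    have c: "cutoff ?x > 0" and g: "cutoff ?x - 2 * ?x * cutoff' ?x > 0"
      using cutoff_pos[OF x1] cutoff_derivative_gap[OF x1] by auto
    have "((\<lambda>t. cutoff (x t)) has_real_derivative cutoff' ?x * (unstretch' ?x * (2 * \<beta> (y t) s))) (at t)"
      by (rule DERIV_chain2[OF has_real_derivative_cutoff x'])
    from has_vector_derivative_scaleR[OF this y'[of t]]
    have "(w has_vector_derivative cutoff ?x *\<^sub>R s + (cutoff' ?x * (unstretch' ?x * (2 * \<beta> (y t) s))) *\<^sub>R y t) (at t)"
      by (simp add: w_def[abs_def])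
    moreover have "cutoff' ?x * (unstretch' ?x * (2 * \<beta> (y t) s)) = rad ?x * \<beta> (w t) s * cutoff ?x"
    proof -
      have "2 * cutoff' ?x * cutoff ?x = rad ?x * (cutoff ?x - 2 * ?x * cutoff' ?x)"
        using cutoff_rad_equation[of ?x] by (simp add: algebra_simps)
      then have "2 * cutoff' ?x * unstretch' ?x = rad ?x * (cutoff ?x)\<^sup>2"
      proof -
        have "2 * cutoff' ?x * unstretch' ?x =
            2 * cutoff' ?x * cutoff ?x * (cutoff ?x)\<^sup>2 / (cutoff ?x - 2 * ?x * cutoff' ?x)"
          by (simp add: unstretch'_def power2_eq_square power3_eq_cube)
        then show ?thesis using g unfolding \<open>2 * cutoff' ?x * cutoff ?x = _\<close> by simp
      qed
      then have "(2 * cutoff' ?x * unstretch' ?x) * \<beta> (y t) s = rad ?x * (cutoff ?x)\<^sup>2 * \<beta> (y t) s" by simp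
      then show ?thesis by (simp add: w_def scaleR_left power2_eq_square algebra_simps)
    qed
    ultimately show ?thesis by (simp add: ball_field_def ww) (simp add: w_def)
  qed
  moreover have "smooth_on UNIV w"
  proof -
    have sy: "smooth_on UNIV y"
      unfolding y_def[abs_def] by (intro smooth_on_add smooth_on_scaleR smooth_on_const smooth_on_id open_UNIV)
    then have "smooth_on UNIV Q"
      unfolding Q_def[abs_def] smooth_on_def by (auto intro!: Ck_on_bilinear[OF \<beta>])
    then have "smooth_on UNIV x"
      unfolding x_def[abs_def] by (rule smooth_on_real_compose[OF open_UNIV smooth_on_unstretch])
    then show ?thesis unfolding w_def[abs_def]
      by (intro smooth_on_scaleR smooth_on_real_compose[OF open_UNIV smooth_on_cutoff] sy open_UNIV)
  qed
  moreover have "w 0 = v"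
    using c unstretch_stretch[OF True] by (simp add: w_def x_def Q0) (simp add: y_def)
  ultimately show ?thesis using that by blast
qed

section \<open>Smooth functions on manifolds\<close>

text \<open>The part of the definition of a manifold that concerns single charts. It is inherited by products with
  a vector space, on which smooth functions are considered as well.\<close>

definition charted :: "('m::topological_space, 'a::real_normed_vector) chart set \<Rightarrow> bool" where
  "charted A \<longleftrightarrow> finite_dimensional TYPE('a) \<and> (\<forall>c\<in>A. is_chart c) \<and> (\<Union>(U, \<phi>)\<in>A. U) = UNIV"

lemma smooth_manifold_charted: "smooth_manifold A \<Longrightarrow> charted A"
  by (simp add: smooth_manifold_def charted_def)

lemma chartedD:
  assumes "charted A" "(U, \<phi>) \<in> A"
  shows "open U" "homeomorphism U (\<phi> ` U) \<phi> (inv_into U \<phi>)" "open (\<phi> ` U)"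
    and "inj_on \<phi> U" "x \<in> U \<Longrightarrow> inv_into U \<phi> (\<phi> x) = x"
    and "continuous_on U \<phi>" "continuous_on (\<phi> ` U) (inv_into U \<phi>)"
proof -
  show 1: "open U" "homeomorphism U (\<phi> ` U) \<phi> (inv_into U \<phi>)" "open (\<phi> ` U)"
    using assms by (auto simp: charted_def is_chart_def)
  show "inj_on \<phi> U" using 1(2) by (metis homeomorphism_def inj_on_inverseI)
  show "x \<in> U \<Longrightarrow> inv_into U \<phi> (\<phi> x) = x" using 1(2) by (simp add: homeomorphism_def)
  show "continuous_on U \<phi>" "continuous_on (\<phi> ` U) (inv_into U \<phi>)"
    using 1(2) by (simp_all add: homeomorphism_def)
qed

lemma charted_obtain:
  assumes "charted A"
  obtains U \<phi> where "(U, \<phi>) \<in> A" "x \<in> U"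
proof -
  have "x \<in> (\<Union>(U, \<phi>)\<in>A. U)" using assms by (simp add: charted_def)
  then show ?thesis using that by blast
qed

lemma chart_image_open:
  assumes "charted A" "(U, \<phi>) \<in> A" "open S"
  shows "open (\<phi> ` (U \<inter> S))"
proof -
  have "openin (top_of_set (\<phi> ` U)) (\<phi> ` (U \<inter> S))"
    using homeomorphism_imp_open_map[OF chartedD(2)[OF assms(1,2)]] assms(3) by (simp add: openin_open_Int)
  then show ?thesis using chartedD(3)[OF assms(1,2)] by (rule openin_open_trans)
qed

abbreviation smooth_fun_on ::
  "('m::topological_space, 'a::real_normed_vector) chart set \<Rightarrow> 'm set \<Rightarrow> ('m \<Rightarrow> 'b::real_normed_vector) \<Rightarrow> bool" where
  "smooth_fun_on A S f \<equiv> smooth_map_on A euclidean_atlas S f"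

lemma smooth_fun_on_alt:
  "smooth_fun_on A S f \<longleftrightarrow> continuous_on S f \<and> (\<forall>(U, \<phi>)\<in>A. smooth_on (\<phi> ` (U \<inter> S)) (\<lambda>y. f (inv_into U \<phi> y)))"
  by (auto simp: smooth_map_on_def euclidean_atlas_def o_def)

lemma smooth_fun_on_iff:
  assumes A: "charted A" and S: "open S"
  shows "smooth_fun_on A S f \<longleftrightarrow> (\<forall>(U, \<phi>)\<in>A. smooth_on (\<phi> ` (U \<inter> S)) (\<lambda>y. f (inv_into U \<phi> y)))"
proof
  assume *: "\<forall>(U, \<phi>)\<in>A. smooth_on (\<phi> ` (U \<inter> S)) (\<lambda>y. f (inv_into U \<phi> y))"
  have "continuous_on S f"
  proof -
    have "continuous_on (U \<inter> S) f" if U: "(U, \<phi>) \<in> A" for U \<phi>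
    proof -
      have "continuous_on (U \<inter> S) (\<lambda>x. f (inv_into U \<phi> (\<phi> x)))"
      proof (rule continuous_on_compose2[of "\<phi> ` (U \<inter> S)" "\<lambda>y. f (inv_into U \<phi> y)"])
        show "continuous_on (\<phi> ` (U \<inter> S)) (\<lambda>y. f (inv_into U \<phi> y))"
          using * U by (auto intro: smooth_on_continuous)
        show "continuous_on (U \<inter> S) \<phi>"
          using chartedD(6)[OF A U] by (rule continuous_on_subset) simp
      qed simp
      then show ?thesis by (rule continuous_on_eq) (simp add: chartedD(5)[OF A U])
    qed
    then have "continuous_on (\<Union>((\<lambda>(U, \<phi>). U \<inter> S) ` A)) f"
      using chartedD(1)[OF A] S by (intro continuous_on_open_Union) auto
    moreover have "\<Union>((\<lambda>(U, \<phi>). U \<inter> S) ` A) = S"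
    proof -
      have "x \<in> \<Union>((\<lambda>(U, \<phi>). U \<inter> S) ` A)" if x: "x \<in> S" for x
      proof -
        obtain U \<phi> where "(U, \<phi>) \<in> A" "x \<in> U" using charted_obtain[OF A] .
        then show ?thesis using x by (intro UN_I[of "(U, \<phi>)"]) auto
      qed
      then show ?thesis by auto
    qed
    ultimately show ?thesis by simp
  qed
  with * show "smooth_fun_on A S f" by (simp add: smooth_fun_on_alt)
qed (simp add: smooth_fun_on_alt)

lemma smooth_functions_smooth_fun_on: "smooth_functions A = {f. smooth_fun_on A UNIV f}"
  by (simp add: smooth_functions_def)

lemma smooth_fun_on_local:
  assumes A: "charted A" and S: "open S"
    and "\<And>x. x \<in> S \<Longrightarrow> \<exists>W. open W \<and> x \<in> W \<and> smooth_fun_on A (W \<inter> S) f"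
  shows "smooth_fun_on A S f"
  unfolding smooth_fun_on_iff[OF A S]
proof (clarify, rule smooth_on_local)
  fix U \<phi> y assume U: "(U, \<phi>) \<in> A" and "y \<in> \<phi> ` (U \<inter> S)"
  then obtain x where x: "x \<in> U" "x \<in> S" "y = \<phi> x" by auto
  obtain W where W: "open W" "x \<in> W" "smooth_fun_on A (W \<inter> S) f" using assms(3)[OF x(2)] by blast
  have "open (\<phi> ` (U \<inter> (W \<inter> S)))" using chart_image_open[OF A U, of "W \<inter> S"] W S by auto
  moreover have "smooth_on (\<phi> ` (U \<inter> (W \<inter> S))) (\<lambda>y. f (inv_into U \<phi> y))"
    using W(3) U by (auto simp: smooth_fun_on_alt)
  ultimately show "\<exists>T. open T \<and> y \<in> T \<and> smooth_on (T \<inter> \<phi> ` (U \<inter> S)) (\<lambda>y. f (inv_into U \<phi> y))"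
    using x W by (intro exI[of _ "\<phi> ` (U \<inter> (W \<inter> S))"]) (auto intro: smooth_on_subset)
qed

lemma smooth_fun_on_subset:
  "smooth_fun_on A S f \<Longrightarrow> T \<subseteq> S \<Longrightarrow> smooth_fun_on A T f"
  unfolding smooth_fun_on_alt
proof (intro conjI ballI, goal_cases)
  case (2 c)
  then have "smooth_on (snd c ` (fst c \<inter> S)) (\<lambda>y. f (inv_into (fst c) (snd c) y))"
    by (auto simp: case_prod_unfold)
  moreover have "snd c ` (fst c \<inter> T) \<subseteq> snd c ` (fst c \<inter> S)" using 2 by auto
  ultimately show ?case by (auto simp: case_prod_unfold intro: smooth_on_subset)
qed (auto intro: continuous_on_subset)

lemma smooth_fun_on_cong:
  assumes A: "charted A" and S: "open S" and eq: "\<And>x. x \<in> S \<Longrightarrow> f x = g x" and f: "smooth_fun_on A S f"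
  shows "smooth_fun_on A S g"
  unfolding smooth_fun_on_iff[OF A S]
proof clarify
  fix U \<phi> assume U: "(U, \<phi>) \<in> A"
  show "smooth_on (\<phi> ` (U \<inter> S)) (\<lambda>y. g (inv_into U \<phi> y))"
    by (rule smooth_on_cong[OF chart_image_open[OF A U S], of "\<lambda>y. f (inv_into U \<phi> y)"])
       (use f U eq chartedD(5)[OF A U] in \<open>auto simp: smooth_fun_on_alt\<close>)
qed

lemma smooth_fun_on_const: "charted A \<Longrightarrow> open S \<Longrightarrow> smooth_fun_on A S (\<lambda>x. c)"
  by (auto simp: smooth_fun_on_iff smooth_on_const)

lemma smooth_fun_on_add:
  assumes "charted A" "open S" "smooth_fun_on A S f" "smooth_fun_on A S g"
  shows "smooth_fun_on A S (\<lambda>x. f x + g x)"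
  using assms by (auto simp: smooth_fun_on_iff intro!: smooth_on_add chart_image_open[OF assms(1)])

lemma smooth_fun_on_mult:
  fixes f g :: "_ \<Rightarrow> real"
  assumes "charted A" "open S" "smooth_fun_on A S f" "smooth_fun_on A S g"
  shows "smooth_fun_on A S (\<lambda>x. f x * g x)"
  using assms by (auto simp: smooth_fun_on_iff intro!: smooth_on_mult chart_image_open[OF assms(1)])

lemma smooth_fun_on_divide:
  fixes f g :: "_ \<Rightarrow> real"
  assumes "charted A" "open S" "smooth_fun_on A S f" "smooth_fun_on A S g" "\<And>x. x \<in> S \<Longrightarrow> g x \<noteq> 0"
  shows "smooth_fun_on A S (\<lambda>x. f x / g x)"
  unfolding smooth_fun_on_iff[OF assms(1,2)]
proof clarify
  fix U \<phi> assume U: "(U, \<phi>) \<in> A"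
  show "smooth_on (\<phi> ` (U \<inter> S)) (\<lambda>y. f (inv_into U \<phi> y) / g (inv_into U \<phi> y))"
    by (rule smooth_on_divide[OF chart_image_open[OF assms(1) U assms(2)]])
       (use assms(3-5) U chartedD(5)[OF assms(1) U] in \<open>auto simp: smooth_fun_on_alt\<close>)
qed

lemma smooth_fun_on_real_compose:
  fixes f :: "_ \<Rightarrow> real" and h :: "real \<Rightarrow> real"
  assumes "charted A" "open S" "smooth_fun_on A S f" "smooth_on UNIV h"
  shows "smooth_fun_on A S (\<lambda>x. h (f x))"
  unfolding smooth_fun_on_iff[OF assms(1,2)]
proof clarify
  fix U \<phi> assume U: "(U, \<phi>) \<in> A"
  show "smooth_on (\<phi> ` (U \<inter> S)) (\<lambda>y. h (f (inv_into U \<phi> y)))"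
    by (rule smooth_on_real_compose[OF chart_image_open[OF assms(1) U assms(2)] assms(4)])
       (use assms(3) U in \<open>auto simp: smooth_fun_on_alt\<close>)
qed

lemma smooth_fun_on_sum:
  fixes f :: "_ \<Rightarrow> _ \<Rightarrow> 'b::real_normed_vector"
  assumes "charted A" "open S" "\<And>i. i \<in> I \<Longrightarrow> smooth_fun_on A S (f i)"
  shows "smooth_fun_on A S (\<lambda>x. \<Sum>i\<in>I. f i x)"
  using assms(3)
  by (induction I rule: infinite_finite_induct)
     (simp_all add: smooth_fun_on_const smooth_fun_on_add assms(1,2))

lemma smooth_fun_on_prod:
  fixes f :: "_ \<Rightarrow> _ \<Rightarrow> real"
  assumes "charted A" "open S" "\<And>i. i \<in> I \<Longrightarrow> smooth_fun_on A S (f i)"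
  shows "smooth_fun_on A S (\<lambda>x. \<Prod>i\<in>I. f i x)"
  using assms(3)
  by (induction I rule: infinite_finite_induct)
     (simp_all add: smooth_fun_on_const smooth_fun_on_mult assms(1,2))

lemma smooth_fun_on_compose:
  assumes A: "charted A" and B: "charted (B :: ('n::topological_space, 'b::real_normed_vector) chart set)"
    and S: "open S" and T: "open T"
    and f: "smooth_map_on A B S f" "f ` S \<subseteq> T" and g: "smooth_fun_on B T g"
  shows "smooth_fun_on A S (\<lambda>x. g (f x))"
  unfolding smooth_fun_on_iff[OF A S]
proof (clarify, rule smooth_on_local)
  fix U \<phi> y assume U: "(U, \<phi>) \<in> A" and "y \<in> \<phi> ` (U \<inter> S)"
  then obtain x where x: "x \<in> U" "x \<in> S" "y = \<phi> x" by auto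
  obtain V \<psi> where V: "(V, \<psi>) \<in> B" "f x \<in> V" using charted_obtain[OF B] .
  have cf: "continuous_on S f" using f by (simp add: smooth_map_on_def)
  have oW: "open (S \<inter> f -` V)"
    using continuous_open_preimage[OF cf S chartedD(1)[OF B V(1)]] .
  let ?N = "\<phi> ` (U \<inter> (S \<inter> f -` V))"
  have N: "open ?N" by (rule chart_image_open[OF A U oW])
  have "smooth_on ?N (\<lambda>y. (\<lambda>z. g (inv_into V \<psi> z)) (\<psi> (f (inv_into U \<phi> y))))"
  proof (rule smooth_on_compose[where T = "\<psi> ` (V \<inter> T)"])
    show "finite_dimensional TYPE('b)" using B by (simp add: charted_def)
    show "open (\<psi> ` (V \<inter> T))" by (rule chart_image_open[OF B V(1) T])
    show "(\<lambda>y. \<psi> (f (inv_into U \<phi> y))) ` ?N \<subseteq> \<psi> ` (V \<inter> T)"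
      using f(2) by (auto simp: chartedD(5)[OF A U])
    show "smooth_on (\<psi> ` (V \<inter> T)) (\<lambda>z. g (inv_into V \<psi> z))"
      using g V by (auto simp: smooth_fun_on_alt)
    show "smooth_on ?N (\<lambda>y. \<psi> (f (inv_into U \<phi> y)))"
      using f(1) U V by (fastforce simp: smooth_map_on_def o_def Int_assoc)
  qed (rule N)
  then have "smooth_on ?N (\<lambda>y. g (f (inv_into U \<phi> y)))"
    by (rule smooth_on_cong[OF N, rotated]) (auto simp: chartedD(5)[OF A U] chartedD(5)[OF B V(1)])
  then show "\<exists>T. open T \<and> y \<in> T \<and> smooth_on (T \<inter> \<phi> ` (U \<inter> S)) (\<lambda>y. g (f (inv_into U \<phi> y)))"
    using N x V by (intro exI[of _ ?N]) (auto intro: smooth_on_subset)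
qed

text \<open>\<open>W\<close> and the complement of \<open>K\<close> are an open cover, and \<open>g\<close> is smooth on each of the two.\<close>

lemma smooth_fun_on_extend_zero:
  fixes f :: "'m::topological_space \<Rightarrow> 'b::real_normed_vector"
  assumes A: "charted A" and W: "open W" and K: "closed K" "K \<subseteq> W" and S: "open S"
    and f: "smooth_fun_on A (W \<inter> S) f" and eq: "\<And>x. x \<in> W \<Longrightarrow> x \<in> S \<Longrightarrow> g x = f x"
    and zero: "\<And>x. x \<in> S \<Longrightarrow> x \<notin> K \<Longrightarrow> g x = 0"
  shows "smooth_fun_on A S g"
proof (rule smooth_fun_on_local[OF A S])
  fix x assume x: "x \<in> S"
  show "\<exists>V. open V \<and> x \<in> V \<and> smooth_fun_on A (V \<inter> S) g"
  proof (cases "x \<in> W")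
    case True
    have "smooth_fun_on A (W \<inter> S) g"
      by (rule smooth_fun_on_cong[OF A _ _ f]) (use W S eq in auto)
    then show ?thesis using W True by blast
  next
    case False
    have "smooth_fun_on A (- K \<inter> S) g"
      by (rule smooth_fun_on_cong[OF A _ _ smooth_fun_on_const[OF A, of _ 0]]) (use K S zero in auto)
    then show ?thesis using K False by (intro exI[of _ "- K"]) auto
  qed
qed

definition locally_finite_on :: "'m::topological_space set \<Rightarrow> (nat \<Rightarrow> 'm \<Rightarrow> 'b::zero) \<Rightarrow> bool" where
  "locally_finite_on S f \<longleftrightarrow>
     (\<forall>x\<in>S. \<exists>W J. open W \<and> x \<in> W \<and> (\<forall>j\<ge>J. \<forall>y\<in>W \<inter> S. f j y = 0))"

lemma smooth_fun_on_suminf: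
  fixes f :: "nat \<Rightarrow> _ \<Rightarrow> real"
  assumes A: "charted A" and S: "open S" and f: "\<And>j. smooth_fun_on A S (f j)"
    and fin: "locally_finite_on S f"
  shows "smooth_fun_on A S (\<lambda>x. \<Sum>j. f j x)"
proof (rule smooth_fun_on_local[OF A S])
  fix x assume "x \<in> S"
  then obtain W J where W: "open W" "x \<in> W" "\<And>j y. j \<ge> J \<Longrightarrow> y \<in> W \<Longrightarrow> y \<in> S \<Longrightarrow> f j y = 0"
    using fin unfolding locally_finite_on_def by (metis IntI)
  have o: "open (W \<inter> S)" using W S by auto
  have 1: "smooth_fun_on A (W \<inter> S) (\<lambda>x. \<Sum>j<J. f j x)"
    by (rule smooth_fun_on_sum[OF A o], rule smooth_fun_on_subset[OF f]) auto
  have 2: "(\<Sum>j<J. f j y) = (\<Sum>j. f j y)" if "y \<in> W \<inter> S" for y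
    using that W(3) by (intro suminf_finite[symmetric]) (auto simp: not_less)
  have "smooth_fun_on A (W \<inter> S) (\<lambda>x. \<Sum>j. f j x)"
    by (rule smooth_fun_on_cong[OF A o 2 1])
  then show "\<exists>W. open W \<and> x \<in> W \<and> smooth_fun_on A (W \<inter> S) (\<lambda>x. \<Sum>j. f j x)" using W by blast
qed

section \<open>Products with a vector space\<close>

lemma charted_euclidean: "finite_dimensional TYPE('a::real_normed_vector) \<Longrightarrow> charted (euclidean_atlas :: ('a, 'a) chart set)"
  by (auto simp: charted_def euclidean_atlas_def is_chart_def homeomorphism_def inv_into_def)

lemma inv_into_map_prod:
  assumes "inj_on \<phi> U" "inj_on \<psi> V" "x \<in> \<phi> ` U" "y \<in> \<psi> ` V"
  shows "inv_into (U \<times> V) (map_prod \<phi> \<psi>) (x, y) = (inv_into U \<phi> x, inv_into V \<psi> y)"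
  using assms by (intro inv_into_f_eq map_prod_inj_on) (auto simp: inv_into_into)

lemma charted_prod:
  assumes A: "charted (A :: ('m::topological_space, 'a::real_normed_vector) chart set)"
    and B: "charted (B :: ('n::topological_space, 'b::real_normed_vector) chart set)"
  shows "charted (prod_atlas A B)"
  unfolding charted_def
proof (intro conjI ballI)
  show "finite_dimensional TYPE('a \<times> 'b)"
    using A B by (intro finite_dimensional_prod) (auto simp: charted_def)
  show "(\<Union>(U, \<phi>)\<in>prod_atlas A B. U) = UNIV"
  proof -
    have "(x, y) \<in> (\<Union>(U, \<phi>)\<in>prod_atlas A B. U)" for x y
    proof -
      obtain U \<phi> V \<psi> where "(U, \<phi>) \<in> A" "x \<in> U" "(V, \<psi>) \<in> B" "y \<in> V"
        using charted_obtain[OF A] charted_obtain[OF B] by metis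
      then show ?thesis by (intro UN_I[of "(U \<times> V, map_prod \<phi> \<psi>)"]) (auto simp: prod_atlas_def)
    qed
    then show ?thesis by auto
  qed
  fix c assume "c \<in> prod_atlas A B"
  then obtain U \<phi> V \<psi> where c: "c = (U \<times> V, map_prod \<phi> \<psi>)" "(U, \<phi>) \<in> A" "(V, \<psi>) \<in> B"
    by (auto simp: prod_atlas_def)
  note a = chartedD[OF A c(2)] and b = chartedD[OF B c(3)]
  have img: "map_prod \<phi> \<psi> ` (U \<times> V) = \<phi> ` U \<times> \<psi> ` V" by (auto simp: image_iff)
  have inv: "inv_into (U \<times> V) (map_prod \<phi> \<psi>) z = (inv_into U \<phi> (fst z), inv_into V \<psi> (snd z))"
    if "z \<in> \<phi> ` U \<times> \<psi> ` V" for z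
    using inv_into_map_prod[OF a(4) b(4)] that by (cases z) auto
  have cont: "continuous_on (\<phi> ` U \<times> \<psi> ` V) (inv_into (U \<times> V) (map_prod \<phi> \<psi>))"
  proof (rule continuous_on_eq[OF _ inv[symmetric]])
    show "continuous_on (\<phi> ` U \<times> \<psi> ` V) (\<lambda>z. (inv_into U \<phi> (fst z), inv_into V \<psi> (snd z)))"
      by (intro continuous_on_Pair continuous_on_compose2[OF a(7)] continuous_on_compose2[OF b(7)] continuous_intros) auto
  qed
  have cont': "continuous_on (U \<times> V) (map_prod \<phi> \<psi>)"
    unfolding map_prod_def case_prod_unfold
    by (intro continuous_on_Pair continuous_on_compose2[OF a(6)] continuous_on_compose2[OF b(6)] continuous_intros) auto
  have "homeomorphism (U \<times> V) (\<phi> ` U \<times> \<psi> ` V) (map_prod \<phi> \<psi>) (inv_into (U \<times> V) (map_prod \<phi> \<psi>))"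
    unfolding homeomorphism_def
  proof (intro conjI ballI cont cont' img)
    have inj: "inj_on (map_prod \<phi> \<psi>) (U \<times> V)" using a(4) b(4) by (rule map_prod_inj_on)
    show "inv_into (U \<times> V) (map_prod \<phi> \<psi>) (map_prod \<phi> \<psi> x) = x" if "x \<in> U \<times> V" for x
      using inv_into_f_f[OF inj that] .
    show "map_prod \<phi> \<psi> (inv_into (U \<times> V) (map_prod \<phi> \<psi>) y) = y" if "y \<in> \<phi> ` U \<times> \<psi> ` V" for y
      using that img by (intro f_inv_into_f) simp
    show "inv_into (U \<times> V) (map_prod \<phi> \<psi>) ` (\<phi> ` U \<times> \<psi> ` V) = U \<times> V"
      unfolding img[symmetric] using inj by (rule inv_into_image_cancel) simp
  qed
  then show "is_chart c"
    unfolding c(1) is_chart_def using a b by (simp add: img open_Times)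
qed

lemma charted_prod_euclidean:
  assumes "charted A" "finite_dimensional TYPE('b::real_normed_vector)"
  shows "charted (prod_atlas A (euclidean_atlas :: ('b, 'b) chart set))"
  by (rule charted_prod[OF assms(1) charted_euclidean[OF assms(2)]])

lemma smooth_fun_on_prod_euclidean_iff:
  fixes f :: "'m::topological_space \<times> 'b::real_normed_vector \<Rightarrow> 'c::real_normed_vector"
  assumes A: "charted A" and fd: "finite_dimensional TYPE('b)" and S: "open S"
  shows "smooth_fun_on (prod_atlas A euclidean_atlas) (S \<times> UNIV) f \<longleftrightarrow>
    (\<forall>(U, \<phi>)\<in>A. smooth_on (\<phi> ` (U \<inter> S) \<times> UNIV) (\<lambda>(x, v). f (inv_into U \<phi> x, v)))"
proof -
  have eq: "smooth_on (map_prod \<phi> (\<lambda>v. v) ` (U \<times> UNIV \<inter> S \<times> UNIV))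
        (\<lambda>y. f (inv_into (U \<times> UNIV) (map_prod \<phi> (\<lambda>v. v)) y)) \<longleftrightarrow>
      smooth_on (\<phi> ` (U \<inter> S) \<times> UNIV) (\<lambda>(x, v). f (inv_into U \<phi> x, v))" if U: "(U, \<phi>) \<in> A" for U \<phi>
  proof -
    have img: "map_prod \<phi> (\<lambda>v. v) ` (U \<times> UNIV \<inter> S \<times> (UNIV::'b set)) = \<phi> ` (U \<inter> S) \<times> UNIV"
      by (auto simp: image_iff)
    have o: "open (\<phi> ` (U \<inter> S) \<times> (UNIV :: 'b set))"
      using chart_image_open[OF A U S] by (simp add: open_Times)
    have inv: "inv_into (U \<times> UNIV) (map_prod \<phi> (\<lambda>v. v)) z = (inv_into U \<phi> (fst z), snd z)"
      if "z \<in> \<phi> ` (U \<inter> S) \<times> (UNIV :: 'b set)" for z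
      using inv_into_map_prod[OF chartedD(4)[OF A U], of "\<lambda>v::'b. v" UNIV "fst z" "snd z"] that
      by (auto simp: inv_into_def)
    show ?thesis unfolding img
      by (rule iffI; erule smooth_on_cong[OF o, rotated]) (auto simp: inv split: prod.splits)
  qed
  have atlas: "prod_atlas A euclidean_atlas = (\<lambda>c. (fst c \<times> UNIV, map_prod (snd c) (\<lambda>v::'b. v))) ` A"
    by (force simp: prod_atlas_def euclidean_atlas_def)
  have "smooth_fun_on (prod_atlas A euclidean_atlas) (S \<times> UNIV) f \<longleftrightarrow>
    (\<forall>(U, \<phi>)\<in>A. smooth_on (map_prod \<phi> (\<lambda>v. v) ` (U \<times> UNIV \<inter> S \<times> UNIV))
        (\<lambda>y. f (inv_into (U \<times> UNIV) (map_prod \<phi> (\<lambda>v. v)) y)))"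
    unfolding smooth_fun_on_iff[OF charted_prod_euclidean[OF A fd] open_Times[OF S open_UNIV]]
    unfolding atlas by (simp add: case_prod_unfold)
  also have "\<dots> \<longleftrightarrow> (\<forall>(U, \<phi>)\<in>A. smooth_on (\<phi> ` (U \<inter> S) \<times> UNIV) (\<lambda>(x, v). f (inv_into U \<phi> x, v)))"
  proof (rule ball_cong[OF refl])
    fix c assume "c \<in> A"
    then show "(case c of (U, \<phi>) \<Rightarrow> smooth_on (map_prod \<phi> (\<lambda>v. v) ` (U \<times> UNIV \<inter> S \<times> UNIV))
        (\<lambda>y. f (inv_into (U \<times> UNIV) (map_prod \<phi> (\<lambda>v. v)) y))) \<longleftrightarrow>
      (case c of (U, \<phi>) \<Rightarrow> smooth_on (\<phi> ` (U \<inter> S) \<times> UNIV) (\<lambda>(x, v). f (inv_into U \<phi> x, v)))"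
      using eq[of "fst c" "snd c"] by (cases c) simp
  qed
  finally show ?thesis .
qed

lemma smooth_fun_on_prod_linear:
  fixes L :: "'b::real_normed_vector \<Rightarrow> 'c::real_normed_vector"
  assumes A: "charted A" and fd: "finite_dimensional TYPE('b)" and S: "open S" and L: "bounded_linear L"
  shows "smooth_fun_on (prod_atlas A euclidean_atlas) (S \<times> UNIV) (\<lambda>z. L (snd z))"
  unfolding smooth_fun_on_prod_euclidean_iff[OF A fd S]
proof clarify
  fix U \<phi> assume U: "(U, \<phi>) \<in> A"
  have "smooth_on (\<phi> ` (U \<inter> S) \<times> UNIV) (\<lambda>z. L (snd z))"
    using chart_image_open[OF A U S]
    by (intro smooth_on_linear_compose[OF L] smooth_on_linear bounded_linear_snd open_Times open_UNIV)
  then show "smooth_on (\<phi> ` (U \<inter> S) \<times> UNIV) (\<lambda>(x, v). L (snd (inv_into U \<phi> x, v)))"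
    by (simp add: case_prod_unfold)
qed

text \<open>Freezing the base point is composition with an affine map in a chart.\<close>

lemma smooth_fun_on_prod_slice:
  fixes f :: "'m::topological_space \<times> 'b::real_normed_vector \<Rightarrow> 'c::real_normed_vector"
  assumes A: "charted A" and fd: "finite_dimensional TYPE('b)" and S: "open S"
    and f: "smooth_fun_on (prod_atlas A euclidean_atlas) (S \<times> UNIV) f"
    and "p \<in> S"
  shows "smooth_on UNIV (\<lambda>v. f (p, v))"
proof -
  obtain U \<phi> where U: "(U, \<phi>) \<in> A" "p \<in> U" using charted_obtain[OF A] .
  let ?F = "\<lambda>(x, v). f (inv_into U \<phi> x, v)"
  have F: "smooth_on (\<phi> ` (U \<inter> S) \<times> UNIV) ?F"
    using f U by (auto simp: smooth_fun_on_prod_euclidean_iff[OF A fd S])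
  have fd': "finite_dimensional TYPE('a \<times> 'b)" if "charted (A :: ('m, 'a::real_normed_vector) chart set)" for A
    using that fd by (intro finite_dimensional_prod) (auto simp: charted_def)
  have "smooth_on UNIV (\<lambda>v. ?F (\<phi> p, v))"
  proof (rule smooth_on_compose[OF fd'[OF A] open_UNIV _ _ F])
    show "open (\<phi> ` (U \<inter> S) \<times> (UNIV :: 'b set))"
      using chart_image_open[OF A U(1) S] by (simp add: open_Times)
    show "(\<lambda>v. (\<phi> p, v)) ` UNIV \<subseteq> \<phi> ` (U \<inter> S) \<times> UNIV" using U assms(5) by auto
    have "smooth_on UNIV (\<lambda>v. (\<phi> p, 0) + (0, v :: 'b))"
      by (intro smooth_on_add smooth_on_const smooth_on_linear open_UNIV bounded_linear_Pair
          bounded_linear_zero bounded_linear_ident)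
    then show "smooth_on UNIV (\<lambda>v :: 'b. (\<phi> p, v))" by simp
  qed
  then show ?thesis by (simp add: chartedD(5)[OF A U(1) U(2)])
qed

text \<open>In charts of the product, a derivative along the second factor is one of the directional derivatives
  whose smoothness is part of the definition of a smooth map.\<close>

lemma smooth_fun_on_prod_partial:
  fixes f :: "'m::topological_space \<times> 'b::real_normed_vector \<Rightarrow> 'c::real_normed_vector"
  assumes A: "charted A" and fd: "finite_dimensional TYPE('b)" and S: "open S"
    and f: "smooth_fun_on (prod_atlas A euclidean_atlas) (S \<times> UNIV) f"
  shows "smooth_fun_on (prod_atlas A euclidean_atlas) (S \<times> UNIV)
    (\<lambda>(p, v). frechet_derivative (\<lambda>v. f (p, v)) (at v) w)"
  unfolding smooth_fun_on_prod_euclidean_iff[OF A fd S]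
proof (intro ballI, goal_cases)
  case (1 c)
  define U \<phi> where "U = fst c" and "\<phi> = snd c"
  have c: "c = (U, \<phi>)" and U: "(U, \<phi>) \<in> A" using 1 by (simp_all add: U_def \<phi>_def)
  let ?N = "\<phi> ` (U \<inter> S) \<times> (UNIV :: 'b set)"
  let ?F = "\<lambda>(x, v). f (inv_into U \<phi> x, v)"
  have F: "smooth_on ?N ?F" using f U by (auto simp: smooth_fun_on_prod_euclidean_iff[OF A fd S])
  have "frechet_derivative ?F (at z) (0, w) = frechet_derivative (\<lambda>v. f (inv_into U \<phi> (fst z), v)) (at (snd z)) w"
    if z: "z \<in> ?N" for z
  proof -
    have "((\<lambda>v. (fst z, v)) has_derivative (\<lambda>v. (0, v))) (at (snd z))"
      by (auto intro!: derivative_eq_intros)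
    from has_derivative_compose[OF this, of ?F] smooth_on_has_derivative[OF F z]
    have "((\<lambda>v. f (inv_into U \<phi> (fst z), v)) has_derivative (\<lambda>v. frechet_derivative ?F (at z) (0, v))) (at (snd z))"
      by simp
    from frechet_derivative_at[OF this] show ?thesis by metis
  qed
  note eq = this
  have "open ?N" using chart_image_open[OF A U S] by (simp add: open_Times)
  from smooth_on_cong[OF this eq smooth_on_partial[OF F]] show ?case
    by (simp add: c case_prod_unfold)
qed

section \<open>Bump functions\<close>

lemma smooth_on_prod:
  fixes f :: "'i \<Rightarrow> 'a::real_normed_vector \<Rightarrow> real"
  assumes "open S" "\<And>i. i \<in> I \<Longrightarrow> smooth_on S (f i)"
  shows "smooth_on S (\<lambda>x. \<Prod>i\<in>I. f i x)"
  using assms(2)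
  by (induction I rule: infinite_finite_induct) (simp_all add: smooth_on_const smooth_on_mult assms(1))

text \<open>The bump is a product of one-variable bumps in the coordinates of a chart, so that its support is a
  cube in that chart. Convexity of the cube makes smooth functions Lipschitz on it.\<close>

lemma bump_function:
  assumes A: "smooth_manifold (A :: ('m::{t2_space,second_countable_topology}, 'a::real_normed_vector) chart set)"
    and co: "coordinates n (b :: nat \<Rightarrow> 'a) c" and W: "open W" "p \<in> W"
  obtains \<rho> K V \<phi> where "smooth_fun_on A UNIV \<rho>" "\<rho> p = (1::real)" "\<And>x. \<rho> x \<noteq> 0 \<Longrightarrow> x \<in> K"
    "compact K" "K \<subseteq> W" "(V, \<phi>) \<in> A" "K \<subseteq> V" "convex (\<phi> ` K)"
proof -
  have cA: "charted A" using A by (rule smooth_manifold_charted)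
  obtain V \<phi> where V: "(V, \<phi>) \<in> A" "p \<in> V" using charted_obtain[OF cA] .
  note ch = chartedD[OF cA V(1)]
  have "open (\<phi> ` (V \<inter> W))" by (rule chart_image_open[OF cA V(1) W(1)])
  then obtain e where e: "e > 0" "ball (\<phi> p) e \<subseteq> \<phi> ` (V \<inter> W)"
    using V W unfolding open_contains_ball by blast
  define M where "M = 1 + (\<Sum>i<n. norm (b i))"
  have M: "M > 0" by (simp add: M_def add_pos_nonneg sum_nonneg)
  \<comment> \<open>The cube of half side \<open>r\<close> in coordinates lies in the ball of radius \<open>e\<close>.\<close>
  define r where "r = e / (2 * M)"
  have r: "r > 0" using e M by (simp add: r_def)
  define C where "C = {x. \<forall>i<n. \<bar>c i (x - \<phi> p)\<bar> \<le> r}"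
  have C: "C \<subseteq> \<phi> ` (V \<inter> W)"
  proof
    fix x assume x: "x \<in> C"
    have "norm (x - \<phi> p) = norm (\<Sum>i<n. c i (x - \<phi> p) *\<^sub>R b i)"
      by (simp add: coordinatesD(2)[OF co])
    also have "\<dots> \<le> (\<Sum>i<n. r * norm (b i))"
      using x by (intro sum_norm_le) (auto simp: C_def intro!: mult_right_mono)
    also have "\<dots> \<le> r * M" using r by (simp add: M_def sum_distrib_left[symmetric])
    also have "\<dots> < e" using e M by (simp add: r_def)
    finally show "x \<in> \<phi> ` (V \<inter> W)" using e(2) by (auto simp: dist_norm norm_minus_commute)
  qed
  have Cc: "compact C"
  proof (rule finite_dimensional_compact[OF co])
    have "closed {x. \<bar>c i (x - \<phi> p)\<bar> \<le> r}" if "i < n" for i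
      by (intro closed_Collect_le continuous_intros bounded_linear.continuous_on[OF coordinatesD(1)[OF co that]])
    then have "closed (\<Inter>i\<in>{..<n}. {x. \<bar>c i (x - \<phi> p)\<bar> \<le> r})" by (intro closed_INT) auto
    moreover have "C = (\<Inter>i\<in>{..<n}. {x. \<bar>c i (x - \<phi> p)\<bar> \<le> r})" by (auto simp: C_def)
    ultimately show "closed C" by simp
    fix x i assume x: "x \<in> C" and i: "i < n"
    have "\<bar>c i x\<bar> \<le> r + \<bar>c i (\<phi> p)\<bar>" using x i coordinatesD(6)[OF co i, of x "\<phi> p"] by (auto simp: C_def)
    also have "\<dots> \<le> r + (\<Sum>i<n. \<bar>c i (\<phi> p)\<bar>)" using i by (intro add_left_mono member_le_sum) auto
    finally show "\<bar>c i x\<bar> \<le> r + (\<Sum>i<n. \<bar>c i (\<phi> p)\<bar>)" .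
  qed
  have Cv: "convex C"
  proof (rule convexI)
    fix x y and u v :: real assume xy: "x \<in> C" "y \<in> C" "0 \<le> u" "0 \<le> v" "u + v = 1"
    have "\<bar>c i (u *\<^sub>R x + v *\<^sub>R y - \<phi> p)\<bar> \<le> r" if i: "i < n" for i
    proof -
      have "u *\<^sub>R x + v *\<^sub>R y - \<phi> p = u *\<^sub>R (x - \<phi> p) + v *\<^sub>R (y - \<phi> p)"
        using xy(5) by (simp add: algebra_simps flip: scaleR_add_left)
      then have "c i (u *\<^sub>R x + v *\<^sub>R y - \<phi> p) = u * c i (x - \<phi> p) + v * c i (y - \<phi> p)"
        using coordinatesD(4,5)[OF co i] by simp
      also have "\<bar>\<dots>\<bar> \<le> u * r + v * r"
        using xy i by (intro order_trans[OF abs_triangle_ineq] add_mono)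
          (auto simp: abs_mult C_def intro!: mult_left_mono)
      also have "\<dots> = r" using xy(5) by (simp flip: distrib_right)
      finally show ?thesis .
    qed
    then show "u *\<^sub>R x + v *\<^sub>R y \<in> C" by (simp add: C_def)
  qed
  define K where "K = inv_into V \<phi> ` C"
  have K: "K \<subseteq> V \<inter> W" using C ch(5) by (fastforce simp: K_def)
  have Kimg: "\<phi> ` K = C"
  proof -
    have "\<phi> (inv_into V \<phi> x) = x" if "x \<in> C" for x using C that by (intro f_inv_into_f) auto
    then show ?thesis by (simp add: K_def image_image)
  qed
  have KC: "x \<in> K" if "x \<in> V" "\<phi> x \<in> C" for x
    using that ch(5)[of x] by (auto simp: K_def intro!: image_eqI[of _ _ "\<phi> x"])
  have Kc: "compact K"
    unfolding K_def using C by (intro compact_continuous_image Cc continuous_on_subset[OF ch(7)]) auto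
  define h where "h x = (\<Prod>i<n. exp 1 * flat (1 - (c i (x - \<phi> p) / r)\<^sup>2))" for x
  have h: "smooth_on UNIV h"
  proof -
    have "smooth_on UNIV (\<lambda>x. exp 1 * flat (1 - (c i (x - \<phi> p) / r)\<^sup>2))" if "i < n" for i
      unfolding power2_eq_square
      by (intro smooth_on_mult smooth_on_const smooth_on_flat_pow_compose smooth_on_diff smooth_on_divide
          open_UNIV smooth_on_linear_compose[OF coordinatesD(1)[OF co that]] smooth_on_id) (use r in auto)
    then show ?thesis unfolding h_def[abs_def] by (intro smooth_on_prod) auto
  qed
  have h0: "h x = 0" if "x \<notin> C" for x
  proof -
    have "\<not> (\<forall>i<n. \<bar>c i (x - \<phi> p)\<bar> \<le> r)" using that by (simp add: C_def)
    then obtain i where i: "i < n" "\<bar>c i (x - \<phi> p)\<bar> > r" by (meson not_le)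
    then have "1 \<le> \<bar>c i (x - \<phi> p) / r\<bar>" using r by (simp add: abs_divide)
    then have "1 \<le> (c i (x - \<phi> p) / r)\<^sup>2" using one_le_power[of "\<bar>c i (x - \<phi> p) / r\<bar>" 2]
      unfolding power2_abs by simp
    then have "exp 1 * flat (1 - (c i (x - \<phi> p) / r)\<^sup>2) = 0" by (simp add: flat_pow_0)
    then show ?thesis unfolding h_def using i by (intro prod_zero) auto
  qed
  define \<rho> where "\<rho> x = (if x \<in> V then h (\<phi> x) else 0)" for x
  show ?thesis
  proof (rule that[of \<rho> K])
    show "\<rho> p = 1" using V by (simp add: \<rho>_def h_def coordinatesD(7)[OF co] flat_pow_def exp_minus)
    show "x \<in> K" if "\<rho> x \<noteq> 0" for x using that h0 KC by (auto simp: \<rho>_def split: if_splits)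
    have "smooth_fun_on A V (\<lambda>x. h (\<phi> x))"
    proof (subst smooth_fun_on_iff[OF cA ch(1)], clarify)
      fix U \<psi> assume U: "(U, \<psi>) \<in> A"
      have "smooth_on (\<psi> ` (U \<inter> V)) (\<lambda>x. \<phi> (inv_into U \<psi> x))"
        using A U V by (fastforce simp: smooth_manifold_def o_def)
      then show "smooth_on (\<psi> ` (U \<inter> V)) (\<lambda>y. h (\<phi> (inv_into U \<psi> y)))"
        using smooth_on_compose[OF _ chart_image_open[OF cA U ch(1)] open_UNIV _ h] cA
        by (simp add: charted_def)
    qed
    then show "smooth_fun_on A UNIV \<rho>"
      by (intro smooth_fun_on_extend_zero[OF cA ch(1) compact_imp_closed[OF Kc] _ open_UNIV, where f = "\<lambda>x. h (\<phi> x)"])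
         (use K KC h0 in \<open>auto simp: \<rho>_def\<close>)
  qed (use Kc K V Kimg Cv in auto)
qed

section \<open>Covers of bounded multiplicity\<close>

text \<open>A Lipschitz map from an \<open>n\<close>-dimensional set to \<open>\<real>\<^sup>n\<^sup>+\<^sup>1\<close> cannot hit all points of a fine grid: the
  grid of mesh \<open>\<epsilon> / N\<close> has \<open>N\<^sup>n\<^sup>+\<^sup>1\<close> points, while \<open>O(N\<^sup>n)\<close> cells cover the set, each with an image too
  small to contain two of these points. The functions \<open>u\<close> are the coordinates on the set.\<close>

lemma lipschitz_image_misses_grid:
  fixes f :: "nat \<Rightarrow> 'm \<Rightarrow> real" and u :: "nat \<Rightarrow> 'm \<Rightarrow> real"
  assumes u: "\<And>x i. x \<in> K \<Longrightarrow> i < n \<Longrightarrow> \<bar>u i x\<bar> \<le> R"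
    and f: "\<And>x y m. x \<in> K \<Longrightarrow> y \<in> K \<Longrightarrow> m \<le> n \<Longrightarrow> \<bar>f m x - f m y\<bar> \<le> L * (\<Sum>i<n. \<bar>u i x - u i y\<bar>)"
    and L: "L > 0" and \<epsilon>: "\<epsilon> > 0"
  obtains t where "\<And>m. m \<le> n \<Longrightarrow> a m \<le> t m \<and> t m \<le> a m + \<epsilon>"
    "\<And>x. x \<in> K \<Longrightarrow> \<exists>m\<le>n. f m x \<noteq> t m"
proof -
  \<comment> \<open>Cells have side \<open>1 / (\<Lambda> N)\<close>; this \<open>\<Lambda>\<close> makes the image of a cell smaller than the mesh \<open>\<epsilon> / N\<close>.\<close>
  define \<Lambda> where "\<Lambda> = L * n / \<epsilon> + 1"
  have \<Lambda>: "\<Lambda> > 0" "L * n < \<epsilon> * \<Lambda>"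
    using L \<epsilon> by (simp_all add: \<Lambda>_def add_nonneg_pos distrib_left)
  define B where "B = nat \<lceil>\<bar>R\<bar> * \<Lambda>\<rceil>"
  have B: "\<bar>R\<bar> * \<Lambda> \<le> B" using \<Lambda> by (simp add: B_def of_nat_ceiling)
  \<comment> \<open>There are at most \<open>((2 B + 1) N)\<^sup>n\<close> cells, which is less than \<open>N\<^sup>n\<^sup>+\<^sup>1\<close> for this \<open>N\<close>.\<close>
  define N where "N = (2 * B + 1) ^ n + 1"
  have N: "N > 0" by (simp add: N_def)
  define G where "G = PiE {..n} (\<lambda>_. {..<N})"
  define t where "t k m = a m + \<epsilon> * (of_nat (k m) / of_nat N)" for k :: "nat \<Rightarrow> nat" and m
  define cell where "cell x = restrict (\<lambda>i. \<lfloor>u i x * (\<Lambda> * N)\<rfloor>) {..<n}" for x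
  define C where "C = PiE {..<n} (\<lambda>_. {- int (B * N)..int (B * N)})"
  have near: "\<bar>f m x - f m y\<bar> < \<epsilon> / N" if xy: "x \<in> K" "y \<in> K" "m \<le> n" and eq: "cell x = cell y" for x y m
  proof -
    have "\<bar>u i x - u i y\<bar> \<le> 1 / (\<Lambda> * N)" if i: "i < n" for i
    proof -
      have "\<lfloor>u i x * (\<Lambda> * N)\<rfloor> = \<lfloor>u i y * (\<Lambda> * N)\<rfloor>"
        using fun_cong[OF eq, of i] i by (simp add: cell_def)
      then have "\<bar>u i x * (\<Lambda> * N) - u i y * (\<Lambda> * N)\<bar> \<le> 1" by linarith
      then have "\<bar>u i x - u i y\<bar> * (\<Lambda> * N) \<le> 1"
        using \<Lambda> by (simp add: abs_mult flip: left_diff_distrib)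
      then show ?thesis using \<Lambda> N by (simp add: field_simps)
    qed
    then have "(\<Sum>i<n. \<bar>u i x - u i y\<bar>) \<le> (\<Sum>i<n. 1 / (\<Lambda> * N))" by (intro sum_mono) simp
    then have "L * (\<Sum>i<n. \<bar>u i x - u i y\<bar>) \<le> L * (n / (\<Lambda> * N))" using L by (intro mult_left_mono) auto
    also have "\<dots> < \<epsilon> / N" using \<Lambda> N by (simp add: field_simps)
    finally show ?thesis using f[OF xy] by linarith
  qed
  have "\<exists>k\<in>G. \<forall>x\<in>K. \<exists>m\<le>n. f m x \<noteq> t k m"
  proof (rule ccontr)
    assume "\<not> ?thesis"
    then have "\<forall>k\<in>G. \<exists>x\<in>K. \<forall>m\<le>n. f m x = t k m" by blast
    then obtain x where x: "\<And>k. k \<in> G \<Longrightarrow> x k \<in> K" "\<And>k m. k \<in> G \<Longrightarrow> m \<le> n \<Longrightarrow> f m (x k) = t k m"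
      by metis
    have "inj_on (\<lambda>k. cell (x k)) G"
    proof (rule inj_onI)
      fix k l assume kl: "k \<in> G" "l \<in> G" "cell (x k) = cell (x l)"
      show "k = l"
      proof (rule PiE_ext[of k "{..n}" "\<lambda>_. {..<N}" l])
        fix m assume m: "m \<in> {..n}"
        have "\<bar>t k m - t l m\<bar> < \<epsilon> / N"
          using near[of "x k" "x l" m] kl m x by simp
        also have "t k m - t l m = (\<epsilon> / N) * (real (k m) - real (l m))"
          by (simp add: t_def diff_divide_distrib algebra_simps)
        finally have "(\<epsilon> / N) * \<bar>real (k m) - real (l m)\<bar> < (\<epsilon> / N) * 1"
          using \<epsilon> N by (simp add: abs_mult)
        then have "\<bar>real (k m) - real (l m)\<bar> < 1"
          using \<epsilon> N by (subst (asm) mult_less_cancel_left_pos) auto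
        then show "k m = l m" by linarith
      qed (use kl in \<open>auto simp: G_def\<close>)
    qed
    moreover have "(\<lambda>k. cell (x k)) ` G \<subseteq> C"
    proof
      fix z assume "z \<in> (\<lambda>k. cell (x k)) ` G"
      then obtain k where k: "k \<in> G" "z = cell (x k)" by auto
      have "\<lfloor>u i (x k) * (\<Lambda> * N)\<rfloor> \<in> {- int (B * N)..int (B * N)}" if i: "i < n" for i
      proof -
        have "\<bar>u i (x k)\<bar> * \<Lambda> \<le> \<bar>R\<bar> * \<Lambda>"
          using u[OF x(1)[OF k(1)] i] \<Lambda> by (intro mult_right_mono) auto
        then have "\<bar>u i (x k)\<bar> * \<Lambda> * N \<le> real B * N" using B by (intro mult_right_mono) auto
        then have "\<bar>u i (x k) * (\<Lambda> * N)\<bar> \<le> real (B * N)" using \<Lambda> by (simp add: abs_mult mult.assoc)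
        then show ?thesis by (simp add: floor_le_iff le_floor_iff abs_le_iff)
      qed
      then show "z \<in> C" by (auto simp: k C_def cell_def)
    qed
    moreover have "finite C" by (auto simp: C_def intro!: finite_PiE)
    ultimately have "card G \<le> card C" by (rule card_inj_on_le)
    moreover have "card G = N ^ (n + 1)" by (simp add: G_def card_PiE)
    moreover have "card C = (2 * (B * N) + 1) ^ n"
    proof -
      have "card {- int (B * N)..int (B * N)} = nat (int (2 * (B * N) + 1))" by simp
      then have "card {- int (B * N)..int (B * N)} = 2 * (B * N) + 1" by (simp only: nat_int)
      then show ?thesis by (simp add: C_def card_PiE)
    qed
    ultimately have "N ^ (n + 1) \<le> (2 * (B * N) + 1) ^ n" by simp
    also have "\<dots> \<le> ((2 * B + 1) * N) ^ n" using N by (intro power_mono) (auto simp: algebra_simps)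
    also have "\<dots> = (2 * B + 1) ^ n * N ^ n" by (rule power_mult_distrib)
    finally have "N * N ^ n \<le> (2 * B + 1) ^ n * N ^ n" by simp
    then have "N \<le> (2 * B + 1) ^ n" using N by (subst (asm) mult_le_cancel2) auto
    then show False by (simp add: N_def)
  qed
  then obtain k where k: "k \<in> G" "\<And>x. x \<in> K \<Longrightarrow> \<exists>m\<le>n. f m x \<noteq> t k m" by blast
  show ?thesis
  proof (rule that[of "t k"])
    fix m assume "m \<le> n"
    then have "k m < N" using k(1) by (auto simp: G_def)
    then have "real (k m) / real N \<le> 1" using N by simp
    then have "\<epsilon> * (real (k m) / real N) \<le> \<epsilon> * 1" using \<epsilon> by (intro mult_left_mono) auto
    then show "a m \<le> t k m \<and> t k m \<le> a m + \<epsilon>" using \<epsilon> by (simp add: t_def)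
  qed (use k in blast)
qed

text \<open>Thresholds have to stay away from zero, so that a bump function exceeds them only inside its support,
  and below \<open>1/2\<close>, as the sets where bump functions exceed \<open>1/2\<close> cover. This reparametrisation leaves
  their families unconstrained, in a complete space.\<close>

definition squash :: "real \<Rightarrow> real" where
  "squash x = 3 / 8 + arctan x / 16"

lemma squash_bounds: "1 / 4 < squash x" "squash x < 1 / 2"
proof -
  have "- 2 < arctan x" "arctan x < 2"
    using arctan_lbound[of x] arctan_ubound[of x] pi_less_4 by linarith+
  then show "1 / 4 < squash x" "squash x < 1 / 2" by (auto simp: squash_def)
qed

lemma squash_mono: "x < y \<Longrightarrow> squash x < squash y"
  by (simp add: squash_def arctan_monotone)

lemma continuous_squash: "continuous_on S squash"
  unfolding squash_def[abs_def] by (intro continuous_intros) auto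

text \<open>For a compact piece \<open>K m\<close> and a choice \<open>J\<close> of one function for each colour, the families \<open>x\<close> for
  which no point of \<open>K m\<close> lies on all \<open>n + 1\<close> level sets selected by \<open>J\<close> form an open set, by
  compactness, and a dense one, because a small change of the \<open>n + 1\<close> thresholds moves them out of the
  Lipschitz image of \<open>K m\<close>. There are countably many pairs of \<open>m\<close> and \<open>J\<close>.\<close>

lemma generic_thresholds:
  fixes \<rho> :: "nat \<Rightarrow> 'm::t2_space \<Rightarrow> real" and K :: "nat \<Rightarrow> 'm set" and u :: "nat \<Rightarrow> nat \<Rightarrow> 'm \<Rightarrow> real"
  assumes cont: "\<And>j. continuous_on UNIV (\<rho> j)"
    and K: "\<And>m. compact (K m)" "(\<Union>m. K m) = UNIV"
    and u: "\<And>m. \<exists>R. \<forall>x\<in>K m. \<forall>i<n. \<bar>u m i x\<bar> \<le> R"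
    and L: "\<And>m j. \<exists>L>0. \<forall>x\<in>K m. \<forall>y\<in>K m. \<bar>\<rho> j x - \<rho> j y\<bar> \<le> L * (\<Sum>i<n. \<bar>u m i x - u m i y\<bar>)"
  obtains r where "\<And>c j. 1 / 4 < r c j \<and> r c j < 1 / 2" "\<And>p. \<exists>c\<le>n. \<forall>j. \<rho> j p \<noteq> r c j"
proof -
  define A where "A m J = {x :: nat \<times> nat \<Rightarrow> real. \<forall>p\<in>K m. \<exists>c\<le>n. \<rho> (J c) p \<noteq> squash (x (c, J c))}" for m J
  have op: "open (A m J)" for m J
  proof -
    let ?D = "(\<lambda>p c. if c \<le> n then \<rho> (J c) p else 0) ` K m"
    let ?T = "\<lambda>x c. if c \<le> n then squash (x (c, J c)) else (0::real)"
    have "compact ?D"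
    proof (intro compact_continuous_image K continuous_on_coordinatewise_then_product)
      show "continuous_on (K m) (\<lambda>p. if c \<le> n then \<rho> (J c) p else 0)" for c
        by (cases "c \<le> n") (auto intro: continuous_on_subset[OF cont] continuous_on_const)
    qed
    moreover have "continuous_on UNIV ?T"
    proof (rule continuous_on_coordinatewise_then_product)
      show "continuous_on UNIV (\<lambda>x. if c \<le> n then squash (x (c, J c)) else 0)" for c
        by (cases "c \<le> n") (auto intro: continuous_on_compose2[OF continuous_squash[of UNIV]] continuous_on_const)
    qed
    ultimately have "closed (?T -` ?D)" by (intro closed_vimage compact_imp_closed)
    moreover have "?T -` ?D = - A m J"
    proof (intro set_eqI iffI)
      fix x assume "x \<in> ?T -` ?D"
      then obtain p where p: "p \<in> K m" "?T x = (\<lambda>c. if c \<le> n then \<rho> (J c) p else 0)" by auto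
      have "\<rho> (J c) p = squash (x (c, J c))" if "c \<le> n" for c using fun_cong[OF p(2), of c] that by simp
      then show "x \<in> - A m J" using p(1) by (auto simp: A_def)
    next
      fix x assume "x \<in> - A m J"
      then obtain p where "p \<in> K m" "\<forall>c\<le>n. \<rho> (J c) p = squash (x (c, J c))" by (auto simp: A_def)
      then show "x \<in> ?T -` ?D" by (auto simp: fun_eq_iff intro!: image_eqI[of _ _ p])
    qed
    ultimately show ?thesis by (simp add: open_closed)
  qed
  have dense: "closure (A m J) = UNIV" for m J
  proof -
    obtain R where R: "\<And>x i. x \<in> K m \<Longrightarrow> i < n \<Longrightarrow> \<bar>u m i x\<bar> \<le> R" using u by blast
    obtain L' where L': "\<And>j. L' j > 0"
      "\<And>j x y. x \<in> K m \<Longrightarrow> y \<in> K m \<Longrightarrow> \<bar>\<rho> j x - \<rho> j y\<bar> \<le> L' j * (\<Sum>i<n. \<bar>u m i x - u m i y\<bar>)"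
      using L by metis
    define M where "M = (\<Sum>c\<le>n. L' (J c))"
    have M: "M > 0" using L'(1) by (auto simp: M_def intro!: sum_pos)
    have lip: "\<bar>\<rho> (J c) x - \<rho> (J c) y\<bar> \<le> M * (\<Sum>i<n. \<bar>u m i x - u m i y\<bar>)"
      if "x \<in> K m" "y \<in> K m" "c \<le> n" for x y c
    proof -
      have "L' (J c) \<le> M"
        unfolding M_def using that L'(1) by (intro member_le_sum) (auto simp: less_imp_le)
      then show ?thesis
        using L'(2)[OF that(1,2)] by (meson abs_ge_zero mult_right_mono order_trans sum_nonneg)
    qed
    have "x \<in> closure (A m J)" for x
    proof -
      have "\<exists>y\<in>A m J. \<forall>z. x z \<le> y z \<and> y z \<le> x z + 1 / real (Suc k)" for k
      proof -
        let ?e = "1 / real (Suc k)"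
        define \<epsilon> where "\<epsilon> = Min ((\<lambda>c. squash (x (c, J c) + ?e) - squash (x (c, J c))) ` {..n})"
        have "\<epsilon> \<in> (\<lambda>c. squash (x (c, J c) + ?e) - squash (x (c, J c))) ` {..n}"
          unfolding \<epsilon>_def by (intro Min_in) auto
        then have "\<epsilon> > 0" using squash_mono by auto
        have \<epsilon>: "squash (x (c, J c)) + \<epsilon> \<le> squash (x (c, J c) + ?e)" if "c \<le> n" for c
        proof -
          have "\<epsilon> \<le> squash (x (c, J c) + ?e) - squash (x (c, J c))"
            unfolding \<epsilon>_def using that by (intro Min_le) auto
          then show ?thesis by simp
        qed
        obtain t where t: "\<And>c. c \<le> n \<Longrightarrow> squash (x (c, J c)) \<le> t c \<and> t c \<le> squash (x (c, J c)) + \<epsilon>"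
          "\<And>p. p \<in> K m \<Longrightarrow> \<exists>c\<le>n. \<rho> (J c) p \<noteq> t c"
          using lipschitz_image_misses_grid[of "K m" n "u m" R "\<lambda>c. \<rho> (J c)" M \<epsilon> "\<lambda>c. squash (x (c, J c))"]
            R lip M \<open>\<epsilon> > 0\<close> by auto
        have "\<exists>z. x (c, J c) \<le> z \<and> z \<le> x (c, J c) + ?e \<and> squash z = t c" if "c \<le> n" for c
          using IVT'[OF _ _ _ continuous_squash, of "x (c, J c)" "t c" "x (c, J c) + ?e"] t(1)[OF that] \<epsilon>[OF that]
          by fastforce
        then obtain z where z: "\<And>c. c \<le> n \<Longrightarrow> x (c, J c) \<le> z c \<and> z c \<le> x (c, J c) + ?e \<and> squash (z c) = t c"
          by metis
        \<comment> \<open>The pairs \<open>(c, J c)\<close> for distinct colours are distinct, so these thresholds can be moved independently.\<close>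
        define y where "y w = (if fst w \<le> n \<and> snd w = J (fst w) then z (fst w) else x w)" for w
        have "y \<in> A m J" using t(2) z by (fastforce simp: A_def y_def)
        moreover have "x w \<le> y w \<and> y w \<le> x w + ?e" for w
          using z[of "fst w"] by (cases w) (auto simp: y_def)
        ultimately show ?thesis by blast
      qed
      then obtain y where y: "\<And>k. y k \<in> A m J" "\<And>k z. x z \<le> y k z \<and> y k z \<le> x z + 1 / real (Suc k)"
        by metis
      have "(\<lambda>k. y k w) \<longlonglongrightarrow> x w" for w
      proof (rule tendsto_sandwich)
        show "(\<lambda>k. x w) \<longlonglongrightarrow> x w" by simp
        show "(\<lambda>k. x w + 1 / real (Suc k)) \<longlonglongrightarrow> x w"
          using tendsto_add[OF tendsto_const[of "x w"] LIMSEQ_inverse_real_of_nat] by (simp add: inverse_eq_divide)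
      qed (use y(2) in \<open>auto intro!: always_eventually\<close>)
      then have "limitin (product_topology (\<lambda>_. euclidean) UNIV) y x sequentially"
        by (simp add: limitin_componentwise)
      then have "y \<longlonglongrightarrow> x" by (simp add: euclidean_product_topology)
      then show ?thesis using y(1) by (auto simp: closure_sequential)
    qed
    then show ?thesis by auto
  qed
  let ?F = "(\<lambda>(m, J). A m J) ` (UNIV \<times> PiE {..n} (\<lambda>_. UNIV))"
  have "countable ?F" by (intro countable_image countable_SIGMA countable_PiE) auto
  then have "euclidean closure_of \<Inter>?F = topspace euclidean"
    by (intro Baire_category disjI1 completely_metrizable_space_euclidean) (use op dense in \<open>auto simp: open_openin[symmetric]\<close>)
  then have "closure (\<Inter>?F) = UNIV" by simp
  then have "\<Inter>?F \<noteq> {}" by (metis closure_empty empty_not_UNIV)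
  then obtain x where x: "\<And>m J. J \<in> PiE {..n} (\<lambda>_. UNIV) \<Longrightarrow> x \<in> A m J" by fastforce
  show ?thesis
  proof (rule that[of "\<lambda>c j. squash (x (c, j))"])
    fix p
    obtain m where m: "p \<in> K m" using K(2) by blast
    show "\<exists>c\<le>n. \<forall>j. \<rho> j p \<noteq> squash (x (c, j))"
    proof (rule ccontr)
      assume "\<not> ?thesis"
      then have "\<forall>c. \<exists>j. c \<le> n \<longrightarrow> \<rho> j p = squash (x (c, j))" by auto
      then obtain J where J: "\<And>c. c \<le> n \<Longrightarrow> \<rho> (J c) p = squash (x (c, J c))" by metis
      have "x \<in> A m (restrict J {..n})" by (rule x) auto
      then show False using m J by (auto simp: A_def)
    qed
  qed (use squash_bounds in auto)
qed

text \<open>The function \<open>\<theta> c j\<close> is positive exactly on the set \<open>W\<^sub>c\<^sub>j\<close> where \<open>j\<close> is the first index at which the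
  bump function exceeds its threshold, all earlier ones being strictly below theirs. Local finiteness
  comes for free: where \<open>\<rho> j\<close> exceeds its threshold, all later sets of the same colour are empty.\<close>

lemma disjoint_families_of_bumps:
  fixes A :: "('m::{t2_space,second_countable_topology}, 'a::real_normed_vector) chart set"
  assumes A: "smooth_manifold A" and co: "coordinates n (b :: nat \<Rightarrow> 'a) coord"
    and W: "\<And>p. open (W p)" "\<And>p. p \<in> W p"
  obtains \<theta> :: "nat \<Rightarrow> nat \<Rightarrow> 'm \<Rightarrow> real" and K P
  where "\<And>c j. smooth_fun_on A UNIV (\<theta> c j)" "\<And>c j p. \<theta> c j p \<noteq> 0 \<Longrightarrow> p \<in> K j"
    "\<And>j. compact (K j)" "\<And>j. K j \<subseteq> W (P j)" "\<And>c. locally_finite_on UNIV (\<theta> c)"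
    "\<And>c i j p. \<theta> c i p \<noteq> 0 \<Longrightarrow> \<theta> c j p \<noteq> 0 \<Longrightarrow> i = j" "\<And>p. \<exists>c\<le>n. \<exists>j. \<theta> c j p \<noteq> 0"
proof -
  have cA: "charted A" using A by (rule smooth_manifold_charted)
  have "\<forall>p. \<exists>\<rho> K V \<phi>. smooth_fun_on A UNIV \<rho> \<and> \<rho> p = (1::real) \<and> (\<forall>x. \<rho> x \<noteq> 0 \<longrightarrow> x \<in> K) \<and>
    compact K \<and> K \<subseteq> W p \<and> (V, \<phi>) \<in> A \<and> K \<subseteq> V \<and> convex (\<phi> ` K)"
    using bump_function[OF A co W] by (metis (no_types, lifting))
  then obtain \<rho>' K' V' \<phi>' where b: "\<And>p. smooth_fun_on A UNIV (\<rho>' p)" "\<And>p. \<rho>' p p = (1::real)"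
    "\<And>p x. \<rho>' p x \<noteq> 0 \<Longrightarrow> x \<in> K' p" "\<And>p. compact (K' p)" "\<And>p. K' p \<subseteq> W p" "\<And>p. (V' p, \<phi>' p) \<in> A"
    "\<And>p. K' p \<subseteq> V' p" "\<And>p. convex (\<phi>' p ` K' p)"
    by metis
  have op: "open {x. \<rho>' p x > 1 / 2}" for p
    using b(1)[of p] by (intro open_Collect_less) (auto simp: smooth_fun_on_alt)
  obtain F' where F': "F' \<subseteq> range (\<lambda>p. {x. \<rho>' p x > 1 / 2})" "countable F'"
    "\<Union>F' = \<Union>(range (\<lambda>p. {x. \<rho>' p x > 1 / 2}))"
    using Lindelof[of "range (\<lambda>p. {x. \<rho>' p x > 1 / 2})"] op by auto
  have cov: "\<Union>F' = UNIV"
  proof -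
    have "x \<in> {x. \<rho>' x x > 1 / 2} " for x using b(2) by simp
    then show ?thesis using F'(3) by (auto simp: b(2) intro: exI[of _ "_ :: 'm"])
  qed
  obtain Q where Q: "countable Q" "F' = (\<lambda>p. {x. \<rho>' p x > 1 / 2}) ` Q"
    using F'(1,2) by (metis countable_subset_image)
  have "Q \<noteq> {}" using Q cov by auto
  define P where "P = from_nat_into Q"
  have P: "range P = Q" using Q \<open>Q \<noteq> {}\<close> by (simp add: P_def)
  define \<rho> where "\<rho> j = \<rho>' (P j)" for j
  define K where "K j = K' (P j)" for j
  have half: "\<exists>j. \<rho> j x > 1 / 2" for x
  proof -
    have "x \<in> \<Union>F'" using cov by simp
    then show ?thesis unfolding Q(2) P[symmetric] by (auto simp: \<rho>_def)
  qed
  have K: "\<rho> j x \<noteq> 0 \<Longrightarrow> x \<in> K j" for j x using b(3) by (auto simp: \<rho>_def K_def)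
  have cont: "continuous_on UNIV (\<rho> j)" for j using b(1) by (auto simp: \<rho>_def smooth_fun_on_alt)
  define u where "u m i x = coord i (\<phi>' (P m) x)" for m i x
  obtain r where r: "\<And>c j. 1 / 4 < r c j \<and> r c j < 1 / 2" "\<And>p. \<exists>c\<le>n. \<forall>j. \<rho> j p \<noteq> r c j"
  proof (rule generic_thresholds[of \<rho> K n u])
    show "compact (K m)" for m by (simp add: K_def b)
    show "(\<Union>m. K m) = UNIV"
    proof -
      have "x \<in> (\<Union>m. K m)" for x
      proof -
        obtain j where "\<rho> j x > 1 / 2" using half by blast
        then show ?thesis using K[of j x] by auto
      qed
      then show ?thesis by auto
    qed
    have img: "compact (\<phi>' (P m) ` K m)" for m
      unfolding K_def
      by (rule compact_continuous_image[OF continuous_on_subset[OF chartedD(6)[OF cA b(6)] b(7)] b(4)])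
    show "\<exists>R. \<forall>x\<in>K m. \<forall>i<n. \<bar>u m i x\<bar> \<le> R" for m
    proof -
      have "\<exists>R. \<forall>y\<in>\<phi>' (P m) ` K m. \<bar>coord i y\<bar> \<le> R" if "i < n" for i
      proof -
        have "compact (coord i ` \<phi>' (P m) ` K m)"
          by (intro compact_continuous_image img bounded_linear.continuous_on[OF coordinatesD(1)[OF co that]] continuous_on_id)
        then obtain R where "\<forall>z\<in>coord i ` \<phi>' (P m) ` K m. norm z \<le> R"
          using compact_imp_bounded bounded_iff by blast
        then show ?thesis by auto
      qed
      then obtain R where R: "\<And>i y. i < n \<Longrightarrow> y \<in> \<phi>' (P m) ` K m \<Longrightarrow> \<bar>coord i y\<bar> \<le> R i" by metis
      have "\<bar>u m i x\<bar> \<le> (\<Sum>i<n. \<bar>R i\<bar>)" if x: "x \<in> K m" and i: "i < n" for i x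
      proof -
        have "\<bar>u m i x\<bar> \<le> \<bar>R i\<bar>" using R[OF i, of "\<phi>' (P m) x"] x by (auto simp: u_def)
        also have "\<dots> \<le> (\<Sum>i<n. \<bar>R i\<bar>)" using i by (intro member_le_sum) auto
        finally show ?thesis .
      qed
      then show ?thesis by blast
    qed
    show "\<exists>L>0. \<forall>x\<in>K m. \<forall>y\<in>K m. \<bar>\<rho> j x - \<rho> j y\<bar> \<le> L * (\<Sum>i<n. \<bar>u m i x - u m i y\<bar>)" for m j
    proof -
      let ?V = "V' (P m)" and ?\<phi> = "\<phi>' (P m)"
      have "smooth_on (?\<phi> ` ?V) (\<lambda>y. \<rho> j (inv_into ?V ?\<phi> y))"
        using b(1)[of "P j"] b(6)[of "P m"] by (auto simp: smooth_fun_on_alt \<rho>_def)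
      moreover have "convex (?\<phi> ` K m)" "?\<phi> ` K m \<subseteq> ?\<phi> ` ?V" using b(7,8) by (auto simp: K_def)
      ultimately obtain L where L: "L > 0"
        "\<And>x y. x \<in> ?\<phi> ` K m \<Longrightarrow> y \<in> ?\<phi> ` K m \<Longrightarrow>
          \<bar>\<rho> j (inv_into ?V ?\<phi> x) - \<rho> j (inv_into ?V ?\<phi> y)\<bar> \<le> L * (\<Sum>i<n. \<bar>coord i (x - y)\<bar>)"
        using smooth_on_compact_convex_lipschitz[OF co _ img] by metis
      have "\<bar>\<rho> j x - \<rho> j y\<bar> \<le> L * (\<Sum>i<n. \<bar>u m i x - u m i y\<bar>)" if xy: "x \<in> K m" "y \<in> K m" for x y
      proof -
        have "x \<in> ?V" "y \<in> ?V" using xy b(7) by (auto simp: K_def)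
        moreover have "(\<Sum>i<n. \<bar>coord i (?\<phi> x - ?\<phi> y)\<bar>) = (\<Sum>i<n. \<bar>u m i x - u m i y\<bar>)"
          by (intro sum.cong) (auto simp: u_def coordinatesD(6)[OF co])
        ultimately show ?thesis
          using L(2)[of "?\<phi> x" "?\<phi> y"] xy chartedD(5)[OF cA b(6)] by simp
      qed
      then show ?thesis using L(1) by blast
    qed
  qed (use cont in auto)
  define \<theta> where "\<theta> c j p = flat (\<rho> j p - r c j) * (\<Prod>i<j. flat (r c i - \<rho> i p))" for c j p
  have nz: "\<theta> c j p \<noteq> 0 \<longleftrightarrow> \<rho> j p > r c j \<and> (\<forall>i<j. \<rho> i p < r c i)" for c j p
  proof -
    have f: "flat t \<noteq> 0 \<longleftrightarrow> t > 0" for t using flat_pow_pos[of t 0] flat_pow_0[of t 0] by (cases "t > 0") auto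
    show ?thesis using f by (auto simp: \<theta>_def)
  qed
  show ?thesis
  proof (rule that[of \<theta> K P])
    have flat: "smooth_fun_on A UNIV (\<lambda>p. flat (f p))" if "smooth_fun_on A UNIV f" for f
      by (rule smooth_fun_on_real_compose[OF cA open_UNIV that smooth_on_flat_pow])
    have sm: "smooth_fun_on A UNIV (\<rho> j)" for j using b(1) by (simp add: \<rho>_def)
    have 1: "smooth_fun_on A UNIV (\<lambda>p. \<rho> j p - r c j)" for c j
      using smooth_fun_on_add[OF cA open_UNIV sm[of j] smooth_fun_on_const[OF cA open_UNIV, of "- r c j"]] by simp
    have 2: "smooth_fun_on A UNIV (\<lambda>p. r c j - \<rho> j p)" for c j
      using smooth_fun_on_mult[OF cA open_UNIV smooth_fun_on_const[OF cA open_UNIV, of "- 1"] 1[of j c]]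
      by simp
    show "smooth_fun_on A UNIV (\<theta> c j)" for c j
      unfolding \<theta>_def[abs_def]
      by (rule smooth_fun_on_mult[OF cA open_UNIV flat[OF 1] smooth_fun_on_prod[OF cA open_UNIV flat[OF 2]]])
    show "p \<in> K j" if "\<theta> c j p \<noteq> 0" for c j p
      using that r(1)[of c j] K[of j p] unfolding nz by linarith
    show "compact (K j)" "K j \<subseteq> W (P j)" for j using b(4,5) by (auto simp: K_def)
    show "locally_finite_on UNIV (\<theta> c)" for c
      unfolding locally_finite_on_def
    proof
      fix x
      obtain j where j: "\<rho> j x > 1 / 2" using half by blast
      have "open {y. \<rho> j y > r c j}" using cont by (intro open_Collect_less) auto
      moreover have "\<rho> j x > r c j" using j r(1)[of c j] by linarith
      moreover have "\<theta> c k y = 0" if "k \<ge> Suc j" "\<rho> j y > r c j" for k y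
        using nz[of c k y] that by (metis Suc_le_lessD order_less_asym)
      ultimately show "\<exists>W J. open W \<and> x \<in> W \<and> (\<forall>j\<ge>J. \<forall>y\<in>W \<inter> UNIV. \<theta> c j y = 0)"
        by (intro exI[of _ "{y. \<rho> j y > r c j}"] exI[of _ "Suc j"]) auto
    qed
    show "i = j" if "\<theta> c i p \<noteq> 0" "\<theta> c j p \<noteq> 0" for c i j p
      using that unfolding nz by (metis linorder_neqE_nat order_less_asym)
    show "\<exists>c\<le>n. \<exists>j. \<theta> c j p \<noteq> 0" for p
    proof -
      obtain c where c: "c \<le> n" "\<And>j. \<rho> j p \<noteq> r c j" using r(2) by blast
      obtain j0 where "\<rho> j0 p > 1 / 2" using half by blast
      then have "\<rho> j0 p > r c j0" using r(1)[of c j0] by linarith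
      \<comment> \<open>At a point on no level set of colour \<open>c\<close>, the first index above its threshold has all earlier ones strictly below.\<close>
      then obtain j where j: "\<rho> j p > r c j" "\<forall>i<j. \<not> \<rho> i p > r c i"
        using exists_least_iff[of "\<lambda>j. \<rho> j p > r c j"] by blast
      then have "\<theta> c j p \<noteq> 0" unfolding nz using c(2) by (metis linorder_less_linear)
      then show ?thesis using c by blast
    qed
  qed
qed

section \<open>Vector bundles in local frames\<close>

lemma smooth_map_on_compose:
  assumes A: "charted A" and B: "charted (B :: ('n::topological_space, 'b::real_normed_vector) chart set)"
    and C: "charted (C :: ('k::topological_space, 'c::real_normed_vector) chart set)"
    and S: "open S" and T: "open T"
    and f: "smooth_map_on A B S f" "f ` S \<subseteq> T" and g: "smooth_map_on B C T g"
  shows "smooth_map_on A C S (\<lambda>x. g (f x))"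
proof -
  have cf: "continuous_on S f" and cg: "continuous_on T g" using f g by (auto simp: smooth_map_on_def)
  have cont: "continuous_on S (\<lambda>x. g (f x))" using continuous_on_compose2[OF cg cf f(2)] .
  have "smooth_on (\<phi> ` (U \<inter> S \<inter> (\<lambda>x. g (f x)) -` V)) (\<psi> \<circ> (\<lambda>x. g (f x)) \<circ> inv_into U \<phi>)"
    if U: "(U, \<phi>) \<in> A" and V: "(V, \<psi>) \<in> C" for U \<phi> V \<psi>
  proof -
    have oT: "open (T \<inter> g -` V)" using continuous_open_preimage[OF cg T chartedD(1)[OF C V]] .
    have oS: "open (S \<inter> (\<lambda>x. g (f x)) -` V)"
      using continuous_open_preimage[OF cont S chartedD(1)[OF C V]] .
    have "smooth_fun_on B (T \<inter> g -` V) (\<lambda>x. \<psi> (g x))"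
      unfolding smooth_fun_on_iff[OF B oT] using g V
      by (fastforce simp: smooth_map_on_def o_def Int_assoc)
    moreover have "smooth_map_on A B (S \<inter> (\<lambda>x. g (f x)) -` V) f"
    proof -
      have "smooth_on (\<phi> ` (U \<inter> (S \<inter> (\<lambda>x. g (f x)) -` V) \<inter> f -` W)) (\<eta> \<circ> f \<circ> inv_into U \<phi>)"
        if "(U, \<phi>) \<in> A" "(W, \<eta>) \<in> B" for U \<phi> W \<eta>
        using f(1) that unfolding smooth_map_on_def by (fast elim: smooth_on_subset)
      then show ?thesis unfolding smooth_map_on_def using continuous_on_subset[OF cf] by auto
    qed
    ultimately have "smooth_fun_on A (S \<inter> (\<lambda>x. g (f x)) -` V) (\<lambda>x. \<psi> (g (f x)))"
      using f(2) by (intro smooth_fun_on_compose[OF A B oS oT, of f "\<lambda>x. \<psi> (g x)"]) auto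
    then show ?thesis using U by (auto simp: smooth_fun_on_alt o_def Int_assoc)
  qed
  then show ?thesis unfolding smooth_map_on_def using cont by auto
qed

text \<open>Integral curves of vertical fields stay in one fibre, so they arise from curves of this form.\<close>

lemma smooth_curve_in_slice:
  assumes A: "charted A" and w: "smooth_on UNIV (w :: real \<Rightarrow> 'b::real_normed_vector)"
  shows "smooth_map_on euclidean_atlas (prod_atlas A euclidean_atlas) UNIV (\<lambda>t. (p, w t))"
proof -
  have "smooth_on UNIV (\<lambda>t. (\<phi> p, w t))" for \<phi> :: "'a \<Rightarrow> 'd::real_normed_vector"
  proof -
    have "smooth_on UNIV (\<lambda>t. (\<phi> p, 0) + (0, w t))"
      by (intro smooth_on_add smooth_on_const open_UNIV
          smooth_on_linear_compose[OF bounded_linear_Pair[OF bounded_linear_zero bounded_linear_ident]] w)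
    then show ?thesis by simp
  qed
  note 1 = this and 2 = smooth_on_subset[OF this empty_subsetI]
  have "continuous_on UNIV (\<lambda>t. (p, w t))"
    by (intro continuous_intros smooth_on_continuous[OF w])
  then show ?thesis using 1 2
    by (auto simp: smooth_map_on_def euclidean_atlas_def prod_atlas_def o_def inv_into_def vimage_def)
qed

text \<open>The Lie bracket of two vector fields applied to \<open>f\<close>: the second derivatives of \<open>f\<close> cancel by symmetry,
  and the first derivatives by assumption.\<close>

lemma derivatives_along_commuting_fields:
  fixes f :: "'b::real_normed_vector \<Rightarrow> real"
  assumes co: "coordinates n (b :: nat \<Rightarrow> 'b) c" and f: "smooth_on UNIV f"
    and F: "(F has_derivative F') (at v)" and G: "(G has_derivative G') (at v)"
    and comm: "F' (G v) = G' (F v)"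
  shows "frechet_derivative (\<lambda>v. frechet_derivative f (at v) (G v)) (at v) (F v) =
    frechet_derivative (\<lambda>v. frechet_derivative f (at v) (F v)) (at v) (G v)"
proof -
  let ?D = "\<lambda>v. frechet_derivative f (at v)"
  define H where "H w = frechet_derivative (\<lambda>v. ?D v w) (at v)" for w
  have lin: "linear (?D v)" for v
    using has_derivative_linear[OF smooth_on_has_derivative[OF f]] by simp
  have H: "((\<lambda>v. ?D v w) has_derivative H w) (at v)" for w
    unfolding H_def using smooth_on_has_derivative[OF smooth_on_partial[OF f]] by simp
  have linH: "linear (H w)" for w using has_derivative_linear[OF H] .
  have symH: "H w u = H u w" for u w unfolding H_def using mixed_partials_commute[OF open_UNIV _ f] by simp
  have key: "frechet_derivative (\<lambda>v. ?D v (G v)) (at v) u =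
      ?D v (G' u) + (\<Sum>i<n. c i (G v) * H (b i) u)"
    if G: "(G has_derivative G') (at v)" for G G' u
  proof -
    have exp: "?D w (G w) = (\<Sum>i<n. c i (G w) * ?D w (b i))" for w
      using linear_coordinates[OF co lin, of w "G w"] by simp
    have "((\<lambda>w. \<Sum>i<n. c i (G w) * ?D w (b i)) has_derivative
        (\<lambda>u. \<Sum>i<n. c i (G v) * H (b i) u + c i (G' u) * ?D v (b i))) (at v)"
      by (intro has_derivative_sum has_derivative_mult H bounded_linear.has_derivative[OF coordinatesD(1)[OF co]] G) simp
    then have "((\<lambda>w. ?D w (G w)) has_derivative
        (\<lambda>u. \<Sum>i<n. c i (G v) * H (b i) u + c i (G' u) * ?D v (b i))) (at v)"
      by (simp only: exp)
    from fun_cong[OF frechet_derivative_at[OF this], of u]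
    have "frechet_derivative (\<lambda>v. ?D v (G v)) (at v) u = (\<Sum>i<n. c i (G v) * H (b i) u + c i (G' u) * ?D v (b i))"
      by (rule sym)
    also have "\<dots> = ?D v (G' u) + (\<Sum>i<n. c i (G v) * H (b i) u)"
      using linear_coordinates[OF co lin, of v "G' u"] by (simp add: sum.distrib)
    finally show ?thesis .
  qed
  have bil: "(\<Sum>i<n. c i x * H (b i) y) = (\<Sum>i<n. \<Sum>j<n. c i x * c j y * H (b i) (b j))" for x y
  proof (rule sum.cong[OF refl])
    fix i show "c i x * H (b i) y = (\<Sum>j<n. c i x * c j y * H (b i) (b j))"
      unfolding linear_coordinates[OF co linH[of "b i"], of y] by (simp add: sum_distrib_left mult.assoc)
  qed
  have "(\<Sum>i<n. c i (G v) * H (b i) (F v)) = (\<Sum>i<n. c i (F v) * H (b i) (G v))"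
    unfolding bil by (subst sum.swap) (simp add: symH mult.commute)
  then show ?thesis unfolding key[OF F] key[OF G] comm by simp
qed

locale smooth_bundle =
  fixes E :: "('e::{t2_space,second_countable_topology}, 'm::{t2_space,second_countable_topology},
      'c::real_normed_vector, 'a::real_normed_vector, 'b::real_normed_vector) vbundle"
  assumes vb: "smooth_vector_bundle E"
begin

abbreviation "\<pi> \<equiv> proj E"

abbreviation "smooth_fun S (f :: 'e \<Rightarrow> real) \<equiv> smooth_fun_on (total_atlas E) S f"

definition frame :: "'m set \<Rightarrow> ('e \<Rightarrow> 'b) \<Rightarrow> 'm \<Rightarrow> 'b \<Rightarrow> 'e" where
  "frame U \<Phi> p v = inv_into (\<pi> -` U) (\<lambda>e. (\<pi> e, \<Phi> e)) (p, v)"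

lemma charted_total: "charted (total_atlas E)"
  and charted_base: "charted (base_atlas E)"
  and base_manifold: "smooth_manifold (base_atlas E)"
  and total_manifold: "smooth_manifold (total_atlas E)"
  and fd_fibre: "finite_dimensional TYPE('b)"
  and proj_smooth: "smooth_map_on (total_atlas E) (base_atlas E) UNIV \<pi>"
  and fibres: "fibre_vector_space E p"
  using vb by (auto simp: smooth_vector_bundle_def smooth_manifold_charted)

lemma proj_continuous: "continuous_on UNIV \<pi>"
  using proj_smooth by (simp add: smooth_map_on_def)

lemma trivialization_obtain:
  obtains U \<Phi> where "(U, \<Phi>) \<in> bundle_atlas E" "p \<in> U"
proof -
  have "p \<in> (\<Union>(U, \<Phi>)\<in>bundle_atlas E. U)" using vb by (simp add: smooth_vector_bundle_def)
  then show ?thesis using that by blast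
qed

lemma fibre_closed_ops:
  "\<pi> (fib_zero E p) = p"
  "\<pi> x = \<pi> y \<Longrightarrow> \<pi> (fib_add E x y) = \<pi> y"
  "\<pi> (fib_scale E r x) = \<pi> x"
  using fibres[of p] fibres[of "\<pi> y"] fibres[of "\<pi> x"]
  unfolding fibre_vector_space_def fibre_def by auto

lemma trivialization:
  assumes tr: "(U, \<Phi>) \<in> bundle_atlas E"
  shows "open U" "open (\<pi> -` U)"
    and "p \<in> U \<Longrightarrow> \<pi> (frame U \<Phi> p v) = p" "p \<in> U \<Longrightarrow> \<Phi> (frame U \<Phi> p v) = v"
    and "\<pi> e \<in> U \<Longrightarrow> frame U \<Phi> (\<pi> e) (\<Phi> e) = e"
    and "smooth_map_on (total_atlas E) (prod_atlas (base_atlas E) euclidean_atlas) (\<pi> -` U) (\<lambda>e. (\<pi> e, \<Phi> e))"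
    and "smooth_map_on (prod_atlas (base_atlas E) euclidean_atlas) (total_atlas E) (U \<times> UNIV) (\<lambda>z. frame U \<Phi> (fst z) (snd z))"
    and "\<pi> x \<in> U \<Longrightarrow> \<pi> y = \<pi> x \<Longrightarrow> \<Phi> (fib_add E x y) = \<Phi> x + \<Phi> y"
    and "\<pi> x \<in> U \<Longrightarrow> \<Phi> (fib_scale E r x) = r *\<^sub>R \<Phi> x"
proof -
  have lt: "local_trivialization E U \<Phi>" using vb tr unfolding smooth_vector_bundle_def by auto
  then have bij: "bij_betw (\<lambda>e. (\<pi> e, \<Phi> e)) (\<pi> -` U) (U \<times> UNIV)" and
    sm: "smooth_map_on (total_atlas E) (prod_atlas (base_atlas E) euclidean_atlas) (\<pi> -` U) (\<lambda>e. (\<pi> e, \<Phi> e))"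
    "smooth_map_on (prod_atlas (base_atlas E) euclidean_atlas) (total_atlas E) (U \<times> UNIV)
       (inv_into (\<pi> -` U) (\<lambda>e. (\<pi> e, \<Phi> e)))" and U: "open U"
    unfolding local_trivialization_def diffeomorphism_on_def by auto
  show "open U" by (rule U)
  show "open (\<pi> -` U)" using open_vimage[OF U proj_continuous] .
  have "(\<pi> (frame U \<Phi> p v), \<Phi> (frame U \<Phi> p v)) = (p, v)" if "p \<in> U" for p v
    unfolding frame_def
    by (rule f_inv_into_f[of "(p, v)" "\<lambda>e. (\<pi> e, \<Phi> e)"]) (use bij that in \<open>simp add: bij_betw_def\<close>)
  then show "p \<in> U \<Longrightarrow> \<pi> (frame U \<Phi> p v) = p" "p \<in> U \<Longrightarrow> \<Phi> (frame U \<Phi> p v) = v" by auto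
  show "\<pi> e \<in> U \<Longrightarrow> frame U \<Phi> (\<pi> e) (\<Phi> e) = e"
    using inv_into_f_f[OF bij_betw_imp_inj_on[OF bij], of e] by (simp add: frame_def)
  show "smooth_map_on (total_atlas E) (prod_atlas (base_atlas E) euclidean_atlas) (\<pi> -` U) (\<lambda>e. (\<pi> e, \<Phi> e))"
    by (rule sm)
  show "smooth_map_on (prod_atlas (base_atlas E) euclidean_atlas) (total_atlas E) (U \<times> UNIV) (\<lambda>z. frame U \<Phi> (fst z) (snd z))"
    using sm(2) by (simp add: frame_def)
  show "\<pi> x \<in> U \<Longrightarrow> \<pi> y = \<pi> x \<Longrightarrow> \<Phi> (fib_add E x y) = \<Phi> x + \<Phi> y"
    and "\<pi> x \<in> U \<Longrightarrow> \<Phi> (fib_scale E r x) = r *\<^sub>R \<Phi> x"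
    using lt unfolding local_trivialization_def fibre_def by auto
qed

lemma trivialization_eqI:
  assumes "(U, \<Phi>) \<in> bundle_atlas E" "\<pi> x \<in> U" "\<pi> y = \<pi> x" "\<Phi> y = \<Phi> x"
  shows "y = x"
proof -
  have "y = frame U \<Phi> (\<pi> y) (\<Phi> y)" using trivialization(5)[OF assms(1), of y] assms(2,3) by simp
  also have "\<dots> = x" unfolding assms(3,4) by (rule trivialization(5)[OF assms(1,2)])
  finally show ?thesis .
qed

lemma frame_linear:
  assumes tr: "(U, \<Phi>) \<in> bundle_atlas E" and p: "p \<in> U"
  shows "frame U \<Phi> p (v + w) = fib_add E (frame U \<Phi> p v) (frame U \<Phi> p w)"
    and "frame U \<Phi> p (r *\<^sub>R v) = fib_scale E r (frame U \<Phi> p v)"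
  by (rule trivialization_eqI[OF tr]; simp add: trivialization[OF tr] p fibre_closed_ops)+

lemma trivialization_zero:
  assumes tr: "(U, \<Phi>) \<in> bundle_atlas E" and p: "p \<in> U"
  shows "\<Phi> (fib_zero E p) = 0" and "frame U \<Phi> p 0 = fib_zero E p"
proof -
  have "fib_add E (fib_zero E p) (fib_zero E p) = fib_zero E p"
    using fibres[of p] unfolding fibre_vector_space_def by auto
  then show 1: "\<Phi> (fib_zero E p) = 0"
    using trivialization(8)[OF tr, of "fib_zero E p" "fib_zero E p"] p by (simp add: fibre_closed_ops)
  show "frame U \<Phi> p 0 = fib_zero E p"
    by (rule trivialization_eqI[OF tr]) (simp_all add: trivialization[OF tr] p fibre_closed_ops 1)
qed

lemma smooth_fun_frame:
  assumes tr: "(U, \<Phi>) \<in> bundle_atlas E" and f: "smooth_fun (\<pi> -` U) f"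
  shows "smooth_fun_on (prod_atlas (base_atlas E) euclidean_atlas) (U \<times> UNIV) (\<lambda>z. f (frame U \<Phi> (fst z) (snd z)))"
  by (rule smooth_fun_on_compose[OF charted_prod_euclidean[OF charted_base fd_fibre] charted_total
        open_Times[OF trivialization(1)[OF tr] open_UNIV] trivialization(2)[OF tr] trivialization(7)[OF tr] _ f])
     (auto simp: trivialization[OF tr])

lemma smooth_on_frame:
  assumes tr: "(U, \<Phi>) \<in> bundle_atlas E" and f: "smooth_fun (\<pi> -` U) f" and p: "p \<in> U"
  shows "smooth_on UNIV (\<lambda>v. f (frame U \<Phi> p v))"
  using smooth_fun_on_prod_slice[OF charted_base fd_fibre trivialization(1)[OF tr] smooth_fun_frame[OF tr f] p] by simp

lemma smooth_functionsD: "f \<in> smooth_functions (total_atlas E) \<Longrightarrow> smooth_fun S f"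
  using smooth_fun_on_subset[of "total_atlas E" UNIV f S] by (simp add: smooth_functions_smooth_fun_on)

lemma vertical_lift_at_frame:
  assumes tr: "(U, \<Phi>) \<in> bundle_atlas E" and e: "\<pi> e \<in> U" "\<pi> s = \<pi> e"
    and f: "f \<in> smooth_functions (total_atlas E)"
  shows "vertical_lift_at E e s f = frechet_derivative (\<lambda>v. f (frame U \<Phi> (\<pi> e) v)) (at (\<Phi> e)) (\<Phi> s)"
proof -
  let ?g = "\<lambda>v. f (frame U \<Phi> (\<pi> e) v)"
  have "smooth_on UNIV ?g" by (rule smooth_on_frame[OF tr smooth_functionsD[OF f] e(1)])
  then have "(?g has_derivative frechet_derivative ?g (at (\<Phi> e))) (at (\<Phi> e + 0 *\<^sub>R \<Phi> s))"
    by (simp add: smooth_on_has_derivative)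
  from has_real_derivative_along_line[OF this]
  have "((\<lambda>t. ?g (\<Phi> e + t *\<^sub>R \<Phi> s)) has_real_derivative frechet_derivative ?g (at (\<Phi> e)) (\<Phi> s)) (at 0)" .
  moreover have "frame U \<Phi> (\<pi> e) (\<Phi> e + t *\<^sub>R \<Phi> s) = fib_add E e (fib_scale E t s)" for t
    by (rule trivialization_eqI[OF tr]) (simp_all add: trivialization[OF tr] fibre_closed_ops e)
  ultimately show ?thesis using f by (simp add: vertical_lift_at_def DERIV_imp_deriv)
qed

lemma frame_derivative_linear:
  assumes tr: "(U, \<Phi>) \<in> bundle_atlas E" and p: "p \<in> U" and f: "smooth_fun (\<pi> -` U) f"
  shows "linear (frechet_derivative (\<lambda>v. f (frame U \<Phi> p v)) (at v))"
  using has_derivative_linear[OF smooth_on_has_derivative[OF smooth_on_frame[OF tr f p]]] by simp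

lemma vertical_lift_at_linear:
  assumes "\<pi> s = \<pi> e" "\<pi> t = \<pi> e"
  shows "vertical_lift_at E e (fib_add E s t) f = vertical_lift_at E e s f + vertical_lift_at E e t f"
    and "vertical_lift_at E e (fib_scale E r s) f = r * vertical_lift_at E e s f"
proof -
  obtain U \<Phi> where tr: "(U, \<Phi>) \<in> bundle_atlas E" and e: "\<pi> e \<in> U" using trivialization_obtain .
  have "vertical_lift_at E e (fib_add E s t) f = vertical_lift_at E e s f + vertical_lift_at E e t f \<and>
    vertical_lift_at E e (fib_scale E r s) f = r * vertical_lift_at E e s f"
  proof (cases "f \<in> smooth_functions (total_atlas E)")
    case True
    note lin = frame_derivative_linear[OF tr e smooth_functionsD[OF True]]
    show ?thesis using assms e
      by (simp add: vertical_lift_at_frame[OF tr e _ True] fibre_closed_ops trivialization[OF tr]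
          linear_add[OF lin] linear_cmul[OF lin])
  qed (simp add: vertical_lift_at_def)
  then show "vertical_lift_at E e (fib_add E s t) f = vertical_lift_at E e s f + vertical_lift_at E e t f"
    and "vertical_lift_at E e (fib_scale E r s) f = r * vertical_lift_at E e s f" by auto
qed

lemma smooth_frame_partial:
  assumes tr: "(U, \<Phi>) \<in> bundle_atlas E" and f: "smooth_fun (\<pi> -` U) f"
  shows "smooth_fun (\<pi> -` U) (\<lambda>e. frechet_derivative (\<lambda>v. f (frame U \<Phi> (\<pi> e) v)) (at (\<Phi> e)) w)"
proof -
  have "smooth_fun_on (prod_atlas (base_atlas E) euclidean_atlas) (U \<times> UNIV)
      (\<lambda>(p, v). frechet_derivative (\<lambda>v. f (frame U \<Phi> p v)) (at v) w)"
    using smooth_fun_on_prod_partial[OF charted_base fd_fibre trivialization(1)[OF tr] smooth_fun_frame[OF tr f]] by simp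
  from smooth_fun_on_compose[OF charted_total charted_prod_euclidean[OF charted_base fd_fibre]
      trivialization(2)[OF tr] open_Times[OF trivialization(1)[OF tr] open_UNIV] trivialization(6)[OF tr] _ this]
  show ?thesis by auto
qed

lemma smooth_fibre_coordinate:
  assumes tr: "(U, \<Phi>) \<in> bundle_atlas E" and L: "bounded_linear (L :: 'b \<Rightarrow> real)"
  shows "smooth_fun (\<pi> -` U) (\<lambda>e. L (\<Phi> e))"
  using smooth_fun_on_compose[OF charted_total charted_prod_euclidean[OF charted_base fd_fibre]
      trivialization(2)[OF tr] open_Times[OF trivialization(1)[OF tr] open_UNIV] trivialization(6)[OF tr] _
      smooth_fun_on_prod_linear[OF charted_base fd_fibre trivialization(1)[OF tr] L]]
  by auto

lemma smooth_fun_base: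
  fixes g :: "'m \<Rightarrow> real"
  assumes "open U" "smooth_fun_on (base_atlas E) U g"
  shows "smooth_fun (\<pi> -` U) (\<lambda>e. g (\<pi> e))"
proof (rule smooth_fun_on_compose[OF charted_total charted_base open_vimage[OF assms(1) proj_continuous] assms(1) _ _ assms(2)])
  have "smooth_on (\<phi> ` (V \<inter> \<pi> -` U \<inter> \<pi> -` W)) (\<psi> \<circ> \<pi> \<circ> inv_into V \<phi>)"
    if "(V, \<phi>) \<in> total_atlas E" "(W, \<psi>) \<in> base_atlas E" for V \<phi> W \<psi>
    using proj_smooth that unfolding smooth_map_on_def by (fast elim: smooth_on_subset)
  then show "smooth_map_on (total_atlas E) (base_atlas E) (\<pi> -` U) \<pi>"
    unfolding smooth_map_on_def using continuous_on_subset[OF proj_continuous] by auto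
qed auto

text \<open>The vertical lift of the tautological section is the Euler field. In a frame its coefficients are the
  fibre coordinates.\<close>

lemma smooth_euler:
  assumes f: "f \<in> smooth_functions (total_atlas E)"
  shows "smooth_fun UNIV (\<lambda>e. vertical_lift_at E e e f)"
proof (rule smooth_fun_on_local[OF charted_total open_UNIV])
  fix e0
  obtain U \<Phi> where tr: "(U, \<Phi>) \<in> bundle_atlas E" and e0: "\<pi> e0 \<in> U" using trivialization_obtain .
  obtain n and b :: "nat \<Rightarrow> 'b" and c where co: "coordinates n b c" using coordinates_exist[OF fd_fibre] .
  note o = trivialization(2)[OF tr]
  have 1: "smooth_fun (\<pi> -` U) (\<lambda>e. \<Sum>i<n. c i (\<Phi> e) * frechet_derivative (\<lambda>v. f (frame U \<Phi> (\<pi> e) v)) (at (\<Phi> e)) (b i))"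
    by (intro smooth_fun_on_sum[OF charted_total o] smooth_fun_on_mult[OF charted_total o]
        smooth_fibre_coordinate[OF tr] smooth_frame_partial[OF tr smooth_functionsD[OF f]] coordinatesD(1)[OF co]) auto
  have "smooth_fun (\<pi> -` U) (\<lambda>e. vertical_lift_at E e e f)"
  proof (rule smooth_fun_on_cong[OF charted_total o _ 1])
    fix e assume "e \<in> \<pi> -` U"
    then have e: "\<pi> e \<in> U" by simp
    show "(\<Sum>i<n. c i (\<Phi> e) * frechet_derivative (\<lambda>v. f (frame U \<Phi> (\<pi> e) v)) (at (\<Phi> e)) (b i)) = vertical_lift_at E e e f"
      unfolding vertical_lift_at_frame[OF tr e refl f]
      using linear_coordinates[OF co frame_derivative_linear[OF tr e smooth_functionsD[OF f], of "\<Phi> e"], of "\<Phi> e"]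
      by simp
  qed
  then show "\<exists>W. open W \<and> e0 \<in> W \<and> smooth_fun (W \<inter> UNIV) (\<lambda>e. vertical_lift_at E e e f)"
    using o e0 by (intro exI[of _ "\<pi> -` U"]) auto
qed

definition section_of :: "('m \<Rightarrow> 'e) \<Rightarrow> bool" where
  "section_of s \<longleftrightarrow> (\<forall>p. \<pi> (s p) = p)"

text \<open>Smoothness of a section is expressed by that of its vertical lift, which is the form in which it is
  both used and verified.\<close>

definition smooth_section :: "('m \<Rightarrow> 'e) \<Rightarrow> bool" where
  "smooth_section s \<longleftrightarrow> section_of s \<and>
     (\<forall>f\<in>smooth_functions (total_atlas E). smooth_fun UNIV (\<lambda>e. vertical_lift_at E e (s (\<pi> e)) f))"

text \<open>Only smoothness of the quadratic form is demanded, because that of \<open>e \<mapsto> \<beta> e (s (\<pi> e))\<close> follows by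
  \<open>fibre_metric_gradient\<close>. Positivity shows up as compactness of the unit balls in the fibres.\<close>

definition fibre_metric :: "('e \<Rightarrow> 'e \<Rightarrow> real) \<Rightarrow> bool" where
  "fibre_metric \<beta> \<longleftrightarrow>
     (\<forall>x y z. \<pi> x = \<pi> z \<longrightarrow> \<pi> y = \<pi> z \<longrightarrow> \<beta> (fib_add E x y) z = \<beta> x z + \<beta> y z) \<and>
     (\<forall>r x z. \<pi> x = \<pi> z \<longrightarrow> \<beta> (fib_scale E r x) z = r * \<beta> x z) \<and>
     (\<forall>x y. \<pi> x = \<pi> y \<longrightarrow> \<beta> x y = \<beta> y x) \<and>
     smooth_fun UNIV (\<lambda>e. \<beta> e e)"

definition bundle_ball_field :: "('e \<Rightarrow> 'e \<Rightarrow> real) \<Rightarrow> ('m \<Rightarrow> 'e) \<Rightarrow> 'e vfield" where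
  "bundle_ball_field \<beta> s e = vertical_lift_at E e
     (fib_add E (fib_scale E (cutoff (\<beta> e e)) (s (\<pi> e))) (fib_scale E (rad (\<beta> e e) * \<beta> e (s (\<pi> e))) e))"

lemma bundle_ball_field_eq:
  assumes "section_of s"
  shows "bundle_ball_field \<beta> s e f = cutoff (\<beta> e e) * vertical_lift_at E e (s (\<pi> e)) f +
    rad (\<beta> e e) * \<beta> e (s (\<pi> e)) * vertical_lift_at E e e f"
  using assms by (simp add: bundle_ball_field_def section_of_def vertical_lift_at_linear fibre_closed_ops)

lemma bundle_ball_field_vertical:
  "section_of s \<Longrightarrow> bundle_ball_field \<beta> s e \<in> vertical_space E e"
  unfolding bundle_ball_field_def section_of_def
  by (intro vertical_lift_at_vertical[OF vb]) (simp add: fibre_def fibre_closed_ops)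

text \<open>Bilinear forms on a finite-dimensional space are bounded.\<close>

lemma fibre_metric_frame:
  assumes \<beta>: "fibre_metric \<beta>" and tr: "(U, \<Phi>) \<in> bundle_atlas E" and p: "p \<in> U"
  shows "bounded_bilinear (\<lambda>u v. \<beta> (frame U \<Phi> p u) (frame U \<Phi> p v))" (is "bounded_bilinear ?\<beta>")
    and "\<beta> (frame U \<Phi> p u) (frame U \<Phi> p v) = \<beta> (frame U \<Phi> p v) (frame U \<Phi> p u)"
proof -
  have eq: "\<pi> (frame U \<Phi> p u) = \<pi> (frame U \<Phi> p v)" for u v by (simp add: trivialization[OF tr] p)
  show sym: "?\<beta> u v = ?\<beta> v u" for u v using \<beta> eq unfolding fibre_metric_def by blast
  have add: "?\<beta> (u + v) w = ?\<beta> u w + ?\<beta> v w" for u v w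
    using \<beta> eq unfolding fibre_metric_def frame_linear[OF tr p] by blast
  have scale: "?\<beta> (r *\<^sub>R u) w = r * ?\<beta> u w" for r u w
    using \<beta> eq unfolding fibre_metric_def frame_linear[OF tr p] by blast
  have lin: "linear (\<lambda>u. ?\<beta> u w)" for w by (rule linearI) (simp_all add: add scale)
  have lin': "linear (\<lambda>w. ?\<beta> u w)" for u
    by (rule linearI) (simp_all add: sym[of u] add scale)
  obtain n and b :: "nat \<Rightarrow> 'b" and c where co: "coordinates n b c" using coordinates_exist[OF fd_fibre] .
  have exp: "?\<beta> u v = (\<Sum>i<n. c i u * (\<Sum>j<n. c j v * ?\<beta> (b i) (b j)))" for u v
  proof -
    have "?\<beta> u v = (\<Sum>i<n. c i u * ?\<beta> (b i) v)"
      using linear_coordinates[OF co lin[of v], of u] by simp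
    also have "\<dots> = (\<Sum>i<n. c i u * (\<Sum>j<n. c j v * ?\<beta> (b i) (b j)))"
    proof (rule sum.cong[OF refl])
      fix i show "c i u * ?\<beta> (b i) v = c i u * (\<Sum>j<n. c j v * ?\<beta> (b i) (b j))"
        using linear_coordinates[OF co lin'[of "b i"], of v] by simp
    qed
    finally show ?thesis .
  qed
  have "\<exists>K. \<forall>u v. \<bar>?\<beta> u v\<bar> \<le> norm u * norm v * K"
  proof -
    obtain C where C: "\<And>i x. i < n \<Longrightarrow> \<bar>c i x\<bar> \<le> norm x * C i"
    proof -
      have "\<exists>C. \<forall>x. \<bar>c i x\<bar> \<le> norm x * C" if "i < n" for i
        using bounded_linear.bounded[OF coordinatesD(1)[OF co that]] by auto
      then show ?thesis using that by metis
    qed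
    have "\<bar>?\<beta> u v\<bar> \<le> norm u * norm v * (\<Sum>i<n. \<Sum>j<n. C i * C j * \<bar>?\<beta> (b i) (b j)\<bar>)" for u v
    proof -
      have "\<bar>?\<beta> u v\<bar> \<le> (\<Sum>i<n. \<Sum>j<n. \<bar>c i u\<bar> * \<bar>c j v\<bar> * \<bar>?\<beta> (b i) (b j)\<bar>)"
        unfolding exp[of u v] sum_distrib_left
        by (intro order_trans[OF sum_abs] sum_mono) (simp add: abs_mult mult.assoc)
      also have "\<dots> \<le> (\<Sum>i<n. \<Sum>j<n. (norm u * C i) * (norm v * C j) * \<bar>?\<beta> (b i) (b j)\<bar>)"
        by (intro sum_mono mult_right_mono mult_mono C) (auto intro: order_trans[OF abs_ge_zero C])
      also have "\<dots> = norm u * norm v * (\<Sum>i<n. \<Sum>j<n. C i * C j * \<bar>?\<beta> (b i) (b j)\<bar>)"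
        by (simp add: sum_distrib_left ac_simps)
      finally show ?thesis .
    qed
    then show ?thesis by blast
  qed
  then show "bounded_bilinear ?\<beta>"
    using linear_add[OF lin] linear_add[OF lin'] linear_cmul[OF lin] linear_cmul[OF lin']
    by unfold_locales auto
qed

text \<open>This expresses \<open>\<beta> e (s (\<pi> e))\<close> as a derivative of the smooth function \<open>e \<mapsto> \<beta> e e\<close> along the vertical
  lift of \<open>s\<close>, so that it is smooth in \<open>e\<close> for a smooth section \<open>s\<close>.\<close>

lemma fibre_metric_gradient:
  assumes \<beta>: "fibre_metric \<beta>" and s: "\<pi> s = \<pi> e"
  shows "vertical_lift_at E e s (\<lambda>e. \<beta> e e) = 2 * \<beta> e s"
proof -
  obtain U \<Phi> where tr: "(U, \<Phi>) \<in> bundle_atlas E" and e: "\<pi> e \<in> U" using trivialization_obtain .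
  let ?\<beta> = "\<lambda>u v. \<beta> (frame U \<Phi> (\<pi> e) u) (frame U \<Phi> (\<pi> e) v)"
  interpret bounded_bilinear ?\<beta> by (rule fibre_metric_frame[OF \<beta> tr e])
  have "((\<lambda>v. ?\<beta> v v) has_derivative (\<lambda>h. ?\<beta> (\<Phi> e) h + ?\<beta> h (\<Phi> e))) (at (\<Phi> e))"
    using FDERIV[OF has_derivative_ident has_derivative_ident] .
  from fun_cong[OF frechet_derivative_at[OF this], of "\<Phi> s"]
  have "frechet_derivative (\<lambda>v. ?\<beta> v v) (at (\<Phi> e)) (\<Phi> s) = ?\<beta> (\<Phi> e) (\<Phi> s) + ?\<beta> (\<Phi> s) (\<Phi> e)"
    by (rule sym)
  also have "\<dots> = 2 * \<beta> e s"
    using fibre_metric_frame(2)[OF \<beta> tr e, of "\<Phi> s" "\<Phi> e"] trivialization(5)[OF tr e]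
      trivialization(5)[OF tr, of s] e s by simp
  finally show ?thesis
    using \<beta> by (subst vertical_lift_at_frame[OF tr e s]) (auto simp: fibre_metric_def smooth_functions_smooth_fun_on)
qed

lemma bundle_ball_field_vector_field:
  assumes \<beta>: "fibre_metric \<beta>" and s: "smooth_section s"
  shows "vector_field (total_atlas E) (bundle_ball_field \<beta> s)"
  unfolding vector_field_def
proof (intro conjI allI ballI)
  have sec: "section_of s" using s by (simp add: smooth_section_def)
  show "bundle_ball_field \<beta> s p \<in> tangent_space (total_atlas E) p" for p
    using bundle_ball_field_vertical[OF sec] by (simp add: vertical_space_def)
  fix f assume f: "f \<in> smooth_functions (total_atlas E)"
  let ?q = "\<lambda>e. \<beta> e e"
  have q: "?q \<in> smooth_functions (total_atlas E)" and q': "smooth_fun UNIV ?q"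
    using \<beta> by (auto simp: fibre_metric_def smooth_functions_smooth_fun_on)
  note mult = smooth_fun_on_mult[OF charted_total open_UNIV]
  have grad: "\<beta> e (s (\<pi> e)) = 1 / 2 * vertical_lift_at E e (s (\<pi> e)) ?q" for e
    using sec by (subst fibre_metric_gradient[OF \<beta>]) (auto simp: section_of_def)
  have 1: "smooth_fun UNIV (\<lambda>e. vertical_lift_at E e (s (\<pi> e)) f)"
    and 2: "smooth_fun UNIV (\<lambda>e. vertical_lift_at E e (s (\<pi> e)) ?q)"
    using s f q by (auto simp: smooth_section_def)
  have 3: "smooth_fun UNIV (\<lambda>e. \<beta> e (s (\<pi> e)))"
    unfolding grad by (rule mult[OF smooth_fun_on_const[OF charted_total open_UNIV] 2])
  show "(\<lambda>e. bundle_ball_field \<beta> s e f) \<in> smooth_functions (total_atlas E)"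
    unfolding bundle_ball_field_eq[OF sec] smooth_functions_smooth_fun_on mem_Collect_eq
    by (rule smooth_fun_on_add[OF charted_total open_UNIV mult[OF smooth_fun_on_real_compose[OF charted_total open_UNIV q' smooth_on_cutoff] 1]
          mult[OF mult[OF smooth_fun_on_real_compose[OF charted_total open_UNIV q' smooth_on_rad] 3] smooth_euler[OF f]]])
qed

text \<open>This reduces commutation and completeness on \<open>E\<close> to the corresponding facts about \<open>ball_field\<close> in a
  single fibre.\<close>

lemma bundle_ball_field_frame:
  assumes tr: "(U, \<Phi>) \<in> bundle_atlas E" and p: "p \<in> U" and s: "section_of s"
    and f: "f \<in> smooth_functions (total_atlas E)"
  shows "bundle_ball_field \<beta> s (frame U \<Phi> p v) f =
    frechet_derivative (\<lambda>v. f (frame U \<Phi> p v)) (at v)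
      (ball_field (\<lambda>u v. \<beta> (frame U \<Phi> p u) (frame U \<Phi> p v)) (\<Phi> (s p)) v)"
proof -
  let ?e = "frame U \<Phi> p v"
  have e: "\<pi> ?e = p" "\<Phi> ?e = v" using trivialization[OF tr] p by auto
  have sp: "\<pi> (s p) = p" using s by (simp add: section_of_def)
  have fs: "frame U \<Phi> p (\<Phi> (s p)) = s p" using trivialization(5)[OF tr, of "s p"] sp p by simp
  show ?thesis unfolding bundle_ball_field_def
    by (subst vertical_lift_at_frame[OF tr _ _ f])
       (simp_all add: e p sp fibre_closed_ops trivialization[OF tr] ball_field_def fs)
qed

lemma bundle_ball_fields_commute:
  assumes \<beta>: "fibre_metric \<beta>" and s: "smooth_section s" and t: "smooth_section t"
  shows "lie_bracket (bundle_ball_field \<beta> s) (bundle_ball_field \<beta> t) = (\<lambda>e f. 0)"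
proof (intro ext)
  fix e f
  let ?X = "bundle_ball_field \<beta> s" and ?Y = "bundle_ball_field \<beta> t"
  have sec: "section_of s" "section_of t" using s t by (auto simp: smooth_section_def)
  have vf: "vector_field (total_atlas E) ?X" "vector_field (total_atlas E) ?Y"
    using bundle_ball_field_vector_field[OF \<beta>] s t by auto
  show "lie_bracket ?X ?Y e f = 0"
  proof (cases "f \<in> smooth_functions (total_atlas E)")
    case False
    have zero: "Z p f = 0" if "vector_field (total_atlas E) Z" for Z p
      using that False unfolding vector_field_def tangent_space_def by auto
    have zero': "Z p (\<lambda>q. 0) = 0" if "vector_field (total_atlas E) Z" for Z p
    proof -
      have "Z p \<in> tangent_space (total_atlas E) p" using that by (simp add: vector_field_def)
      from tangent_spaceD(2)[OF this sf_const[OF total_manifold, of 0], of 0] show ?thesis by simp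
    qed
    have "(\<lambda>q. ?X q f) = (\<lambda>q. 0)" "(\<lambda>q. ?Y q f) = (\<lambda>q. 0)"
      using zero vf by auto
    then show ?thesis by (simp only: lie_bracket_def zero'[OF vf(1)] zero'[OF vf(2)] diff_self)
  next
    case f: True
    obtain U \<Phi> where tr: "(U, \<Phi>) \<in> bundle_atlas E" and e: "\<pi> e \<in> U" using trivialization_obtain .
    obtain n and b :: "nat \<Rightarrow> 'b" and c where co: "coordinates n b c" using coordinates_exist[OF fd_fibre] .
    let ?p = "\<pi> e" and ?v = "\<Phi> e"
    let ?fr = "frame U \<Phi> ?p"
    let ?\<beta> = "\<lambda>u v. \<beta> (?fr u) (?fr v)"
    let ?F = "ball_field ?\<beta> (\<Phi> (s ?p))" and ?G = "ball_field ?\<beta> (\<Phi> (t ?p))"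
    note bil = fibre_metric_frame[OF \<beta> tr e]
    have ev: "e = ?fr ?v" using trivialization(5)[OF tr e] by simp
    have XZ: "bundle_ball_field \<beta> s' e (\<lambda>e. bundle_ball_field \<beta> t' e f) =
        frechet_derivative (\<lambda>v. frechet_derivative (\<lambda>v. f (?fr v)) (at v) (ball_field ?\<beta> (\<Phi> (t' ?p)) v)) (at ?v)
         (ball_field ?\<beta> (\<Phi> (s' ?p)) ?v)" if st: "section_of s'" "smooth_section t'" for s' t'
    proof -
      have "(\<lambda>e. bundle_ball_field \<beta> t' e f) \<in> smooth_functions (total_atlas E)"
        using bundle_ball_field_vector_field[OF \<beta> st(2)] f by (simp add: vector_field_def)
      moreover have "section_of t'" using st by (simp add: smooth_section_def)
      ultimately show ?thesis
        by (subst ev, subst bundle_ball_field_frame[OF tr e st(1)])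
           (simp_all add: bundle_ball_field_frame[OF tr e _ f])
    qed
    have "smooth_on UNIV (\<lambda>v. f (?fr v))" by (rule smooth_on_frame[OF tr smooth_functionsD[OF f] e])
    from derivatives_along_commuting_fields[OF co this ball_field_has_derivative[OF bil] ball_field_has_derivative[OF bil]
        ball_fields_commute[OF bil]]
    show ?thesis unfolding lie_bracket_def XZ[OF sec(1) t] XZ[OF sec(2) s] by simp
  qed
qed

lemma bundle_ball_field_complete:
  assumes \<beta>: "fibre_metric \<beta>" and s: "section_of s"
  shows "complete_flow (total_atlas E) (bundle_ball_field \<beta> s)"
  unfolding complete_flow_def
proof
  fix e
  obtain U \<Phi> where tr: "(U, \<Phi>) \<in> bundle_atlas E" and e: "\<pi> e \<in> U" using trivialization_obtain .
  let ?p = "\<pi> e"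
  let ?fr = "frame U \<Phi> ?p"
  let ?\<beta> = "\<lambda>u v. \<beta> (?fr u) (?fr v)"
  obtain w where w: "smooth_on UNIV w" "w 0 = \<Phi> e"
    "\<And>t. (w has_vector_derivative ball_field ?\<beta> (\<Phi> (s ?p)) (w t)) (at t)"
    by (rule ball_field_complete[OF fibre_metric_frame[OF \<beta> tr e], where v = "\<Phi> e" and s = "\<Phi> (s ?p)"])
      (use that in blast)
  let ?c = "\<lambda>t. ?fr (w t)"
  have "smooth_map_on euclidean_atlas (total_atlas E) UNIV (\<lambda>t. (\<lambda>z. frame U \<Phi> (fst z) (snd z)) (?p, w t))"
    by (rule smooth_map_on_compose[OF charted_euclidean[OF finite_dimensional_real]
          charted_prod_euclidean[OF charted_base fd_fibre] charted_total open_UNIV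
          open_Times[OF trivialization(1)[OF tr] open_UNIV] smooth_curve_in_slice[OF charted_base w(1)] _
          trivialization(7)[OF tr]]) (use e in auto)
  moreover have "((\<lambda>t. f (?c t)) has_real_derivative bundle_ball_field \<beta> s (?c t) f) (at t)"
    if f: "f \<in> smooth_functions (total_atlas E)" for t f
  proof -
    have "((\<lambda>v. f (?fr v)) has_derivative frechet_derivative (\<lambda>v. f (?fr v)) (at (w t))) (at (w t))"
      using smooth_on_frame[OF tr smooth_functionsD[OF f] e] by (simp add: smooth_on_has_derivative)
    from vector_derivative_diff_chain_within[OF w(3)[of t], of "\<lambda>v. f (?fr v)"] this
    have "(((\<lambda>v. f (?fr v)) \<circ> w) has_vector_derivative
        frechet_derivative (\<lambda>v. f (?fr v)) (at (w t)) (ball_field ?\<beta> (\<Phi> (s ?p)) (w t))) (at t)"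
      by (simp add: has_derivative_at_withinI)
    then show ?thesis
      unfolding bundle_ball_field_frame[OF tr e s f] has_real_derivative_iff_has_vector_derivative o_def .
  qed
  moreover have "?c 0 = e" using w(2) trivialization(5)[OF tr e] by simp
  ultimately show "\<exists>c. integral_curve (total_atlas E) (bundle_ball_field \<beta> s) c \<and> c 0 = e"
    unfolding integral_curve_def by (intro exI[of _ ?c]) simp
qed

end

section \<open>Sums of wedges of commuting fields\<close>

lemma wedge_sum_exterior_square:
  fixes X Y :: "nat \<Rightarrow> 'i \<Rightarrow> real"
  assumes "\<forall>i\<in>{1..d}. X i \<in> V \<and> Y i \<in> V"
  shows "(\<lambda>f g. \<Sum>i=1..d. wedge (X i) (Y i) f g) \<in> exterior_square V"
  unfolding exterior_square_def
  by (rule CollectI, rule exI[of _ d], rule exI[of _ "\<lambda>k. X (Suc k)"], rule exI[of _ "\<lambda>k. Y (Suc k)"])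
     (use assms in \<open>auto simp: sum.atLeast1_atMost_eq\<close>)

lemma tangent_space_zero:
  assumes "smooth_manifold A" "v \<in> tangent_space A p"
  shows "v (\<lambda>q. 0) = 0"
  using tangent_spaceD(2)[OF assms(2) sf_const[OF assms(1), of 0], of 0] by simp

lemma tangent_space_sum:
  assumes A: "smooth_manifold A" and v: "v \<in> tangent_space A p"
    and f: "\<And>i. i \<in> I \<Longrightarrow> f i \<in> smooth_functions A"
  shows "v (\<lambda>q. \<Sum>i\<in>I. f i q) = (\<Sum>i\<in>I. v (f i))" and "(\<lambda>q. \<Sum>i\<in>I. f i q) \<in> smooth_functions A"
proof -
  note zero = tangent_space_zero[OF A v]
  have "v (\<lambda>q. \<Sum>i\<in>I. f i q) = (\<Sum>i\<in>I. v (f i)) \<and> (\<lambda>q. \<Sum>i\<in>I. f i q) \<in> smooth_functions A"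
    using f
  proof (induction I rule: infinite_finite_induct)
    case (insert i I)
    then have "f i \<in> smooth_functions A" "(\<lambda>q. \<Sum>i\<in>I. f i q) \<in> smooth_functions A" by auto
    then show ?case
      using insert tangent_spaceD(1)[OF v] sf_add[OF A] by simp
  qed (simp_all add: zero sf_const[OF A])
  then show "v (\<lambda>q. \<Sum>i\<in>I. f i q) = (\<Sum>i\<in>I. v (f i))" "(\<lambda>q. \<Sum>i\<in>I. f i q) \<in> smooth_functions A" by auto
qed

text \<open>By bilinearity, the Schouten bracket is a sum over pairs of wedges, and each summand is a combination
  of Lie brackets of the fields involved. Functions that are not smooth are treated separately: they
  are annihilated by all tangent vectors.\<close>

lemma poisson_sum_commuting_wedges:
  assumes A: "smooth_manifold A"
    and vf: "\<forall>i\<in>{1..d::nat}. vector_field A (X i) \<and> vector_field A (Y i)"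
    and comm: "\<forall>i\<in>{1..d}. \<forall>j\<in>{1..d}. lie_bracket (X i) (X j) = (\<lambda>e f. 0) \<and>
       lie_bracket (X i) (Y j) = (\<lambda>e f. 0) \<and> lie_bracket (Y i) (Y j) = (\<lambda>e f. 0)"
  shows "poisson_structure A (\<lambda>e f g. \<Sum>i=1..d. wedge (X i e) (Y i e) f g)"
proof -
  let ?I = "{1..d}"
  let ?w = "\<lambda>i e. wedge (X i e) (Y i e)"
  let ?\<theta> = "\<lambda>e f g. \<Sum>i\<in>?I. ?w i e f g"
  have tan: "X i p \<in> tangent_space A p" "Y i p \<in> tangent_space A p"
    and sm: "f \<in> smooth_functions A \<Longrightarrow> (\<lambda>p. X i p f) \<in> smooth_functions A"
      "f \<in> smooth_functions A \<Longrightarrow> (\<lambda>p. Y i p f) \<in> smooth_functions A" if "i \<in> ?I" for i p f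
    using vf that by (auto simp: vector_field_def)
  have wsm: "(\<lambda>p. ?w i p f g) \<in> smooth_functions A"
    if i: "i \<in> ?I" and "f \<in> smooth_functions A" "g \<in> smooth_functions A" for i f g
  proof -
    have "(\<lambda>p. X i p f * Y i p g + - 1 * (X i p g * Y i p f)) \<in> smooth_functions A"
      by (intro sf_add[OF A] sf_mult[OF A] sf_const[OF A] sm i that)
    then show ?thesis by (simp add: wedge_def)
  qed
  have bv: "bivector_field A ?\<theta>"
    unfolding bivector_field_def
  proof (intro conjI allI ballI)
    show "?\<theta> p \<in> exterior_square (tangent_space A p)" for p
      by (rule wedge_sum_exterior_square) (use tan in auto)
    show "(\<lambda>p. ?\<theta> p f g) \<in> smooth_functions A"
      if "f \<in> smooth_functions A" "g \<in> smooth_functions A" for f g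
      using smooth_fun_on_sum[OF smooth_manifold_charted[OF A] open_UNIV, of ?I "\<lambda>i p. ?w i p f g"] wsm that
      by (simp add: smooth_functions_smooth_fun_on)
  qed
  have z1: "?\<theta> p f g = 0" if "f \<notin> smooth_functions A \<or> g \<notin> smooth_functions A" for p f g
  proof (rule sum.neutral, rule ballI)
    fix i assume "i \<in> ?I"
    then show "?w i p f g = 0" using tan[of i p] that by (auto simp: tangent_space_def wedge_def)
  qed
  have z2: "?\<theta> p f (\<lambda>q. 0) = 0" for p f
  proof (rule sum.neutral, rule ballI)
    fix i assume i: "i \<in> ?I"
    have "X i p (\<lambda>q. 0) = 0" "Y i p (\<lambda>q. 0) = 0"
      using tangent_space_zero[OF A] tan[OF i] by auto
    then show "?w i p f (\<lambda>q. 0) = 0" by (simp add: wedge_def)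
  qed
  have "schouten ?\<theta> ?\<theta> p f g h = 0" for p f g h
  proof (cases "f \<in> smooth_functions A \<and> g \<in> smooth_functions A \<and> h \<in> smooth_functions A")
    case True
    have lin: "?\<theta> p a (\<lambda>q. ?\<theta> q b c) = (\<Sum>i\<in>?I. \<Sum>j\<in>?I. ?w i p a (\<lambda>q. ?w j q b c))"
      if bc: "b \<in> smooth_functions A" "c \<in> smooth_functions A" for a b c
    proof (rule sum.cong[OF refl])
      fix i assume i: "i \<in> ?I"
      have "X i p (\<lambda>q. ?\<theta> q b c) = (\<Sum>j\<in>?I. X i p (\<lambda>q. ?w j q b c))"
        "Y i p (\<lambda>q. ?\<theta> q b c) = (\<Sum>j\<in>?I. Y i p (\<lambda>q. ?w j q b c))"
        by (rule tangent_space_sum(1)[OF A tan(1)[OF i], where f = "\<lambda>j q. ?w j q b c"],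
            use wsm bc in blast,
            rule tangent_space_sum(1)[OF A tan(2)[OF i], where f = "\<lambda>j q. ?w j q b c"],
            use wsm bc in blast)
      then show "?w i p a (\<lambda>q. ?\<theta> q b c) = (\<Sum>j\<in>?I. ?w i p a (\<lambda>q. ?w j q b c))"
        unfolding wedge_def[of "X i p"] by (simp add: sum_subtractf sum_distrib_left sum_distrib_right)
    qed
    have "schouten ?\<theta> ?\<theta> p f g h = (\<Sum>i\<in>?I. \<Sum>j\<in>?I. schouten (?w i) (?w j) p f g h)"
    proof -
      have swap: "(\<Sum>i\<in>?I. \<Sum>j\<in>?I. ?w j p a (\<lambda>q. ?w i q b c)) = (\<Sum>i\<in>?I. \<Sum>j\<in>?I. ?w i p a (\<lambda>q. ?w j q b c))" for a b c
        by (rule sum.swap)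
      have T: "f \<in> smooth_functions A" "g \<in> smooth_functions A" "h \<in> smooth_functions A"
        using True by auto
      show ?thesis unfolding schouten_def by (simp only: lin T sum.distrib swap)
    qed
    also have "\<dots> = 0"
    proof (intro sum.neutral ballI)
      fix i j assume ij: "i \<in> ?I" "j \<in> ?I"
      have vfs: "vector_field A (X i)" "vector_field A (Y i)" "vector_field A (X j)" "vector_field A (Y j)"
        using vf ij by auto
      have b: "lie_bracket (X i) (X j) = (\<lambda>e f. 0)" "lie_bracket (X i) (Y j) = (\<lambda>e f. 0)"
        "lie_bracket (Y i) (Y j) = (\<lambda>e f. 0)" "lie_bracket (X j) (Y i) = (\<lambda>e f. 0)"
        using comm ij by auto
      have b': "lie_bracket (Y i) (X j) = (\<lambda>e f. 0)"
        using b(4) unfolding lie_bracket_def fun_eq_iff by (metis minus_diff_eq neg_0_equal_iff_equal)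
      show "schouten (?w i) (?w j) p f g h = 0"
        using True by (subst schouten_wedge[OF A vfs]) (simp_all add: b b' wedge3_def wedge_def)
    qed
    finally show ?thesis .
  next
    case False
    have "?\<theta> p a (\<lambda>q. ?\<theta> q b c) = 0"
      if "a \<notin> smooth_functions A \<or> b \<notin> smooth_functions A \<or> c \<notin> smooth_functions A" for a b c
    proof (cases "a \<in> smooth_functions A")
      case True
      then have "(\<lambda>q. ?\<theta> q b c) = (\<lambda>q. 0)" using that z1 by auto
      then show ?thesis using z2 by simp
    qed (use z1 in blast)
    then show ?thesis using False unfolding schouten_def by auto
  qed
  then show ?thesis using bv by (auto simp: poisson_structure_def fun_eq_iff)
qed

context smooth_bundle
begin

lemma bundle_ball_field_support:
  assumes \<beta>: "fibre_metric \<beta>" and s: "section_of s"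
  shows "vf_support (bundle_ball_field \<beta> s) \<subseteq> {e. \<beta> e e \<le> 1}"
  unfolding vf_support_def
proof (rule closure_minimal)
  show "{e. bundle_ball_field \<beta> s e \<noteq> (\<lambda>f. 0)} \<subseteq> {e. \<beta> e e \<le> 1}"
  proof clarify
    fix e assume e: "bundle_ball_field \<beta> s e \<noteq> (\<lambda>f. 0)"
    show "\<beta> e e \<le> 1"
    proof (rule ccontr)
      assume "\<not> \<beta> e e \<le> 1"
      then have "bundle_ball_field \<beta> s e f = 0" for f
        by (simp add: bundle_ball_field_eq[OF s] cutoff_rad_outer)
      with e show False by (simp add: fun_eq_iff)
    qed
  qed
  show "closed {e. \<beta> e e \<le> 1}"
    using \<beta> by (intro closed_Collect_le continuous_on_const) (auto simp: fibre_metric_def smooth_fun_on_alt)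
qed

lemma bundle_ball_field_inner:
  assumes "section_of s" "\<beta> e e < 1 / 4"
  shows "bundle_ball_field \<beta> s e = vertical_lift_at E e (s (\<pi> e))"
  using assms by (simp add: fun_eq_iff bundle_ball_field_eq cutoff_rad_inner)

lemma continuous_frame:
  assumes "(U, \<Phi>) \<in> bundle_atlas E" "p \<in> U"
  shows "continuous_on S (frame U \<Phi> p)"
proof -
  have "continuous_on (U \<times> UNIV) (\<lambda>z. frame U \<Phi> (fst z) (snd z))"
    using trivialization(7)[OF assms(1)] by (simp add: smooth_map_on_def)
  moreover have "continuous_on S (\<lambda>v. (p, v))" by (intro continuous_intros)
  ultimately have "continuous_on S (\<lambda>v. frame U \<Phi> (fst (p, v)) (snd (p, v)))"
    by (rule continuous_on_compose2) (use assms(2) in auto)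
  then show ?thesis by simp
qed

text \<open>The tube lemma around the compact part of the zero section over \<open>K\<close>, in a frame.\<close>

lemma fibrewise_neighbourhood_radius:
  assumes tr: "(U, \<Phi>) \<in> bundle_atlas E" and co: "coordinates k (b :: nat \<Rightarrow> 'b) c"
    and K: "compact K" "K \<subseteq> U" and W: "open W" "range (fib_zero E) \<subseteq> W"
  obtains \<delta> where "\<delta> > 0" "\<And>e. \<pi> e \<in> K \<Longrightarrow> (\<Sum>l<k. (c l (\<Phi> e))\<^sup>2) \<le> \<delta>\<^sup>2 \<Longrightarrow> e \<in> W"
proof -
  let ?G = "\<lambda>z. frame U \<Phi> (snd z) (fst z)"
  have "continuous_on (U \<times> UNIV) (\<lambda>z. frame U \<Phi> (fst z) (snd z))"
    using trivialization(7)[OF tr] by (simp add: smooth_map_on_def)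
  moreover have "continuous_on (UNIV \<times> U) (\<lambda>z::'b \<times> 'm. (snd z, fst z))" by (intro continuous_intros)
  ultimately have "continuous_on (UNIV \<times> U) (\<lambda>z::'b \<times> 'm. frame U \<Phi> (fst (snd z, fst z)) (snd (snd z, fst z)))"
    by (rule continuous_on_compose2) auto
  then have cont: "continuous_on (UNIV \<times> U) ?G" by simp
  let ?N = "(UNIV \<times> U) \<inter> ?G -` W"
  have "open ?N" using continuous_open_preimage[OF cont open_Times[OF open_UNIV trivialization(1)[OF tr]] W(1)] .
  moreover have "{0} \<times> K \<subseteq> ?N"
  proof
    fix z assume "z \<in> {0 :: 'b} \<times> K"
    then have "snd z \<in> U" "fst z = 0" using K(2) by auto
    then show "z \<in> ?N" using W(2) trivialization_zero(2)[OF tr, of "snd z"] by (cases z) auto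
  qed
  ultimately have "\<exists>X0. 0 \<in> X0 \<and> open X0 \<and> X0 \<times> K \<subseteq> ?N"
    by (rule Elementary_Topology.tube_lemma[OF K(1)])
  then obtain X0 where X0: "0 \<in> X0" "open X0" "X0 \<times> K \<subseteq> ?N" by blast
  then obtain \<epsilon> where \<epsilon>: "\<epsilon> > 0" "ball 0 \<epsilon> \<subseteq> X0" using open_contains_ball by blast
  define M where "M = 1 + (\<Sum>l<k. norm (b l))"
  have M: "M > 0" by (simp add: M_def add_pos_nonneg sum_nonneg)
  show ?thesis
  proof
    show d: "\<epsilon> / (2 * M) > 0" using \<epsilon> M by simp
    fix e assume e: "\<pi> e \<in> K" "(\<Sum>l<k. (c l (\<Phi> e))\<^sup>2) \<le> (\<epsilon> / (2 * M))\<^sup>2"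
    have cl: "\<bar>c l (\<Phi> e)\<bar> \<le> \<epsilon> / (2 * M)" if "l < k" for l
    proof -
      have "(c l (\<Phi> e))\<^sup>2 \<le> (\<Sum>l<k. (c l (\<Phi> e))\<^sup>2)" using that by (intro member_le_sum) auto
      then have "(c l (\<Phi> e))\<^sup>2 \<le> (\<epsilon> / (2 * M))\<^sup>2" using e(2) by linarith
      then show ?thesis using d abs_le_square_iff[of "c l (\<Phi> e)" "\<epsilon> / (2 * M)"] by simp
    qed
    have "norm (\<Phi> e) = norm (\<Sum>l<k. c l (\<Phi> e) *\<^sub>R b l)" by (simp add: coordinatesD(2)[OF co])
    also have "\<dots> \<le> (\<Sum>l<k. \<epsilon> / (2 * M) * norm (b l))"
    proof (rule sum_norm_le)
      fix l assume "l \<in> {..<k}"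
      then show "norm (c l (\<Phi> e) *\<^sub>R b l) \<le> \<epsilon> / (2 * M) * norm (b l)"
        unfolding norm_scaleR by (intro mult_right_mono cl) auto
    qed
    also have "\<dots> = \<epsilon> / (2 * M) * (\<Sum>l<k. norm (b l))" by (rule sum_distrib_left[symmetric])
    also have "\<dots> \<le> \<epsilon> / (2 * M) * M" using d by (intro mult_left_mono) (simp_all add: M_def)
    also have "\<dots> < \<epsilon>" using \<epsilon> M by simp
    finally have "\<Phi> e \<in> X0" using \<epsilon>(2) by (auto simp: dist_norm)
    then have "(\<Phi> e, \<pi> e) \<in> ?N" using X0(3) e(1) by blast
    then show "e \<in> W" using trivialization(5)[OF tr] by auto
  qed
qed

text \<open>The expansion of a bivector in the basis given by a frame, evaluated on two covectors.\<close>

lemma bivector_expansion: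
  assumes \<gamma>: "\<gamma> \<in> exterior_square (fibre_eval E ` fibre E p)"
    and tr: "(U, \<Phi>) \<in> bundle_atlas E" and p: "p \<in> U" and co: "coordinates k (b :: nat \<Rightarrow> 'b) c"
    and dual: "\<alpha> \<in> fibre_dual E p" "\<eta> \<in> fibre_dual E p"
  defines "\<epsilon> \<equiv> \<lambda>l e. if e \<in> fibre E p then c l (\<Phi> e) else 0"
  shows "\<gamma> \<alpha> \<eta> = (\<Sum>l<k. \<Sum>m<k. \<gamma> (\<epsilon> l) (\<epsilon> m) * (\<alpha> (frame U \<Phi> p (b l)) * \<eta> (frame U \<Phi> p (b m))))"
    and "\<gamma> \<eta> \<alpha> = - \<gamma> \<alpha> \<eta>"
proof -
  obtain n v w where vw: "\<gamma> = (\<lambda>i j. \<Sum>q<n. wedge (v q) (w q) i j)"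
    "\<And>q. q < (n::nat) \<Longrightarrow> v q \<in> fibre_eval E ` fibre E p \<and> w q \<in> fibre_eval E ` fibre E p"
    using \<gamma> unfolding exterior_square_def by blast
  have "\<forall>q. \<exists>x y. q < n \<longrightarrow> x \<in> fibre E p \<and> y \<in> fibre E p \<and> v q = fibre_eval E x \<and> w q = fibre_eval E y"
    using vw(2) by blast
  then obtain x y where xy: "\<And>q. q < n \<Longrightarrow> x q \<in> fibre E p \<and> y q \<in> fibre E p \<and>
      v q = fibre_eval E (x q) \<and> w q = fibre_eval E (y q)" by metis
  have ev: "\<gamma> a a' = (\<Sum>q<n. a (x q) * a' (y q) - a' (x q) * a (y q))"
    if "a \<in> fibre_dual E p" "a' \<in> fibre_dual E p" for a a'
    unfolding vw(1)
    by (rule sum.cong[OF refl]) (use xy that in \<open>auto simp: wedge_def fibre_eval_def fibre_def\<close>)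
  show "\<gamma> \<eta> \<alpha> = - \<gamma> \<alpha> \<eta>" unfolding ev[OF dual] ev[OF dual(2,1)] by (simp flip: sum_negf)
  have fin: "\<pi> (frame U \<Phi> p u) = p" for u by (simp add: trivialization[OF tr] p)
  have \<epsilon>: "\<epsilon> l \<in> fibre_dual E p" if "l < k" for l
    unfolding fibre_dual_def \<epsilon>_def fibre_def
    using p that by (auto simp: fibre_closed_ops trivialization[OF tr] coordinatesD(4,5)[OF co])
  have exp: "a z = (\<Sum>l<k. \<epsilon> l z * a (frame U \<Phi> p (b l)))" if a: "a \<in> fibre_dual E p" and z: "z \<in> fibre E p" for a z
  proof -
    have add: "a (fib_add E u u') = a u + a u'" if "\<pi> u = p" "\<pi> u' = p" for u u'
      using a that by (simp add: fibre_dual_def fibre_def)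
    have scale: "a (fib_scale E r u) = r * a u" if "\<pi> u = p" for r u
      using a that by (simp add: fibre_dual_def fibre_def)
    have "linear (\<lambda>u. a (frame U \<Phi> p u))"
      by (rule linearI) (simp_all add: frame_linear[OF tr p] add scale fin)
    from linear_coordinates[OF co this, of "\<Phi> z"]
    show ?thesis using z trivialization(5)[OF tr, of z] p by (simp add: \<epsilon>_def fibre_def)
  qed
  let ?A = "\<lambda>l. \<alpha> (frame U \<Phi> p (b l))" and ?B = "\<lambda>m. \<eta> (frame U \<Phi> p (b m))"
  have "\<gamma> \<alpha> \<eta> = (\<Sum>q<n. \<Sum>l<k. \<Sum>m<k. (\<epsilon> l (x q) * \<epsilon> m (y q) - \<epsilon> m (x q) * \<epsilon> l (y q)) * (?A l * ?B m))"
    unfolding ev[OF dual]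
  proof (rule sum.cong[OF refl])
    fix q assume "q \<in> {..<n}"
    then have q: "x q \<in> fibre E p" "y q \<in> fibre E p" using xy by auto
    have 1: "\<alpha> (x q) * \<eta> (y q) = (\<Sum>l<k. \<Sum>m<k. \<epsilon> l (x q) * \<epsilon> m (y q) * (?A l * ?B m))"
      unfolding exp[OF dual(1) q(1)] exp[OF dual(2) q(2)] sum_product by (simp add: ac_simps)
    have "\<alpha> (y q) * \<eta> (x q) = (\<Sum>l<k. \<Sum>m<k. \<epsilon> m (x q) * \<epsilon> l (y q) * (?A l * ?B m))"
      unfolding exp[OF dual(1) q(2)] exp[OF dual(2) q(1)] sum_product by (simp add: ac_simps)
    then show "\<alpha> (x q) * \<eta> (y q) - \<eta> (x q) * \<alpha> (y q) =
       (\<Sum>l<k. \<Sum>m<k. (\<epsilon> l (x q) * \<epsilon> m (y q) - \<epsilon> m (x q) * \<epsilon> l (y q)) * (?A l * ?B m))"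
      using 1 by (simp add: left_diff_distrib sum_subtractf mult.commute[of "\<eta> (x q)"])
  qed
  also have "\<dots> = (\<Sum>l<k. \<Sum>m<k. \<gamma> (\<epsilon> l) (\<epsilon> m) * (?A l * ?B m))"
  proof -
    have "\<gamma> (\<epsilon> l) (\<epsilon> m) * (?A l * ?B m) =
      (\<Sum>q<n. (\<epsilon> l (x q) * \<epsilon> m (y q) - \<epsilon> m (x q) * \<epsilon> l (y q)) * (?A l * ?B m))" if "l < k" "m < k" for l m
      unfolding ev[OF \<epsilon>[OF that(1)] \<epsilon>[OF that(2)]] by (simp add: sum_distrib_right)
    then show ?thesis
      by (subst sum.swap, intro sum.cong[OF refl], subst sum.swap) simp
  qed
  finally show "\<gamma> \<alpha> \<eta> = (\<Sum>l<k. \<Sum>m<k. \<gamma> (\<epsilon> l) (\<epsilon> m) * (?A l * ?B m))" .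
qed

end

section \<open>Gluing along the coloured cover\<close>

text \<open>The output of \<open>disjoint_families_of_bumps\<close> for trivialising sets \<open>D j\<close>. The radii \<open>\<delta> j\<close> prescribe
  the size of the unit balls of the metric over \<open>K j\<close>.\<close>

locale framed_bundle = smooth_bundle E
  for E :: "('e::{t2_space,second_countable_topology}, 'm::{t2_space,second_countable_topology},
      'c::real_normed_vector, 'a::real_normed_vector, 'b::real_normed_vector) vbundle" +
  fixes N :: nat and \<theta> :: "nat \<Rightarrow> nat \<Rightarrow> 'm \<Rightarrow> real" and K D :: "nat \<Rightarrow> 'm set" and \<Phi> :: "nat \<Rightarrow> 'e \<Rightarrow> 'b"
    and k :: nat and b :: "nat \<Rightarrow> 'b" and coord :: "nat \<Rightarrow> 'b \<Rightarrow> real" and \<delta> :: "nat \<Rightarrow> real"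
  assumes co: "coordinates k b coord"
    and tr: "\<And>j. (D j, \<Phi> j) \<in> bundle_atlas E"
    and \<theta>_smooth: "\<And>c j. smooth_fun_on (base_atlas E) UNIV (\<theta> c j)"
    and \<theta>_support: "\<And>c j p. \<theta> c j p \<noteq> 0 \<Longrightarrow> p \<in> K j"
    and K: "\<And>j. compact (K j)" "\<And>j. K j \<subseteq> D j"
    and \<theta>_locally_finite: "\<And>c. locally_finite_on UNIV (\<theta> c)"
    and \<theta>_disjoint: "\<And>c i j p. \<theta> c i p \<noteq> 0 \<Longrightarrow> \<theta> c j p \<noteq> 0 \<Longrightarrow> i = j"
    and \<theta>_cover: "\<And>p. \<exists>c\<le>N. \<exists>j. \<theta> c j p \<noteq> 0"
    and \<delta>: "\<And>j. \<delta> j > 0"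
begin

text \<open>At every point at most one summand is nonzero, so \<open>glue c F\<close> is \<open>\<theta> c j\<close> times \<open>F j\<close> on the \<open>j\<close>-th set of
  colour \<open>c\<close>. In particular, \<open>F j\<close> matters only over \<open>D j\<close>.\<close>

definition glue :: "nat \<Rightarrow> (nat \<Rightarrow> 'e \<Rightarrow> real) \<Rightarrow> 'e \<Rightarrow> real" where
  "glue c F e = (\<Sum>j. \<theta> c j (\<pi> e) * F j e)"

lemma suminf_active:
  assumes "\<theta> c j p \<noteq> 0" "\<And>i. \<theta> c i p = 0 \<Longrightarrow> F i = 0"
  shows "(\<Sum>i. F i) = (F j :: real)"
proof -
  have "F i = 0" if "i \<noteq> j" for i using \<theta>_disjoint[OF assms(1)] that assms(2) by blast
  then show ?thesis using suminf_finite[of "{j}" F] by simp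
qed

lemma glue_active: "\<theta> c j (\<pi> e) \<noteq> 0 \<Longrightarrow> glue c F e = \<theta> c j (\<pi> e) * F j e"
  unfolding glue_def by (rule suminf_active) auto

lemma glue_inactive: "(\<And>j. \<theta> c j (\<pi> e) = 0) \<Longrightarrow> glue c F e = 0"
  by (simp add: glue_def)

lemma glue_smooth:
  assumes "\<And>j. smooth_fun (\<pi> -` D j) (F j)"
  shows "smooth_fun UNIV (glue c F)"
  unfolding glue_def[abs_def]
proof (rule smooth_fun_on_suminf[OF charted_total open_UNIV])
  fix j
  have o: "open (\<pi> -` D j)" by (rule trivialization(2)[OF tr])
  have \<theta>: "smooth_fun UNIV (\<lambda>e. \<theta> c j (\<pi> e))" using smooth_fun_base[OF open_UNIV \<theta>_smooth] by simp
  have "smooth_fun (\<pi> -` D j) (\<lambda>e. \<theta> c j (\<pi> e) * F j e)"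
    using smooth_fun_on_mult[OF charted_total o smooth_fun_on_subset[OF \<theta>] assms[of j]] by simp
  moreover have "\<theta> c j (\<pi> e) = 0" if "\<pi> e \<notin> K j" for e using \<theta>_support that by blast
  ultimately show "smooth_fun UNIV (\<lambda>e. \<theta> c j (\<pi> e) * F j e)"
    by (intro smooth_fun_on_extend_zero[OF charted_total o _ _ open_UNIV, of "\<pi> -` K j" "\<lambda>e. \<theta> c j (\<pi> e) * F j e"])
       (use K(2) closed_vimage[OF compact_imp_closed[OF K(1)] proj_continuous] in auto)
next
  show "locally_finite_on UNIV (\<lambda>j e. \<theta> c j (\<pi> e) * F j e)"
    unfolding locally_finite_on_def
  proof
    fix e
    have "\<exists>W J. open W \<and> \<pi> e \<in> W \<and> (\<forall>j\<ge>J. \<forall>y\<in>W \<inter> UNIV. \<theta> c j y = 0)"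
      using \<theta>_locally_finite[of c] unfolding locally_finite_on_def by (rule bspec) simp
    then obtain W J where "open W" "\<pi> e \<in> W" "\<forall>j\<ge>J. \<forall>y\<in>W \<inter> UNIV. \<theta> c j y = 0"
      by (elim exE conjE)
    then show "\<exists>W J. open W \<and> e \<in> W \<and> (\<forall>j\<ge>J. \<forall>y\<in>W \<inter> UNIV. \<theta> c j (\<pi> y) * F j y = 0)"
      using open_vimage[OF _ proj_continuous] by (intro exI[of _ "\<pi> -` W"] exI[of _ J]) auto
  qed
qed

definition weight :: "nat \<Rightarrow> 'm \<Rightarrow> real" where
  "weight c p = (\<Sum>j. (\<theta> c j p)\<^sup>2)"

definition total_weight :: "'m \<Rightarrow> real" where
  "total_weight p = (\<Sum>c\<le>N. weight c p)"

lemma weight_active: "\<theta> c j p \<noteq> 0 \<Longrightarrow> weight c p = (\<theta> c j p)\<^sup>2"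
  unfolding weight_def by (rule suminf_active) auto

lemma weight_inactive: "(\<And>j. \<theta> c j p = 0) \<Longrightarrow> weight c p = 0"
  by (simp add: weight_def)

lemma weight_nonneg: "weight c p \<ge> 0"
  by (cases "\<exists>j. \<theta> c j p \<noteq> 0") (auto simp: weight_active weight_inactive)

lemma total_weight_pos: "total_weight p > 0"
proof -
  obtain c j where "c \<le> N" "\<theta> c j p \<noteq> 0" using \<theta>_cover by blast
  then show ?thesis unfolding total_weight_def
    by (intro sum_pos2[of _ c]) (auto simp: weight_active weight_nonneg)
qed

lemma total_weight_smooth: "smooth_fun_on (base_atlas E) UNIV total_weight"
  unfolding total_weight_def[abs_def] weight_def
proof (intro smooth_fun_on_sum[OF charted_base open_UNIV] smooth_fun_on_suminf[OF charted_base open_UNIV])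
  fix c j
  show "smooth_fun_on (base_atlas E) UNIV (\<lambda>p. (\<theta> c j p)\<^sup>2)"
    unfolding power2_eq_square by (intro smooth_fun_on_mult[OF charted_base open_UNIV] \<theta>_smooth)
  show "locally_finite_on UNIV (\<lambda>j p. (\<theta> c j p)\<^sup>2)"
    using \<theta>_locally_finite[of c] unfolding locally_finite_on_def by simp
qed

definition covector :: "nat \<Rightarrow> nat \<Rightarrow> 'e \<Rightarrow> real" where
  "covector c l = glue c (\<lambda>j e. coord l (\<Phi> j e) / \<delta> j)"

text \<open>On the sets of colour \<open>c\<close>, the summand for \<open>c\<close> is \<open>\<theta>\<^sup>2\<close> times the square of the fibre coordinates,
  rescaled by \<open>\<delta>\<close>. Division by \<open>total_weight\<close> makes \<open>metric\<close> a weighted mean of these local metrics.\<close>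

definition metric :: "'e \<Rightarrow> 'e \<Rightarrow> real" where
  "metric x y = (\<Sum>c\<le>N. \<Sum>l<k. covector c l x * covector c l y) / total_weight (\<pi> x)"

lemma covector_linear:
  assumes "l < k"
  shows "\<pi> x = \<pi> y \<Longrightarrow> covector c l (fib_add E x y) = covector c l x + covector c l y"
    and "covector c l (fib_scale E r x) = r * covector c l x"
proof -
  have D: "\<theta> c j p \<noteq> 0 \<Longrightarrow> p \<in> D j" for j p using \<theta>_support K(2) by blast
  show "covector c l (fib_add E x y) = covector c l x + covector c l y" if xy: "\<pi> x = \<pi> y"
  proof (cases "\<exists>j. \<theta> c j (\<pi> y) \<noteq> 0")
    case True
    then obtain j where "\<theta> c j (\<pi> y) \<noteq> 0" by blast
    then show ?thesis using xy D[of j "\<pi> y"]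
      by (simp add: covector_def glue_active fibre_closed_ops trivialization[OF tr] coordinatesD(4,5)[OF co assms]
          add_divide_distrib distrib_left)
  qed (use xy in \<open>simp add: covector_def glue_inactive fibre_closed_ops\<close>)
  show "covector c l (fib_scale E r x) = r * covector c l x"
  proof (cases "\<exists>j. \<theta> c j (\<pi> x) \<noteq> 0")
    case True
    then obtain j where "\<theta> c j (\<pi> x) \<noteq> 0" by blast
    then show ?thesis using D[of j "\<pi> x"]
      by (simp add: covector_def glue_active fibre_closed_ops trivialization[OF tr] coordinatesD(4,5)[OF co assms])
  qed (simp add: covector_def glue_inactive fibre_closed_ops)
qed

lemma covector_smooth: "l < k \<Longrightarrow> smooth_fun UNIV (covector c l)"
  unfolding covector_def divide_inverse
  by (intro glue_smooth smooth_fun_on_mult[OF charted_total trivialization(2)[OF tr]]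
      smooth_fun_on_const[OF charted_total trivialization(2)[OF tr]]
      smooth_fibre_coordinate[OF tr coordinatesD(1)[OF co]])

lemma fibre_metric_metric: "fibre_metric metric"
  unfolding fibre_metric_def
proof (intro conjI allI impI)
  show "metric (fib_add E x y) z = metric x z + metric y z" if "\<pi> x = \<pi> z" "\<pi> y = \<pi> z" for x y z
    using that by (simp add: metric_def fibre_closed_ops covector_linear distrib_right sum.distrib add_divide_distrib)
  show "metric (fib_scale E r x) z = r * metric x z" for r x z
    by (simp add: metric_def fibre_closed_ops covector_linear sum_distrib_left mult.assoc)
  show "metric x y = metric y x" if "\<pi> x = \<pi> y" for x y
    using that by (simp add: metric_def mult.commute)
  have "smooth_fun UNIV (\<lambda>e. total_weight (\<pi> e))" using smooth_fun_base[OF open_UNIV total_weight_smooth] by simp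
  then show "smooth_fun UNIV (\<lambda>e. metric e e)"
    unfolding metric_def
    by (intro smooth_fun_on_divide[OF charted_total open_UNIV] smooth_fun_on_sum[OF charted_total open_UNIV]
        smooth_fun_on_mult[OF charted_total open_UNIV] covector_smooth)
       (use total_weight_pos in \<open>auto simp: less_imp_neq[symmetric]\<close>)
qed

lemma covector_square_sum:
  assumes "\<theta> c j (\<pi> e) \<noteq> 0"
  shows "(\<Sum>l<k. covector c l e * covector c l e) = weight c (\<pi> e) * ((\<Sum>l<k. (coord l (\<Phi> j e))\<^sup>2) / (\<delta> j)\<^sup>2)"
  using assms \<delta>[of j]
  by (simp add: covector_def glue_active weight_active power2_eq_square sum_distrib_left sum_divide_distrib ac_simps)

text \<open>A weighted mean that is at most one has a member that is at most one.\<close>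

lemma metric_ball:
  assumes "metric e e \<le> 1"
  shows "\<exists>j. \<pi> e \<in> K j \<and> (\<Sum>l<k. (coord l (\<Phi> j e))\<^sup>2) \<le> (\<delta> j)\<^sup>2"
proof (rule ccontr)
  assume *: "\<not> ?thesis"
  let ?L = "\<lambda>c. \<Sum>l<k. covector c l e * covector c l e"
  have gt: "weight c (\<pi> e) < ?L c" if j: "\<theta> c j (\<pi> e) \<noteq> 0" for c j
  proof -
    have "(\<Sum>l<k. (coord l (\<Phi> j e))\<^sup>2) > (\<delta> j)\<^sup>2" using * \<theta>_support[OF j] by (auto simp: not_le)
    then have "(\<Sum>l<k. (coord l (\<Phi> j e))\<^sup>2) / (\<delta> j)\<^sup>2 > 1" using \<delta>[of j] by simp
    moreover have "weight c (\<pi> e) > 0" using weight_active[OF j] j by simp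
    ultimately have "weight c (\<pi> e) * 1 < weight c (\<pi> e) * ((\<Sum>l<k. (coord l (\<Phi> j e))\<^sup>2) / (\<delta> j)\<^sup>2)"
      by (rule mult_strict_left_mono)
    then show ?thesis unfolding covector_square_sum[OF j] by (simp only: mult_1_right)
  qed
  have "total_weight (\<pi> e) < (\<Sum>c\<le>N. ?L c)"
    unfolding total_weight_def
  proof (rule sum_strict_mono_ex1)
    show "\<forall>c\<in>{..N}. weight c (\<pi> e) \<le> ?L c"
    proof
      fix c show "weight c (\<pi> e) \<le> ?L c"
        using gt[of c] by (cases "\<exists>j. \<theta> c j (\<pi> e) \<noteq> 0") (auto simp: less_imp_le weight_inactive sum_nonneg)
    qed
    show "\<exists>c\<in>{..N}. weight c (\<pi> e) < ?L c" using \<theta>_cover[of "\<pi> e"] gt by blast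
  qed simp
  then have "metric e e > 1" using total_weight_pos[of "\<pi> e"] by (simp add: metric_def)
  with assms show False by simp
qed

text \<open>Already the contribution of one set that contains \<open>p\<close> bounds all fibre coordinates.\<close>

lemma metric_fibre_compact: "compact ({e. metric e e \<le> 1} \<inter> fibre E p)"
proof -
  obtain c j where cj: "c \<le> N" "\<theta> c j p \<noteq> 0" using \<theta>_cover by blast
  have p: "p \<in> D j" using \<theta>_support[OF cj(2)] K(2) by blast
  let ?fr = "frame (D j) (\<Phi> j) p"
  define S where "S = {v. metric (?fr v) (?fr v) \<le> 1}"
  have sm: "smooth_fun (\<pi> -` D j) (\<lambda>e. metric e e)"
    using fibre_metric_metric smooth_fun_on_subset unfolding fibre_metric_def by blast
  have "compact S"
  proof (rule finite_dimensional_compact[OF co])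
    show "closed S" unfolding S_def
      by (intro closed_Collect_le continuous_on_const smooth_on_continuous[OF smooth_on_frame[OF tr sm p]])
    fix v l assume v: "v \<in> S" and l: "l < k"
    have fr: "\<pi> (?fr v) = p" "\<Phi> j (?fr v) = v" by (simp_all add: trivialization[OF tr] p)
    let ?w = "weight c p / (\<delta> j)\<^sup>2"
    have w: "?w > 0" using weight_active[OF cj(2)] cj \<delta>[of j] by simp
    have "(coord l v)\<^sup>2 * ?w \<le> (\<Sum>l<k. (coord l v)\<^sup>2) * ?w"
      using l w by (intro mult_right_mono member_le_sum) auto
    also have "\<dots> = (\<Sum>l<k. covector c l (?fr v) * covector c l (?fr v))"
      using covector_square_sum[of c j "?fr v"] cj by (simp add: fr mult.commute)
    also have "\<dots> \<le> (\<Sum>c\<le>N. \<Sum>l<k. covector c l (?fr v) * covector c l (?fr v))"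
      using cj by (intro member_le_sum[of c "{..N}"]) (auto intro: sum_nonneg)
    also have "\<dots> \<le> total_weight p" using v total_weight_pos[of p] by (simp add: S_def metric_def fr)
    finally have "(coord l v)\<^sup>2 \<le> total_weight p / ?w" by (simp only: pos_le_divide_eq[OF w])
    moreover have "\<bar>coord l v\<bar> \<le> 1 + (coord l v)\<^sup>2"
    proof -
      have "0 \<le> (\<bar>coord l v\<bar> - 1)\<^sup>2" by simp
      then have "2 * \<bar>coord l v\<bar> \<le> 1 + (coord l v)\<^sup>2" by (simp add: power2_eq_square algebra_simps)
      then show ?thesis by linarith
    qed
    ultimately show "\<bar>coord l v\<bar> \<le> 1 + total_weight p / ?w" by linarith
  qed
  then have "compact (?fr ` S)" by (rule compact_continuous_image[OF continuous_frame[OF tr p]])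
  moreover have "?fr ` S = {e. metric e e \<le> 1} \<inter> fibre E p"
  proof (intro set_eqI iffI)
    fix e assume "e \<in> {e. metric e e \<le> 1} \<inter> fibre E p"
    then have "e = ?fr (\<Phi> j e)" "metric e e \<le> 1" using trivialization(5)[OF tr, of e j] p by (auto simp: fibre_def)
    then show "e \<in> ?fr ` S" unfolding S_def by (intro image_eqI[of _ _ "\<Phi> j e"]) auto
  qed (auto simp: S_def fibre_def trivialization[OF tr] p)
  ultimately show ?thesis by simp
qed

definition glue_section :: "nat \<Rightarrow> (nat \<Rightarrow> 'm \<Rightarrow> 'b) \<Rightarrow> 'm \<Rightarrow> 'e" where
  "glue_section c F p = (if \<exists>j. \<theta> c j p \<noteq> 0
     then let j = SOME j. \<theta> c j p \<noteq> 0 in frame (D j) (\<Phi> j) p (\<theta> c j p *\<^sub>R F j p) else fib_zero E p)"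

lemma glue_section_active:
  assumes "\<theta> c j p \<noteq> 0"
  shows "glue_section c F p = frame (D j) (\<Phi> j) p (\<theta> c j p *\<^sub>R F j p)"
proof -
  have "(SOME j. \<theta> c j p \<noteq> 0) = j" using assms \<theta>_disjoint by (intro some_equality) auto
  then show ?thesis using assms by (auto simp: glue_section_def Let_def)
qed

lemma glue_section_section: "section_of (glue_section c F)"
  unfolding section_of_def
proof
  fix p show "\<pi> (glue_section c F p) = p"
  proof (cases "\<exists>j. \<theta> c j p \<noteq> 0")
    case True
    then obtain j where j: "\<theta> c j p \<noteq> 0" by blast
    then have "p \<in> D j" using \<theta>_support K(2) by blast
    then show ?thesis using glue_section_active[OF j] by (simp add: trivialization[OF tr])
  qed (simp add: glue_section_def fibre_closed_ops)
qed

lemma vertical_lift_glue_section: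
  shows "\<theta> c j (\<pi> e) \<noteq> 0 \<Longrightarrow> vertical_lift_at E e (glue_section c F (\<pi> e)) f =
      \<theta> c j (\<pi> e) * vertical_lift_at E e (frame (D j) (\<Phi> j) (\<pi> e) (F j (\<pi> e))) f"
    and "(\<And>j. \<theta> c j (\<pi> e) = 0) \<Longrightarrow> vertical_lift_at E e (glue_section c F (\<pi> e)) f = 0"
proof -
  show "vertical_lift_at E e (glue_section c F (\<pi> e)) f =
      \<theta> c j (\<pi> e) * vertical_lift_at E e (frame (D j) (\<Phi> j) (\<pi> e) (F j (\<pi> e))) f" if j: "\<theta> c j (\<pi> e) \<noteq> 0"
  proof -
    have p: "\<pi> e \<in> D j" using \<theta>_support[OF j] K(2) by blast
    show ?thesis unfolding glue_section_active[OF j] frame_linear(2)[OF tr p]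
      by (rule vertical_lift_at_linear(2)) (simp_all add: trivialization[OF tr] p)
  qed
  assume z: "\<And>j. \<theta> c j (\<pi> e) = 0"
  have "fib_scale E 0 e = fib_zero E (\<pi> e)"
  proof -
    obtain U \<Psi> where t: "(U, \<Psi>) \<in> bundle_atlas E" "\<pi> e \<in> U" using trivialization_obtain .
    show ?thesis
      by (rule trivialization_eqI[OF t(1)])
         (use t(2) in \<open>simp_all add: fibre_closed_ops trivialization[OF t(1)] trivialization_zero[OF t]\<close>)
  qed
  then show "vertical_lift_at E e (glue_section c F (\<pi> e)) f = 0"
    using z vertical_lift_at_linear(2)[of e e e 0 f] by (simp add: glue_section_def)
qed

lemma glue_section_smooth:
  assumes F: "\<And>j l. l < k \<Longrightarrow> smooth_fun_on (base_atlas E) (D j) (\<lambda>p. coord l (F j p))"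
  shows "smooth_section (glue_section c F)"
  unfolding smooth_section_def
proof (intro conjI glue_section_section ballI)
  fix f assume f: "f \<in> smooth_functions (total_atlas E)"
  let ?g = "\<lambda>j e v. f (frame (D j) (\<Phi> j) (\<pi> e) v)"
  let ?G = "\<lambda>j e. \<Sum>l<k. coord l (F j (\<pi> e)) * frechet_derivative (?g j e) (at (\<Phi> j e)) (b l)"
  have "smooth_fun UNIV (glue c ?G)"
    by (intro glue_smooth smooth_fun_on_sum[OF charted_total trivialization(2)[OF tr]]
        smooth_fun_on_mult[OF charted_total trivialization(2)[OF tr]]
        smooth_fun_base[OF trivialization(1)[OF tr] F] smooth_frame_partial[OF tr smooth_functionsD[OF f]]) simp
  moreover have eq: "glue c ?G e = vertical_lift_at E e (glue_section c F (\<pi> e)) f" for e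
  proof (cases "\<exists>j. \<theta> c j (\<pi> e) \<noteq> 0")
    case True
    then obtain j where j: "\<theta> c j (\<pi> e) \<noteq> 0" by blast
    have p: "\<pi> e \<in> D j" using \<theta>_support[OF j] K(2) by blast
    have "vertical_lift_at E e (frame (D j) (\<Phi> j) (\<pi> e) (F j (\<pi> e))) f = ?G j e"
      using linear_coordinates[OF co frame_derivative_linear[OF tr p smooth_functionsD[OF f]], of "\<Phi> j e" "F j (\<pi> e)"]
      by (subst vertical_lift_at_frame[OF tr p _ f]) (simp_all add: trivialization[OF tr] p)
    then show ?thesis by (simp only: vertical_lift_glue_section(1)[OF j] glue_active[OF j])
  qed (simp add: glue_inactive vertical_lift_glue_section(2))
  ultimately show "smooth_fun UNIV (\<lambda>e. vertical_lift_at E e (glue_section c F (\<pi> e)) f)"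
    by (simp only: eq[abs_def])
qed

text \<open>The components of \<open>\<gamma>\<close> in the \<open>j\<close>-th frame.\<close>

definition coefficient :: "('m \<Rightarrow> ('e \<Rightarrow> real) \<Rightarrow> ('e \<Rightarrow> real) \<Rightarrow> real) \<Rightarrow> nat \<Rightarrow> nat \<Rightarrow> nat \<Rightarrow> 'm \<Rightarrow> real" where
  "coefficient \<gamma> j l m p = \<gamma> p (\<lambda>e. if e \<in> fibre E p then coord l (\<Phi> j e) else 0)
     (\<lambda>e. if e \<in> fibre E p then coord m (\<Phi> j e) else 0)"

text \<open>On the \<open>j\<close>-th set of colour \<open>c\<close> these are \<open>\<theta> e\<^sub>l\<close> and \<open>\<theta> (2 \<Theta>)\<^sup>-\<^sup>1 \<Sum>\<^sub>m \<gamma>\<^sub>l\<^sub>m e\<^sub>m\<close>, where the \<open>e\<^sub>l\<close> are the \<open>j\<close>-th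
  frame and \<open>\<Theta>\<close> is the total weight. The factor \<open>1/2\<close> accounts for each \<open>e\<^sub>l \<and> e\<^sub>m\<close> occurring twice.\<close>

definition left_factor :: "nat \<Rightarrow> nat \<Rightarrow> 'm \<Rightarrow> 'e" where
  "left_factor c l = glue_section c (\<lambda>j p. b l)"

definition right_factor ::
  "('m \<Rightarrow> ('e \<Rightarrow> real) \<Rightarrow> ('e \<Rightarrow> real) \<Rightarrow> real) \<Rightarrow> nat \<Rightarrow> nat \<Rightarrow> 'm \<Rightarrow> 'e" where
  "right_factor \<gamma> c l = glue_section c (\<lambda>j p. \<Sum>m<k. (coefficient \<gamma> j l m p / (2 * total_weight p)) *\<^sub>R b m)"

lemma left_factor_smooth: "smooth_section (left_factor c l)"
  unfolding left_factor_def
  by (rule glue_section_smooth) (simp add: smooth_fun_on_const[OF charted_base trivialization(1)[OF tr]])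

lemma right_factor_smooth:
  assumes \<gamma>: "smooth_bivector_section E \<gamma>" and l: "l < k"
  shows "smooth_section (right_factor \<gamma> c l)"
  unfolding right_factor_def
proof (rule glue_section_smooth)
  fix j m assume m: "m < k"
  note o = trivialization(1)[OF tr[of j]]
  have c: "coord m (\<Sum>m<k. (coefficient \<gamma> j l m p / (2 * total_weight p)) *\<^sub>R b m) = coefficient \<gamma> j l m p / (2 * total_weight p)" for p
  proof -
    have lin: "linear (coord m)" using coordinatesD(1)[OF co m] bounded_linear.linear by blast
    have "coord m (\<Sum>m<k. (coefficient \<gamma> j l m p / (2 * total_weight p)) *\<^sub>R b m) =
       (\<Sum>i<k. if m = i then coefficient \<gamma> j l i p / (2 * total_weight p) else 0)"
      unfolding linear_sum[OF lin] by (intro sum.cong) (simp_all add: linear_cmul[OF lin] coordinatesD(3)[OF co m])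
    then show ?thesis using m by simp
  qed
  have lin: "linear (coord l)" "linear (coord m)"
    using coordinatesD(1)[OF co] l m bounded_linear.linear by blast+
  have "smooth_fun_on (base_atlas E) (D j) (coefficient \<gamma> j l m)"
    using \<gamma> tr[of j] lin unfolding smooth_bivector_section_def coefficient_def[abs_def] by blast
  then show "smooth_fun_on (base_atlas E) (D j)
     (\<lambda>p. coord m (\<Sum>m<k. (coefficient \<gamma> j l m p / (2 * total_weight p)) *\<^sub>R b m))"
    unfolding c using total_weight_pos
    by (intro smooth_fun_on_divide[OF charted_base o] smooth_fun_on_mult[OF charted_base o]
        smooth_fun_on_const[OF charted_base o] smooth_fun_on_subset[OF total_weight_smooth])
       (auto simp: less_imp_neq[symmetric])
qed

text \<open>On a set of colour \<open>c\<close>, the wedges with this colour add up to \<open>\<theta>\<^sup>2 / \<Theta>\<close> times \<open>\<gamma>\<close>: no products of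
  different frames occur, because the sets of one colour are disjoint. Summing over the colours gives
  \<open>\<gamma>\<close>, by the definition of \<open>\<Theta>\<close>.\<close>

lemma vertical_lift_decomposition:
  assumes \<gamma>: "smooth_bivector_section E \<gamma>"
  shows "vertical_lift E \<gamma> e f g = (\<Sum>c\<le>N. \<Sum>l<k.
    wedge (vertical_lift_at E e (left_factor c l (\<pi> e))) (vertical_lift_at E e (right_factor \<gamma> c l (\<pi> e))) f g)"
proof -
  let ?p = "\<pi> e"
  let ?d = "fibre_differential E e"
  have ext: "\<gamma> ?p \<in> exterior_square (fibre_eval E ` fibre E ?p)"
    using \<gamma> by (simp add: smooth_bivector_section_def)
  have dual: "?d f \<in> fibre_dual E ?p" for f
    unfolding fibre_dual_def
    by (auto simp: fibre_differential_def fibre_def fibre_closed_ops vertical_lift_at_linear)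
  have anti: "\<gamma> ?p (?d g) (?d f) = - \<gamma> ?p (?d f) (?d g)"
  proof -
    obtain U \<Psi> where t: "(U, \<Psi>) \<in> bundle_atlas E" "?p \<in> U" using trivialization_obtain .
    show ?thesis by (rule bivector_expansion(2)[OF ext t co dual dual])
  qed
  have colour: "(\<Sum>l<k. wedge (vertical_lift_at E e (left_factor c l ?p)) (vertical_lift_at E e (right_factor \<gamma> c l ?p)) f g)
     = weight c ?p / total_weight ?p * \<gamma> ?p (?d f) (?d g)" for c
  proof (cases "\<exists>j. \<theta> c j ?p \<noteq> 0")
    case False
    then show ?thesis
      by (simp add: weight_inactive left_factor_def right_factor_def wedge_def vertical_lift_glue_section(2))
  next
    case True
    then obtain j where j: "\<theta> c j ?p \<noteq> 0" by blast
    have p: "?p \<in> D j" using \<theta>_support[OF j] K(2) by blast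
    let ?t = "\<theta> c j ?p"
    define V where "V f v = vertical_lift_at E e (frame (D j) (\<Phi> j) ?p v) f" for f v
    have linV: "linear (V f)" for f
      unfolding V_def by (rule linearI)
        (simp_all add: frame_linear[OF tr p] vertical_lift_at_linear trivialization[OF tr] p)
    let ?\<gamma> = "\<lambda>l m. coefficient \<gamma> j l m ?p"
    have lf: "vertical_lift_at E e (left_factor c l ?p) f = ?t * V f (b l)" for l f
      unfolding left_factor_def V_def by (rule vertical_lift_glue_section(1)[OF j])
    have rf: "vertical_lift_at E e (right_factor \<gamma> c l ?p) f =
        ?t * (\<Sum>m<k. ?\<gamma> l m / (2 * total_weight ?p) * V f (b m))" for l f
      unfolding right_factor_def vertical_lift_glue_section(1)[OF j] V_def[symmetric]
      by (simp add: linear_sum[OF linV] linear_cmul[OF linV])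
    have exp: "\<gamma> ?p (?d f) (?d g) = (\<Sum>l<k. \<Sum>m<k. ?\<gamma> l m * (V f (b l) * V g (b m)))" for f g
    proof -
      have "?d f (frame (D j) (\<Phi> j) ?p v) = V f v" for f v
        by (simp add: fibre_differential_def V_def fibre_def trivialization[OF tr] p)
      then show ?thesis
        using bivector_expansion(1)[OF ext tr p co dual dual] by (simp add: coefficient_def)
    qed
    have "(\<Sum>l<k. wedge (vertical_lift_at E e (left_factor c l ?p)) (vertical_lift_at E e (right_factor \<gamma> c l ?p)) f g) =
      (\<Sum>l<k. \<Sum>m<k. ?t\<^sup>2 / (2 * total_weight ?p) * (?\<gamma> l m * (V f (b l) * V g (b m)))
        - ?t\<^sup>2 / (2 * total_weight ?p) * (?\<gamma> l m * (V g (b l) * V f (b m))))"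
      unfolding wedge_def lf rf
      by (intro sum.cong refl) (simp add: sum_distrib_left sum_subtractf power2_eq_square ac_simps)
    also have "\<dots> = ?t\<^sup>2 / (2 * total_weight ?p) * (\<gamma> ?p (?d f) (?d g) - \<gamma> ?p (?d g) (?d f))"
      unfolding exp by (simp only: sum_subtractf sum_distrib_left[symmetric] right_diff_distrib)
    also have "\<dots> = weight c ?p / total_weight ?p * \<gamma> ?p (?d f) (?d g)"
      unfolding anti weight_active[OF j] using total_weight_pos[of ?p] by (simp add: field_simps)
    finally show ?thesis .
  qed
  have "(\<Sum>c\<le>N. weight c ?p / total_weight ?p * \<gamma> ?p (?d f) (?d g)) = \<gamma> ?p (?d f) (?d g)"
    using total_weight_pos[of ?p] by (simp add: total_weight_def flip: sum_distrib_right sum_divide_distrib)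
  then show ?thesis unfolding colour vertical_lift_def by simp
qed

end


theorem proposition2p3:
  fixes E :: "('e::{t2_space,second_countable_topology}, 'm::{t2_space,second_countable_topology},
      'c::real_normed_vector, 'a::real_normed_vector, 'b::real_normed_vector) vbundle"
    and \<gamma> :: "'m \<Rightarrow> ('e \<Rightarrow> real) \<Rightarrow> ('e \<Rightarrow> real) \<Rightarrow> real"
    and U :: "'e set"
  assumes vb_E: "smooth_vector_bundle E"
    and section_\<gamma>: "smooth_bivector_section E \<gamma>"
    and open_U: "open U"
    and zero_section_U: "range (fib_zero E) \<subseteq> U"
  shows "\<exists>(d::nat) (X :: nat \<Rightarrow> 'e vfield) (Y :: nat \<Rightarrow> 'e vfield) (U' :: 'e set).
    (\<forall>i\<in>{1..d}. vector_field (total_atlas E) (X i) \<and> vector_field (total_atlas E) (Y i)) \<and>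
    open U' \<and> range (fib_zero E) \<subseteq> U' \<and> U' \<subseteq> U \<and>
    (\<forall>i\<in>{1..d}. \<forall>e. X i e \<in> vertical_space E e \<and> Y i e \<in> vertical_space E e) \<and>
    (\<forall>i\<in>{1..d}. vf_support (X i) \<subseteq> U \<and> vf_support (Y i) \<subseteq> U) \<and>
    (\<forall>i\<in>{1..d}. \<forall>p. compact (vf_support (X i) \<inter> fibre E p) \<and>
                    compact (vf_support (Y i) \<inter> fibre E p)) \<and>
    (\<forall>i\<in>{1..d}. \<forall>j\<in>{1..d}.
       lie_bracket (X i) (X j) = (\<lambda>e f. 0) \<and>
       lie_bracket (X i) (Y j) = (\<lambda>e f. 0) \<and>
       lie_bracket (Y i) (Y j) = (\<lambda>e f. 0)) \<and>
    (\<forall>i\<in>{1..d}. complete_flow (total_atlas E) (X i) \<and> complete_flow (total_atlas E) (Y i)) \<and>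
    (let \<theta> = (\<lambda>e f g. \<Sum>i=1..d. wedge (X i e) (Y i e) f g) in
       poisson_structure (total_atlas E) \<theta> \<and>
       (\<forall>e. \<theta> e \<in> exterior_square (vertical_space E e)) \<and>
       (\<forall>e\<in>U'. \<theta> e = vertical_lift E \<gamma> e))"
proof -
  interpret smooth_bundle E by unfold_locales (rule vb_E)
  obtain k and b :: "nat \<Rightarrow> 'b" and coord where co: "coordinates k b coord"
    using coordinates_exist[OF fd_fibre] .
  obtain n and b' :: "nat \<Rightarrow> 'a" and coord' where co': "coordinates n b' coord'"
    using coordinates_exist[where 'a = 'a] charted_base by (auto simp: charted_def)
  have "\<forall>p. \<exists>V \<Psi>. (V, \<Psi>) \<in> bundle_atlas E \<and> p \<in> V" using trivialization_obtain by metis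
  then obtain V \<Psi> where V: "\<And>p. (V p, \<Psi> p) \<in> bundle_atlas E" "\<And>p. p \<in> V p" by metis
  obtain \<theta> :: "nat \<Rightarrow> nat \<Rightarrow> 'm \<Rightarrow> real" and K P
    where \<theta>: "\<And>c j. smooth_fun_on (base_atlas E) UNIV (\<theta> c j)" "\<And>c j p. \<theta> c j p \<noteq> 0 \<Longrightarrow> p \<in> K j"
    "\<And>j. compact (K j)" "\<And>j. K j \<subseteq> V (P j)" "\<And>c. locally_finite_on UNIV (\<theta> c)"
    "\<And>c i j p. \<theta> c i p \<noteq> 0 \<Longrightarrow> \<theta> c j p \<noteq> 0 \<Longrightarrow> i = j" "\<And>p. \<exists>c\<le>n. \<exists>j. \<theta> c j p \<noteq> 0"
    by (rule disjoint_families_of_bumps[OF base_manifold co', of V])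
       (use trivialization(1)[OF V(1)] V(2) that in \<open>blast+\<close>)
  have "\<forall>j. \<exists>\<delta>>0. \<forall>e. \<pi> e \<in> K j \<longrightarrow> (\<Sum>l<k. (coord l (\<Psi> (P j) e))\<^sup>2) \<le> \<delta>\<^sup>2 \<longrightarrow> e \<in> U"
    using fibrewise_neighbourhood_radius[OF V(1) co \<theta>(3,4) open_U zero_section_U] by metis
  then obtain \<delta> where radius: "\<And>j. \<delta> j > 0"
    "\<And>j e. \<pi> e \<in> K j \<Longrightarrow> (\<Sum>l<k. (coord l (\<Psi> (P j) e))\<^sup>2) \<le> (\<delta> j)\<^sup>2 \<Longrightarrow> e \<in> U"
    by metis
  interpret framed_bundle E n \<theta> K "\<lambda>j. V (P j)" "\<lambda>j. \<Psi> (P j)" k b coord \<delta>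
    by unfold_locales (fact co V(1) \<theta> radius(1))+
  have ball: "{e. metric e e \<le> 1} \<subseteq> U" using metric_ball radius(2) by blast
  define I where "I = {..n} \<times> {..<k}"
  have "finite I" by (simp add: I_def)
  then obtain h where h: "bij_betw h {1..card I} I" using ex_bij_betw_nat_finite_1 by blast
  define X where "X i = bundle_ball_field metric (left_factor (fst (h i)) (snd (h i)))" for i
  define Y where "Y i = bundle_ball_field metric (right_factor \<gamma> (fst (h i)) (snd (h i)))" for i
  \<comment> \<open>There \<open>cutoff = 1\<close> and \<open>rad = 0\<close>.\<close>
  define W where "W = {e. metric e e < 1 / 4}"
  have L: "smooth_section (left_factor (fst (h i)) (snd (h i)))"
    and R: "smooth_section (right_factor \<gamma> (fst (h i)) (snd (h i)))" if "i \<in> {1..card I}" for i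
  proof -
    have "h i \<in> I" using h that by (auto simp: bij_betw_def)
    then have "snd (h i) < k" by (auto simp: I_def)
    then show "smooth_section (left_factor (fst (h i)) (snd (h i)))"
      "smooth_section (right_factor \<gamma> (fst (h i)) (snd (h i)))"
      using left_factor_smooth right_factor_smooth[OF section_\<gamma>] by auto
  qed
  note S = L[THEN smooth_section_def[THEN iffD1], THEN conjunct1] R[THEN smooth_section_def[THEN iffD1], THEN conjunct1]
  note m = fibre_metric_metric
  have vf: "\<forall>i\<in>{1..card I}. vector_field (total_atlas E) (X i) \<and> vector_field (total_atlas E) (Y i)"
    unfolding X_def Y_def using bundle_ball_field_vector_field[OF m] L R by blast
  have vert: "\<forall>i\<in>{1..card I}. \<forall>e. X i e \<in> vertical_space E e \<and> Y i e \<in> vertical_space E e"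
    unfolding X_def Y_def using bundle_ball_field_vertical S by blast
  have comm: "\<forall>i\<in>{1..card I}. \<forall>j\<in>{1..card I}. lie_bracket (X i) (X j) = (\<lambda>e f. 0) \<and>
       lie_bracket (X i) (Y j) = (\<lambda>e f. 0) \<and> lie_bracket (Y i) (Y j) = (\<lambda>e f. 0)"
    unfolding X_def Y_def using bundle_ball_fields_commute[OF m] L R by blast
  have supp: "\<forall>i\<in>{1..card I}. vf_support (X i) \<subseteq> {e. metric e e \<le> 1} \<and> vf_support (Y i) \<subseteq> {e. metric e e \<le> 1}"
    unfolding X_def Y_def using bundle_ball_field_support[OF m] S by blast
  have compact: "compact (vf_support Z \<inter> fibre E p)" if "vf_support Z \<subseteq> {e. metric e e \<le> 1}" for Z p
  proof -
    have "closed (vf_support Z)" by (simp add: vf_support_def)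
    from compact_Int_closed[OF metric_fibre_compact[of p] this] that
    show ?thesis by (metis (no_types, lifting) Int_absorb1 Int_assoc Int_commute)
  qed
  have complete: "\<forall>i\<in>{1..card I}. complete_flow (total_atlas E) (X i) \<and> complete_flow (total_atlas E) (Y i)"
    unfolding X_def Y_def by (intro ballI conjI bundle_ball_field_complete[OF m] S)
  have W: "open W" "range (fib_zero E) \<subseteq> W" "W \<subseteq> U"
  proof -
    show "open W"
      using m unfolding W_def by (intro open_Collect_less continuous_on_const) (auto simp: fibre_metric_def smooth_fun_on_alt)
    have "metric (fib_zero E p) (fib_zero E p) = 0" for p
    proof -
      have "fib_add E (fib_zero E p) (fib_zero E p) = fib_zero E p"
        using fibres[of p] unfolding fibre_vector_space_def by auto
      moreover have "metric (fib_add E z z) z = metric z z + metric z z" for z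
        using m by (simp add: fibre_metric_def)
      ultimately show ?thesis by (metis add_cancel_right_right)
    qed
    then show "range (fib_zero E) \<subseteq> W" by (auto simp: W_def)
    show "W \<subseteq> U" using ball by (auto simp: W_def)
  qed
  have lift: "(\<Sum>i=1..card I. wedge (X i e) (Y i e) f g) = vertical_lift E \<gamma> e f g" if e: "e \<in> W" for e f g
  proof -
    let ?w = "\<lambda>(c, l). wedge (vertical_lift_at E e (left_factor c l (\<pi> e))) (vertical_lift_at E e (right_factor \<gamma> c l (\<pi> e))) f g"
    have "(\<Sum>i=1..card I. wedge (X i e) (Y i e) f g) = (\<Sum>i=1..card I. ?w (h i))"
    proof (rule sum.cong[OF refl])
      fix i assume i: "i \<in> {1..card I}"
      have q: "metric e e < 1 / 4" using e by (simp add: W_def)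
      show "wedge (X i e) (Y i e) f g = ?w (h i)"
        unfolding X_def Y_def bundle_ball_field_inner[OF S(1)[OF i], of metric, OF q]
          bundle_ball_field_inner[OF S(2)[OF i], of metric, OF q]
        by (simp add: case_prod_unfold)
    qed
    also have "\<dots> = (\<Sum>z\<in>I. ?w z)" by (rule sum.reindex_bij_betw[OF h])
    also have "\<dots> = vertical_lift E \<gamma> e f g"
      unfolding vertical_lift_decomposition[OF section_\<gamma>] I_def by (simp add: sum.cartesian_product)
    finally show ?thesis .
  qed
  show ?thesis
    unfolding Let_def
  proof (rule exI[of _ "card I"], rule exI[of _ X], rule exI[of _ Y], rule exI[of _ W], intro conjI)
    show "\<forall>i\<in>{1..card I}. vf_support (X i) \<subseteq> U \<and> vf_support (Y i) \<subseteq> U" using supp ball by blast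
    show "\<forall>i\<in>{1..card I}. \<forall>p. compact (vf_support (X i) \<inter> fibre E p) \<and> compact (vf_support (Y i) \<inter> fibre E p)"
      using supp compact by blast
    show "poisson_structure (total_atlas E) (\<lambda>e f g. \<Sum>i=1..card I. wedge (X i e) (Y i e) f g)"
      by (rule poisson_sum_commuting_wedges[OF total_manifold vf comm])
    show "\<forall>e. (\<lambda>f g. \<Sum>i=1..card I. wedge (X i e) (Y i e) f g) \<in> exterior_square (vertical_space E e)"
      by (rule allI, rule wedge_sum_exterior_square) (use vert in blast)
    show "\<forall>e\<in>W. (\<lambda>f g. \<Sum>i=1..card I. wedge (X i e) (Y i e) f g) = vertical_lift E \<gamma> e"
      using lift by (auto simp: fun_eq_iff)
  qed (use vf vert comm complete W in blast)+
qed

end
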